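(* The Einstein constant of a Kähler--Einstein submanifold of an indefinite complex space form $(S,g_c)$ of constant holomorphic sectional curvature $2c$ is a rational multiple of $c$.
   Context: A Kähler metric $g$ is Kähler--Einstein (KE) if $\mathrm{Ric}_g=\lambda g$ for a constant $\lambda\in\mathbb{R}$, its Einstein constant. A KE submanifold of $(S,g_c)$ is a complex manifold $M$ with a (positive definite) KE metric $g$ admitting a Kähler immersion into $(S,g_c)$, i.e. a holomorphic map $\varphi:M\to S$ (not required to be injective) with $\varphi^*g_c=g$. An indefinite complex space form $(S,g_c)$ is a finite dimensional complex manifold with an indefinite Kähler metric of constant holomorphic sectional curvature $2c$, $c\in\mathbb{R}$. With $N=\dim_{\mathbb C}S$ and $|z|_s^2=|z_1|^2+\cdots+|z_s|^2-|z_{s+1}|^2-\cdots-|z_N|^2$, the models (to which every such form is locally holomorphically isometric) are: for $c=0$, $\mathbb{C}^N$ with Kähler form $\frac i2\partial\bar\partial|z|_s^2$; for $c>0$, the open set $\mathbb{C}\mathrm{P}^N_s=\{[Z_0,\dots,Z_N]\in\mathbb{C}\mathrm{P}^N: |Z_0|^2+\cdots+|Z_s|^2-|Z_{s+1}|^2-\cdots-|Z_N|^2>0\}$ with Kähler form $\frac ic\partial\bar\partial\log(1+|z|_s^2)$ in the affine chart $Z_0\ne0$, $z_j=Z_j/Z_0$; for $c<0$, $\mathbb{C}\mathrm{H}^N_s=\{z\in\mathbb{C}^N: |z|_s^2<1\}$ with Kähler form $\frac ic\partial\bar\partial\log(1-|z|_s^2)$. *)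

theory Defs
  imports "HOL-Analysis.Analysis"
begin

section \<open>Calculus on open subsets of a Euclidean space\<close>

abbreviation dir_deriv ::
  "('v::euclidean_space \<Rightarrow> 'w::real_normed_vector) \<Rightarrow> 'v \<Rightarrow> 'v \<Rightarrow> 'w" where
  "dir_deriv f x u \<equiv> frechet_derivative f (at x) u"

text \<open>The following two predicates are only meant for open sets \<open>S\<close>.\<close>

primrec C_on :: "nat \<Rightarrow> 'v::euclidean_space set \<Rightarrow> ('v \<Rightarrow> 'w::real_normed_vector) \<Rightarrow> bool" where
  "C_on 0 S f \<longleftrightarrow> continuous_on S f"
| "C_on (Suc k) S f \<longleftrightarrow>
     (\<forall>x\<in>S. f differentiable (at x)) \<and> (\<forall>u. C_on k S (\<lambda>x. dir_deriv f x u))"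

definition smooth_on :: "'v::euclidean_space set \<Rightarrow> ('v \<Rightarrow> 'w::real_normed_vector) \<Rightarrow> bool" where
  "smooth_on S f \<longleftrightarrow> (\<forall>k. C_on k S f)"

abbreviation J :: "complex ^ 'n \<Rightarrow> complex ^ 'n" where
  "J v \<equiv> \<i> *s v"

text \<open>Holomorphic maps of several variables: a complex linear Frechet derivative at every
  point of the open set \<open>S\<close>.\<close>

definition holomorphic_vec_on ::
  "(complex ^ 'n::finite) set \<Rightarrow> (complex ^ 'n \<Rightarrow> complex ^ 'm::finite) \<Rightarrow> bool" where
  "holomorphic_vec_on S f \<longleftrightarrow>
     (\<forall>x\<in>S. \<exists>D. (f has_derivative D) (at x) \<and> (\<forall>v. D (J v) = J (D v)))"


section \<open>Pseudo-Riemannian metrics on open sets and their curvature\<close>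

text \<open>A metric on an open set is a function \<open>G\<close>, where \<open>G x u v\<close> is the inner product at \<open>x\<close>
  of the tangent vectors \<open>u\<close> and \<open>v\<close>; no assumption on the signature is made.\<close>

definition pseudo_riemannian_on ::
  "'v::euclidean_space set \<Rightarrow> ('v \<Rightarrow> 'v \<Rightarrow> 'v \<Rightarrow> real) \<Rightarrow> bool" where
  "pseudo_riemannian_on S G \<longleftrightarrow>
     (\<forall>x\<in>S. bilinear (G x) \<and> (\<forall>u v. G x u v = G x v u) \<and>
            (\<forall>u. (\<forall>v. G x u v = 0) \<longrightarrow> u = 0)) \<and>
     (\<forall>u v. smooth_on S (\<lambda>x. G x u v))"

text \<open>\<open>christoffel G x u v\<close> is the Levi-Civita covariant derivative at \<open>x\<close> of the constant
  vector field \<open>v\<close> in the direction \<open>u\<close>, given by the Koszul formula.\<close>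

definition christoffel ::
  "('v::euclidean_space \<Rightarrow> 'v \<Rightarrow> 'v \<Rightarrow> real) \<Rightarrow> 'v \<Rightarrow> 'v \<Rightarrow> 'v \<Rightarrow> 'v" where
  "christoffel G x u v = (THE w. \<forall>z. 2 * G x w z =
     dir_deriv (\<lambda>y. G y v z) x u + dir_deriv (\<lambda>y. G y u z) x v - dir_deriv (\<lambda>y. G y u v) x z)"

text \<open>Sign convention: \<open>R(u,v)w = \<nabla>\<^sub>u\<nabla>\<^sub>v w - \<nabla>\<^sub>v\<nabla>\<^sub>u w - \<nabla>\<^bsub>[u,v]\<^esub> w\<close>, evaluated on constant
  vector fields, so that round spheres have positive sectional and Ricci curvature.\<close>

definition riemann ::
  "('v::euclidean_space \<Rightarrow> 'v \<Rightarrow> 'v \<Rightarrow> real) \<Rightarrow> 'v \<Rightarrow> 'v \<Rightarrow> 'v \<Rightarrow> 'v \<Rightarrow> 'v" where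
  "riemann G x u v w =
     dir_deriv (\<lambda>y. christoffel G y v w) x u - dir_deriv (\<lambda>y. christoffel G y u w) x v
     + christoffel G x u (christoffel G x v w) - christoffel G x v (christoffel G x u w)"

text \<open>The trace of the endomorphism \<open>u \<mapsto> R(u,v)w\<close> of the real tangent space.\<close>

definition ricci ::
  "('v::euclidean_space \<Rightarrow> 'v \<Rightarrow> 'v \<Rightarrow> real) \<Rightarrow> 'v \<Rightarrow> 'v \<Rightarrow> 'v \<Rightarrow> real" where
  "ricci G x v w = (\<Sum>b\<in>Basis. riemann G x b v w \<bullet> b)"

definition sectional_curvature ::
  "('v::euclidean_space \<Rightarrow> 'v \<Rightarrow> 'v \<Rightarrow> real) \<Rightarrow> 'v \<Rightarrow> 'v \<Rightarrow> 'v \<Rightarrow> real" where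
  "sectional_curvature G x u v =
     G x (riemann G x u v v) u / (G x u u * G x v v - (G x u v)\<^sup>2)"

text \<open>An indefinite Kaehler metric on an open subset of complex coordinate space: invariance
  under the complex structure, and closedness of the form \<open>\<omega>(u,v) = G(Ju,v)\<close>.\<close>

definition kaehler_on ::
  "(complex ^ 'n::finite) set \<Rightarrow> (complex ^ 'n \<Rightarrow> complex ^ 'n \<Rightarrow> complex ^ 'n \<Rightarrow> real) \<Rightarrow> bool" where
  "kaehler_on S G \<longleftrightarrow>
     pseudo_riemannian_on S G \<and>
     (\<forall>x\<in>S. \<forall>u v. G x (J u) (J v) = G x u v) \<and>
     (\<forall>x\<in>S. \<forall>u v w. dir_deriv (\<lambda>y. G y (J v) w) x u + dir_deriv (\<lambda>y. G y (J w) u) x v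
                     + dir_deriv (\<lambda>y. G y (J u) v) x w = 0)"


section \<open>Complex manifolds and Kaehler metrics\<close>

text \<open>A chart is a pair of its domain and its coordinate map; the values of the map outside the
  domain are irrelevant. The dimension is the (positive) cardinality of the type \<open>'n\<close>.\<close>

type_synonym ('a, 'n) chart = "'a set \<times> ('a \<Rightarrow> complex ^ 'n)"

definition local_rep ::
  "('a, 'n::finite) chart \<Rightarrow> ('b, 'm::finite) chart \<Rightarrow> ('a \<Rightarrow> 'b) \<Rightarrow> complex ^ 'n \<Rightarrow> complex ^ 'm" where
  "local_rep c d f = snd d \<circ> f \<circ> inv_into (fst c) (snd c)"

definition holomorphic_in_charts ::
  "('a, 'n::finite) chart set \<Rightarrow> ('b, 'm::finite) chart set \<Rightarrow> ('a \<Rightarrow> 'b) \<Rightarrow> bool" where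
  "holomorphic_in_charts A B f \<longleftrightarrow>
     (\<forall>c\<in>A. \<forall>d\<in>B. holomorphic_vec_on (snd c ` (fst c \<inter> f -` fst d)) (local_rep c d f))"

text \<open>\<open>local_rep c d id\<close> is the transition map from \<open>c\<close> to \<open>d\<close>, so the last condition below says
  that all transition maps are holomorphic. Connectedness is not required.\<close>

definition complex_manifold :: "'a topology \<Rightarrow> ('a, 'n::finite) chart set \<Rightarrow> bool" where
  "complex_manifold X A \<longleftrightarrow>
     topspace X \<noteq> {} \<and> Hausdorff_space X \<and> second_countable X \<and>
     (\<Union>c\<in>A. fst c) = topspace X \<and>
     (\<forall>(U, \<phi>)\<in>A. openin X U \<and> open (\<phi> ` U) \<and>
                 homeomorphic_map (subtopology X U) (top_of_set (\<phi> ` U)) \<phi>) \<and>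
     holomorphic_in_charts A A id"

definition holomorphic_map ::
  "'a topology \<Rightarrow> ('a, 'n::finite) chart set \<Rightarrow> 'b topology \<Rightarrow> ('b, 'm::finite) chart set \<Rightarrow>
   ('a \<Rightarrow> 'b) \<Rightarrow> bool" where
  "holomorphic_map X A Y B f \<longleftrightarrow> continuous_map X Y f \<and> holomorphic_in_charts A B f"

text \<open>A metric on a manifold is given by its coordinate expressions \<open>g c\<close> in the charts \<open>c\<close> of the
  atlas; \<open>g c x u v\<close> is only meaningful for \<open>x\<close> in the image of \<open>c\<close>.\<close>

type_synonym ('a, 'n) metric =
  "('a, 'n) chart \<Rightarrow> complex ^ 'n \<Rightarrow> complex ^ 'n \<Rightarrow> complex ^ 'n \<Rightarrow> real"

text \<open>The equation \<open>f\<^sup>*h = g\<close>, written in charts.\<close>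

definition pullback_eq ::
  "('a, 'n::finite) chart set \<Rightarrow> ('a, 'n) metric \<Rightarrow> ('b, 'm::finite) chart set \<Rightarrow> ('b, 'm) metric \<Rightarrow>
   ('a \<Rightarrow> 'b) \<Rightarrow> bool" where
  "pullback_eq A g B h f \<longleftrightarrow>
     (\<forall>c\<in>A. \<forall>d\<in>B. \<forall>p \<in> fst c \<inter> f -` fst d. \<forall>u v.
        g c (snd c p) u v =
        h d (snd d (f p)) (dir_deriv (local_rep c d f) (snd c p) u)
                          (dir_deriv (local_rep c d f) (snd c p) v))"

text \<open>The last condition is the transformation law of the coordinate expressions under
  transition maps.\<close>

definition indefinite_kaehler_manifold ::
  "'a topology \<Rightarrow> ('a, 'n::finite) chart set \<Rightarrow> ('a, 'n) metric \<Rightarrow> bool" where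
  "indefinite_kaehler_manifold X A g \<longleftrightarrow>
     complex_manifold X A \<and> (\<forall>c\<in>A. kaehler_on (snd c ` fst c) (g c)) \<and> pullback_eq A g A g id"

definition kaehler_manifold ::
  "'a topology \<Rightarrow> ('a, 'n::finite) chart set \<Rightarrow> ('a, 'n) metric \<Rightarrow> bool" where
  "kaehler_manifold X A g \<longleftrightarrow>
     indefinite_kaehler_manifold X A g \<and>
     (\<forall>c\<in>A. \<forall>x \<in> snd c ` fst c. \<forall>v. v \<noteq> 0 \<longrightarrow> g c x v v > 0)"

definition kaehler_einstein ::
  "'a topology \<Rightarrow> ('a, 'n::finite) chart set \<Rightarrow> ('a, 'n) metric \<Rightarrow> real \<Rightarrow> bool" where
  "kaehler_einstein X A g \<Lambda> \<longleftrightarrow>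
     kaehler_manifold X A g \<and>
     (\<forall>c\<in>A. \<forall>x \<in> snd c ` fst c. \<forall>u v. ricci (g c) x u v = \<Lambda> * g c x u v)"

text \<open>The plane spanned by \<open>v\<close> and \<open>J v\<close> is nondegenerate iff \<open>v\<close> is not a null vector, and the
  holomorphic sectional curvature is defined for such \<open>v\<close> only. The signature is arbitrary, so
  definite space forms are included.\<close>

definition indefinite_complex_space_form ::
  "'a topology \<Rightarrow> ('a, 'n::finite) chart set \<Rightarrow> ('a, 'n) metric \<Rightarrow> real \<Rightarrow> bool" where
  "indefinite_complex_space_form X A g c \<longleftrightarrow>
     indefinite_kaehler_manifold X A g \<and>
     (\<forall>d\<in>A. \<forall>x \<in> snd d ` fst d. \<forall>v. g d x v v \<noteq> 0 \<longrightarrow>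
        sectional_curvature (g d) x v (J v) = 2 * c)"

definition kaehler_immersion ::
  "'a topology \<Rightarrow> ('a, 'n::finite) chart set \<Rightarrow> ('a, 'n) metric \<Rightarrow>
   'b topology \<Rightarrow> ('b, 'm::finite) chart set \<Rightarrow> ('b, 'm) metric \<Rightarrow> ('a \<Rightarrow> 'b) \<Rightarrow> bool" where
  "kaehler_immersion X A g Y B h f \<longleftrightarrow> holomorphic_map X A Y B f \<and> pullback_eq A g B h f"

end

(*
Restrict everything to the disc t |-> p + t e in a chart of M. In the flat case the pulled back metric,
and in the curved case the ambient Hermitian form of the space form, satisfies a linear equation
W_t = N W with holomorphic N along the disc, so W = X H X^* is a finite sum of products of holomorphic
and antiholomorphic functions. Its restriction to the tangent space of M has determinant E with the
same property, and the Einstein equation turns into a relation between mixed logarithmic derivatives: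
  (log E)_{t s} = beta (log P)_{t s},   beta = (n + 1) - Lambda / c   (c nonzero),
  (log E)_{t s} = -(Lambda / 2) rho                                   (c = 0),
where s replaces the conjugate of t and P, rho are finite sums of the same kind.
The functions of t occurring here generate a countable dimensional algebra. Applying a character of
this algebra turns the relation into an equation for holomorphic functions of s. If beta is irrational,
comparing orders of zeros shows that the images of P have no zeros, for every character, which forces
P to split as a product p(t) q(s) because nonconstant elements of the algebra take unbounded values on
characters; this contradicts the positivity of the metric. Similarly Lambda = 0 if c = 0.
*)
theory Submission
  imports Defs "HOL-Complex_Analysis.Complex_Analysis" "HOL-Library.Function_Algebras"
    "HOL-Computational_Algebra.Fundamental_Theorem_Algebra"
begin

section \<open>Characters of countable algebras of functions\<close>

text \<open>Points t of a small disc give no information, as neither E nor P vanishes there.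
  Characters play the role of points beyond it. Under each of them E(t,s)/E(t,0) and P(t,s)/P(t,0)
  become functions H and F of s with F(0) = H(0) = 1 and H'/H = beta F'/F + v, v holomorphic. At a
  zero of F this forces ord H = beta ord F. Countable dimension takes the place of algebraicity: it
  yields a Nullstellensatz and the unbounded values. Characters at which the coefficients of F blow
  up give, after rescaling, zero free functions converging to a nonzero one that vanishes at s = 0,
  which Hurwitz's theorem forbids.

  In the curved case the metric is, up to a factor, a mixed derivative of log P and need not be a
  finite sum itself. Hence the ambient form, whose entries are P and its derivatives. Its
  restriction to M has determinant E = const P^(n+1) det g, and on the diagonal (log P)_{ts} = (c/2)
  rho and (log det g)_{ts} = -(Lambda/2) rho; this is the origin of beta. In the flat case the
  logarithmic derivative of E has no denominators, so zero free images come from a linear equation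
  for every value of Lambda.\<close>

definition algebra_of_functions :: "('s \<Rightarrow> complex) set \<Rightarrow> bool" where
  "algebra_of_functions A \<longleftrightarrow> (\<forall>c. (\<lambda>_. c) \<in> A) \<and>
     (\<forall>f\<in>A. \<forall>g\<in>A. (\<lambda>t. f t + g t) \<in> A \<and> (\<lambda>t. f t * g t) \<in> A)"

definition proper_ideal :: "('s \<Rightarrow> complex) set \<Rightarrow> ('s \<Rightarrow> complex) set \<Rightarrow> bool" where
  "proper_ideal A I \<longleftrightarrow> I \<subseteq> A \<and> (\<lambda>_. 0) \<in> I \<and> (\<forall>f\<in>I. \<forall>g\<in>I. (\<lambda>t. f t + g t) \<in> I) \<and>
     (\<forall>f\<in>A. \<forall>g\<in>I. (\<lambda>t. f t * g t) \<in> I) \<and> (\<lambda>_. 1) \<notin> I"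

definition prime_in :: "('s \<Rightarrow> complex) set \<Rightarrow> ('s \<Rightarrow> complex) set \<Rightarrow> bool" where
  "prime_in A I \<longleftrightarrow> (\<forall>f\<in>A. \<forall>g\<in>A. (\<lambda>t. f t * g t) \<in> I \<longrightarrow> f \<in> I \<or> g \<in> I)"

text \<open>Complex linearity is contained in the conditions: scalars are the constant functions,
  whose values are prescribed, and products are respected.\<close>

definition character_on :: "('s \<Rightarrow> complex) set \<Rightarrow> (('s \<Rightarrow> complex) \<Rightarrow> complex) \<Rightarrow> bool" where
  "character_on A x \<longleftrightarrow> (\<forall>c. x (\<lambda>_. c) = c) \<and>
     (\<forall>f\<in>A. \<forall>g\<in>A. x (\<lambda>t. f t + g t) = x f + x g \<and> x (\<lambda>t. f t * g t) = x f * x g)"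

lemma character_onD:
  assumes "character_on A x"
  shows "x (\<lambda>_. c) = c" "f \<in> A \<Longrightarrow> g \<in> A \<Longrightarrow> x (\<lambda>t. f t + g t) = x f + x g"
    "f \<in> A \<Longrightarrow> g \<in> A \<Longrightarrow> x (\<lambda>t. f t * g t) = x f * x g"
  using assms by (auto simp: character_on_def)

text \<open>Countable dimension of an algebra is expressed below as inclusion in
  \<open>complex_fun.span E\<close> for a countable \<open>E\<close>.\<close>

interpretation complex_fun: vector_space "\<lambda>(c::complex) (f :: 's \<Rightarrow> complex) t. c * f t"
  by unfold_locales (auto simp: fun_eq_iff algebra_simps)

lemma algebra_of_functionsD:
  assumes "algebra_of_functions A"
  shows "(\<lambda>_. c) \<in> A" "f \<in> A \<Longrightarrow> g \<in> A \<Longrightarrow> (\<lambda>t. f t + g t) \<in> A"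
    "f \<in> A \<Longrightarrow> g \<in> A \<Longrightarrow> (\<lambda>t. f t * g t) \<in> A" "f \<in> A \<Longrightarrow> (\<lambda>t. c * f t) \<in> A"
    "f \<in> A \<Longrightarrow> g \<in> A \<Longrightarrow> (\<lambda>t. f t - g t) \<in> A" "f \<in> A \<Longrightarrow> (\<lambda>t. f t - c) \<in> A"
proof -
  show c: "(\<lambda>_. c) \<in> A" for c using assms unfolding algebra_of_functions_def by blast
  show a: "f \<in> A \<Longrightarrow> g \<in> A \<Longrightarrow> (\<lambda>t. f t + g t) \<in> A" for f g 
    using assms unfolding algebra_of_functions_def by blast
  show m: "f \<in> A \<Longrightarrow> g \<in> A \<Longrightarrow> (\<lambda>t. f t * g t) \<in> A" for f g 
    using assms unfolding algebra_of_functions_def by blast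
  show m': "f \<in> A \<Longrightarrow> (\<lambda>t. c * f t) \<in> A" for f c using m[OF c[of c]] .
  show d: "f \<in> A \<Longrightarrow> g \<in> A \<Longrightarrow> (\<lambda>t. f t - g t) \<in> A" for f g 
    using a[OF _ m'[of g "-1"], of f] by simp
  show "f \<in> A \<Longrightarrow> (\<lambda>t. f t - c) \<in> A" using d[OF _ c] .
qed

lemma algebra_of_functions_sum:
  assumes "algebra_of_functions A" "finite F" "\<And>i. i \<in> F \<Longrightarrow> f i \<in> A"
  shows "(\<lambda>t. \<Sum>i\<in>F. f i t) \<in> A"
  using assms(2,3)
proof (induction rule: finite_induct)
  case (insert i F)
  then have "f i \<in> A" "(\<lambda>t. \<Sum>i\<in>F. f i t) \<in> A" by auto
  from algebra_of_functionsD(2)[OF assms(1) this] show ?case using insert.hyps by simp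
qed (simp add: algebra_of_functionsD(1)[OF assms(1)])

lemma algebra_of_functions_prod:
  assumes "algebra_of_functions A" "finite F" "\<And>i. i \<in> F \<Longrightarrow> f i \<in> A"
  shows "(\<lambda>t. \<Prod>i\<in>F. f i t) \<in> A"
  using assms(2,3)
proof (induction rule: finite_induct)
  case (insert i F)
  then have "f i \<in> A" "(\<lambda>t. \<Prod>i\<in>F. f i t) \<in> A" by auto
  from algebra_of_functionsD(3)[OF assms(1) this] show ?case using insert.hyps by simp
qed (simp add: algebra_of_functionsD(1)[OF assms(1)])

lemma algebra_of_functions_poly:
  assumes "algebra_of_functions A" "a \<in> A"
  shows "(\<lambda>t. poly q (a t)) \<in> A"
proof (induction q)
  case (pCons c q)
  then show ?case
    using algebra_of_functionsD(2)[OF assms(1) algebra_of_functionsD(1)[OF assms(1)]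
        algebra_of_functionsD(3)[OF assms(1) assms(2) pCons.IH], of c] by simp
qed (simp add: algebra_of_functionsD(1)[OF assms(1)])

lemma proper_idealD:
  assumes "algebra_of_functions A" "proper_ideal A I"
  shows "f \<in> I \<Longrightarrow> f \<in> A" "(\<lambda>_. 0) \<in> I" "f \<in> I \<Longrightarrow> g \<in> I \<Longrightarrow> (\<lambda>t. f t + g t) \<in> I"
    "f \<in> A \<Longrightarrow> g \<in> I \<Longrightarrow> (\<lambda>t. f t * g t) \<in> I" "f \<in> I \<Longrightarrow> (\<lambda>t. c * f t) \<in> I"
    "f \<in> I \<Longrightarrow> g \<in> I \<Longrightarrow> (\<lambda>t. f t - g t) \<in> I" "(\<lambda>_. c) \<in> I \<longleftrightarrow> c = 0"
proof -
  show "f \<in> I \<Longrightarrow> f \<in> A" using assms by (auto simp: proper_ideal_def)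
  show z: "(\<lambda>_. 0) \<in> I" using assms by (auto simp: proper_ideal_def)
  show a: "f \<in> I \<Longrightarrow> g \<in> I \<Longrightarrow> (\<lambda>t. f t + g t) \<in> I" for f g
    using assms by (auto simp: proper_ideal_def)
  show m: "f \<in> A \<Longrightarrow> g \<in> I \<Longrightarrow> (\<lambda>t. f t * g t) \<in> I" for f g
    using assms by (auto simp: proper_ideal_def)
  show m': "f \<in> I \<Longrightarrow> (\<lambda>t. c * f t) \<in> I" for f c
    using m[OF algebra_of_functionsD(1)[OF assms(1)]] .
  show "f \<in> I \<Longrightarrow> g \<in> I \<Longrightarrow> (\<lambda>t. f t - g t) \<in> I"
    using a[OF _ m'[of g "-1"], of f] by simp
  show "(\<lambda>_. c) \<in> I \<longleftrightarrow> c = 0" 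
  proof
    assume "(\<lambda>_. c) \<in> I"
    then have "(\<lambda>_. 1 / c * c) \<in> I" by (rule m')
    then show "c = 0" using assms(2) by (cases "c = 0") (auto simp: proper_ideal_def)
  qed (use z in auto)
qed

lemma proper_ideal_sum:
  assumes "algebra_of_functions A" "proper_ideal A I" "finite F" "\<And>i. i \<in> F \<Longrightarrow> f i \<in> I"
  shows "(\<lambda>t. \<Sum>i\<in>F. f i t) \<in> I"
  using assms(3,4)
proof (induction rule: finite_induct)
  case (insert i F)
  then have "f i \<in> I" "(\<lambda>t. \<Sum>i\<in>F. f i t) \<in> I" by auto
  from proper_idealD(3)[OF assms(1,2) this] show ?case using insert.hyps by simp
qed (simp add: proper_idealD(2)[OF assms(1,2)])

text \<open>Over the complex numbers \<open>q\<close> splits into linear factors, and a prime ideal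
  containing a product contains a factor. A nonzero constant cannot be that factor, since the ideal
  is proper.\<close>

lemma prime_ideal_linear_factor:
  assumes A: "algebra_of_functions A" and I: "proper_ideal A I" "prime_in A I" and "a \<in> A"
    and "q \<noteq> 0" "(\<lambda>t. poly q (a t)) \<in> I"
  shows "\<exists>\<mu>. (\<lambda>t. a t - \<mu>) \<in> I"
  using assms(5,6)
proof (induction "degree q" arbitrary: q)
  case 0
  then obtain c where "q = [:c:]" using degree_eq_zeroE by metis
  with 0 show ?case using proper_idealD(7)[OF A I(1), of c] by simp
next
  case (Suc n)
  then obtain z where z: "poly q z = 0" using fundamental_theorem_of_algebra_alt[of q] by force
  then obtain r where r: "q = [:-z, 1:] * r" by (metis poly_eq_0_iff_dvd dvdE)
  have r0: "r \<noteq> 0" using r Suc.prems by auto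
  have d: "degree r = n" using Suc.hyps r r0 by (simp del: mult_pCons_left add: degree_mult_eq)
  have f: "(\<lambda>t. (a t - z) * poly r (a t)) \<in> I" using Suc.prems r by (simp add: algebra_simps)
  have m: "(\<lambda>t. a t - z) \<in> A" "(\<lambda>t. poly r (a t)) \<in> A"
    by (intro algebra_of_functionsD(6)[OF A] algebra_of_functions_poly[OF A] \<open>a \<in> A\<close>)+
  have "(\<lambda>t. a t - z) \<in> I \<or> (\<lambda>t. poly r (a t)) \<in> I"
    using I(2)[unfolded prime_in_def, rule_format, OF m f] .
  then show ?case using Suc.hyps(1)[OF d[symmetric] r0] by blast
qed

text \<open>A family larger than a spanning set is dependent. The family \<open>b\<close> may repeat
  a value, in which case two coefficients 1 and -1 give the relation directly.\<close>

lemma nontrivial_relation: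
  fixes b :: "complex \<Rightarrow> 's \<Rightarrow> complex"
  assumes "finite F" "finite E" "card E < card F" "\<And>l. l \<in> F \<Longrightarrow> b l \<in> complex_fun.span E"
  shows "\<exists>c. (\<exists>l\<in>F. c l \<noteq> 0) \<and> (\<forall>t. (\<Sum>l\<in>F. c l * b l t) = 0)"
proof (cases "inj_on b F")
  case False
  then obtain l m where lm: "l \<in> F" "m \<in> F" "l \<noteq> m" "b l = b m" by (auto simp: inj_on_def)
  have "(\<Sum>k\<in>F. (if k = l then 1 else if k = m then -1 else 0) * b k t) = 0" for t
  proof -
    have "(\<Sum>k\<in>F. (if k = l then 1 else if k = m then -1 else 0) * b k t) =
      (\<Sum>k\<in>F. (if k = l then b k t else 0) - (if k = m then b k t else 0))"
      using lm by (intro sum.cong) auto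
    also have "\<dots> = 0" using lm assms(1) by (simp add: sum_subtractf)
    finally show ?thesis .
  qed
  then show ?thesis using lm by (intro exI[of _ "\<lambda>k. if k = l then 1 else if k = m then -1 else 0"]) auto
next
  case True
  have "complex_fun.dependent (b ` F)"
  proof (rule ccontr)
    assume "\<not> complex_fun.dependent (b ` F)"
    then have "card (b ` F) \<le> card E"
      using complex_fun.independent_span_bound[OF assms(2)] assms(4) by blast
    with True assms(3) show False by (simp add: card_image)
  qed
  then obtain u where u: "\<exists>v\<in>b ` F. u v \<noteq> 0" "(\<Sum>v\<in>b ` F. (\<lambda>t. u v * v t)) = 0"
    using assms(1) by (auto simp: complex_fun.dependent_finite)
  have "(\<Sum>l\<in>F. u (b l) * b l t) = 0" for t
  proof -
    have s: "(\<Sum>v\<in>S. (\<lambda>t. u v * v t)) t = (\<Sum>v\<in>S. u v * v t)" for S :: "('s \<Rightarrow> complex) set"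
      by (induction S rule: infinite_finite_induct) auto
    have "(\<Sum>v\<in>b ` F. u v * v t) = 0" using fun_cong[OF u(2), of t] by (simp add: s)
    then show ?thesis using True by (simp add: sum.reindex)
  qed
  then show ?thesis using u(1) by (intro exI[of _ "\<lambda>l. u (b l)"]) auto
qed

text \<open>Here \<open>b\<close> is the resolvent, \<open>q\<close> the factor
  \<open>a t - l\<close> and \<open>p\<close> the product of the other factors. The left side is a
  multiple of \<open>b * q - 1\<close>, an element of the ideal, so both terms on the right agree
  modulo the ideal.\<close>

lemma resolvent_identity: "(- c * p) * (b * q - 1) = c * p - (c * b) * (q * p)" for c p b q :: complex
  by (simp add: algebra_simps)

text \<open>Amitsur's trick: resolvents are linearly independent, so an algebra of countable dimension
  cannot contain uncountably many of them.\<close>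

lemma countable_resolvents:
  assumes A: "algebra_of_functions A" and E: "countable E" "A \<subseteq> complex_fun.span E"
    and I: "proper_ideal A I" "prime_in A I" and "a \<in> A" and L: "uncountable L"
    and res: "\<And>l. l \<in> L \<Longrightarrow> \<exists>b\<in>A. (\<lambda>t. b t * (a t - l) - 1) \<in> I"
  shows "\<exists>\<mu>. (\<lambda>t. a t - \<mu>) \<in> I"
proof -
  obtain b where b: "\<And>l. l \<in> L \<Longrightarrow> b l \<in> A" "\<And>l. l \<in> L \<Longrightarrow> (\<lambda>t. b l t * (a t - l) - 1) \<in> I"
    using res by metis
  have Ene: "E \<noteq> {}"
  proof
    assume "E = {}"
    then have "(\<lambda>_. 1) = (0 :: 'a \<Rightarrow> complex)" using E(2) algebra_of_functionsD(1)[OF A, of 1] by auto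
    then show False by (auto simp: fun_eq_iff)
  qed
  \<comment> \<open>Finite initial segments of \<open>E\<close>. Every resolvent lies in the span of
    one of them, so by uncountability of \<open>L\<close> a single segment serves infinitely many
    resolvents, more than its size.\<close>
  define En where "En n = from_nat_into E ` {..<n}" for n
  have "\<exists>n. b l \<in> complex_fun.span (En n)" if "l \<in> L" for l
  proof -
    have "b l \<in> complex_fun.span E" using b(1)[OF that] E(2) by auto
    then obtain S r where S': "finite S" "S \<subseteq> E" "b l = (\<Sum>s\<in>S. (\<lambda>t. r s * s t))"
      unfolding complex_fun.span_explicit by blast
    have "b l \<in> complex_fun.span S"
      unfolding S'(3) by (intro complex_fun.span_sum complex_fun.span_scale complex_fun.span_base)
    note S = S'(1,2) this
    define n where "n = Suc (Max (to_nat_on E ` S))"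
    have "S \<subseteq> En n"
    proof
      fix s assume "s \<in> S"
      then have "to_nat_on E s < n" using S(1) by (auto simp: n_def less_Suc_eq_le)
      moreover have "from_nat_into E (to_nat_on E s) = s" using \<open>s \<in> S\<close> S(2) E(1) by (intro from_nat_into_to_nat_on) auto
      ultimately show "s \<in> En n" unfolding En_def by force
    qed
    then show ?thesis using S(3) complex_fun.span_mono by blast
  qed
  then have "L = (\<Union>n. {l\<in>L. b l \<in> complex_fun.span (En n)})" by auto
  then have "\<not> countable (\<Union>n. {l\<in>L. b l \<in> complex_fun.span (En n)})" using L by argo
  then obtain n where "uncountable {l\<in>L. b l \<in> complex_fun.span (En n)}"
    using countable_UN[of UNIV "\<lambda>n. {l\<in>L. b l \<in> complex_fun.span (En n)}", OF countableI_type] by blast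
  then have "infinite {l\<in>L. b l \<in> complex_fun.span (En n)}" using countable_finite by blast
  then obtain F where F: "finite F" "card F = Suc (card (En n))"
      "F \<subseteq> {l\<in>L. b l \<in> complex_fun.span (En n)}"
    using infinite_arbitrarily_large by blast
  obtain c where c: "\<exists>l\<in>F. c l \<noteq> 0" "\<And>t. (\<Sum>l\<in>F. c l * b l t) = 0"
    using nontrivial_relation[OF F(1), of "En n" b] F by (auto simp: En_def)
  \<comment> \<open>The relation between the \<open>b l\<close>, multiplied by all the
    \<open>a - m\<close>: modulo \<open>I\<close> the product with \<open>b l\<close> loses the
    factor \<open>a - l\<close>.\<close>
  define q where "q = (\<Sum>l\<in>F. smult (c l) (\<Prod>m\<in>F - {l}. [:-m, 1:]))"
  have pq: "poly q z = (\<Sum>l\<in>F. c l * (\<Prod>m\<in>F - {l}. z - m))" for z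
    by (simp add: q_def poly_sum poly_prod)
  have "q \<noteq> 0"
  proof -
    obtain l where l: "l \<in> F" "c l \<noteq> 0" using c(1) by auto
    \<comment> \<open>At an \<open>l\<close> with nonzero coefficient every term of another index
      contains the factor \<open>l - l\<close>.\<close>
    have "poly q l = (\<Sum>k\<in>F. if k = l then c l * (\<Prod>m\<in>F - {l}. l - m) else 0)"
      unfolding pq using l F(1) by (intro sum.cong) auto
    also have "\<dots> \<noteq> 0" using l F(1) by simp
    finally show ?thesis by auto
  qed
  moreover have "(\<lambda>t. poly q (a t)) \<in> I"
  proof -
    define g where "g l t = (- c l * (\<Prod>m\<in>F - {l}. a t - m)) * (b l t * (a t - l) - 1)" for l t
    have gI: "g l \<in> I" if "l \<in> F" for l
    proof -
      have "(\<lambda>t. - c l * (\<Prod>m\<in>F - {l}. a t - m)) \<in> A"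
        by (intro algebra_of_functionsD(4)[OF A] algebra_of_functions_prod[OF A] algebra_of_functionsD(6)[OF A])
          (use F \<open>a \<in> A\<close> in auto)
      then show ?thesis unfolding g_def
        using proper_idealD(4)[OF A I(1)] b(2) that F(3) by blast
    qed
    have "poly q (a t) = (\<Sum>l\<in>F. g l t)" for t
    proof -
      have "g l t = c l * (\<Prod>m\<in>F - {l}. a t - m) - (c l * b l t) * (\<Prod>m\<in>F. a t - m)" if "l \<in> F" for l
      proof -
        have key: "(\<Prod>m\<in>F. a t - m) = (a t - l) * (\<Prod>m\<in>F - {l}. a t - m)"
          using prod.remove[OF F(1) that, of "\<lambda>m. a t - m"] .
        show ?thesis unfolding g_def key by (rule resolvent_identity)
      qed
      then have "(\<Sum>l\<in>F. g l t) = poly q (a t) - (\<Sum>l\<in>F. c l * b l t) * (\<Prod>m\<in>F. a t - m)"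
        by (simp add: pq sum_subtractf sum_distrib_right)
      then show ?thesis using c(2) by simp
    qed
    then show ?thesis using proper_ideal_sum[OF A I(1) F(1) gI] by simp
  qed
  ultimately show ?thesis by (rule prime_ideal_linear_factor[OF A I \<open>a \<in> A\<close>])
qed

text \<open>The extension is the ideal generated by \<open>I\<close> and \<open>a\<close>. If it
  contained 1, written as \<open>b * a + i\<close>, then \<open>b\<close> would invert
  \<open>a\<close> modulo \<open>I\<close>.\<close>

lemma ideal_extension:
  assumes A: "algebra_of_functions A" and I: "proper_ideal A I" and "a \<in> A"
    and no_inv: "\<not> (\<exists>b\<in>A. (\<lambda>t. b t * a t - 1) \<in> I)"
  shows "\<exists>K. proper_ideal A K \<and> I \<subseteq> K \<and> a \<in> K"
proof -
  note AD = algebra_of_functionsD[OF A] and ID = proper_idealD[OF A I]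
  define K where "K = {f. \<exists>b\<in>A. \<exists>i\<in>I. \<forall>t. f t = b t * a t + i t}"
  have KI: "f \<in> K" if "b \<in> A" "i \<in> I" "\<And>t. f t = b t * a t + i t" for f b i
    unfolding K_def by (intro CollectI bexI[of _ b] bexI[of _ i] allI that)
  have KE: "\<exists>b i. b \<in> A \<and> i \<in> I \<and> (\<forall>t. f t = b t * a t + i t)" if "f \<in> K" for f
    using that unfolding K_def Bex_def by simp
  have "proper_ideal A K"
    unfolding proper_ideal_def
  proof (intro conjI ballI)
    show "K \<subseteq> A"
    proof
      fix f assume "f \<in> K"
      then obtain b i where b: "b \<in> A" "i \<in> I" "\<forall>t. f t = b t * a t + i t" using KE by blast
      have "f = (\<lambda>t. b t * a t + i t)" using b(3) by (intro ext) simp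
      then show "f \<in> A" using AD(2)[OF AD(3)[OF b(1) \<open>a \<in> A\<close>] ID(1)[OF b(2)]] by simp
    qed
    show "(\<lambda>_. 0) \<in> K" by (rule KI[OF AD(1)[of 0] ID(2)]) simp
    show "(\<lambda>_. 1) \<notin> K"
    proof
      assume "(\<lambda>_. 1) \<in> K"
      then obtain b i where b: "b \<in> A" "i \<in> I" "\<forall>t. 1 = b t * a t + i t" using KE by blast
      have "b t * a t - 1 = (-1) * i t" for t using b(3)[rule_format, of t] by (simp add: algebra_simps)
      then have "(\<lambda>t. b t * a t - 1) \<in> I" using ID(5)[OF b(2), of "-1"] by presburger
      with b(1) no_inv show False by blast
    qed
    fix f g assume f: "f \<in> K" and g: "g \<in> K"
    obtain b i where b: "b \<in> A" "i \<in> I" "\<forall>t. f t = b t * a t + i t" using KE[OF f] by blast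
    obtain b' i' where b': "b' \<in> A" "i' \<in> I" "\<forall>t. g t = b' t * a t + i' t" using KE[OF g] by blast
    show "(\<lambda>t. f t + g t) \<in> K"
      by (rule KI[OF AD(2)[OF b(1) b'(1)] ID(3)[OF b(2) b'(2)]]) (simp add: b(3) b'(3) algebra_simps)
  next
    fix f g assume f: "f \<in> A" and g: "g \<in> K"
    obtain b i where b: "b \<in> A" "i \<in> I" "\<forall>t. g t = b t * a t + i t" using KE[OF g] by blast
    show "(\<lambda>t. f t * g t) \<in> K"
      by (rule KI[OF AD(3)[OF f b(1)] ID(4)[OF f b(2)]]) (simp add: b(3) algebra_simps)
  qed
  moreover have "I \<subseteq> K" by (auto intro!: KI[OF AD(1)[of 0]])
  moreover have "a \<in> K" by (rule KI[OF AD(1)[of 1] ID(2)]) simp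
  ultimately show ?thesis by blast
qed

text \<open>A Nullstellensatz in countable dimension. Zorn's lemma gives a maximal ideal
  \<open>K\<close> above \<open>I\<close>, and elements outside \<open>K\<close> are invertible
  modulo \<open>K\<close>. If no \<open>a - \<mu>\<close> were in \<open>K\<close>, all resolvents
  of \<open>a\<close> would exist, against \<open>countable_resolvents\<close>. So each
  \<open>a\<close> is congruent to a number, which is the value of the character.\<close>

lemma exists_character:
  assumes A: "algebra_of_functions A" and E: "countable E" "A \<subseteq> complex_fun.span E"
    and I: "proper_ideal A I"
  shows "\<exists>x. character_on A x \<and> (\<forall>f\<in>I. x f = 0)"
proof -
  note AD = algebra_of_functionsD[OF A]
  define Z where "Z = {K. proper_ideal A K \<and> I \<subseteq> K}"
  have ch: "\<Union>C \<in> Z" if C: "C \<noteq> {}" "subset.chain Z C" for C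
    unfolding Z_def proper_ideal_def mem_Collect_eq
    proof (intro conjI ballI)
      have CZ: "\<And>K. K \<in> C \<Longrightarrow> proper_ideal A K \<and> I \<subseteq> K" using C(2) by (auto simp: subset.chain_def Z_def)
      show "\<Union>C \<subseteq> A" using CZ unfolding proper_ideal_def by blast
      show "(\<lambda>_. 0) \<in> \<Union>C" using CZ C(1) by (auto simp: proper_ideal_def)
      show "(\<lambda>_. 1) \<notin> \<Union>C" using CZ C(1) by (auto simp: proper_ideal_def)
      show "I \<subseteq> \<Union>C" using CZ C(1) by auto
      show "(\<lambda>t. f t * g t) \<in> \<Union>C" if fg: "f \<in> A" "g \<in> \<Union>C" for f g
      proof -
        obtain K where "K \<in> C" "g \<in> K" using fg by auto
        then show ?thesis using CZ[of K] fg(1) unfolding proper_ideal_def by blast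
      qed
      show "(\<lambda>t. f t + g t) \<in> \<Union>C" if fg: "f \<in> \<Union>C" "g \<in> \<Union>C" for f g
      proof -
        obtain K L where K: "K \<in> C" "f \<in> K" "L \<in> C" "g \<in> L" using fg by auto
        then have "K \<subseteq> L \<or> L \<subseteq> K" using C(2) by (auto simp: subset.chain_def)
        then obtain H where H: "H \<in> C" "f \<in> H" "g \<in> H" using K by blast
        then show ?thesis using CZ[OF H(1)] by (auto simp: proper_ideal_def)
      qed
    qed
  have "Z \<noteq> {}" using I unfolding Z_def by blast
  then obtain K where KZ: "K \<in> Z" and max: "\<And>X. X \<in> Z \<Longrightarrow> K \<subseteq> X \<Longrightarrow> X = K"
    using subset_Zorn_nonempty[OF _ ch] by metis
  have K: "proper_ideal A K" "I \<subseteq> K" using KZ by (auto simp: Z_def)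
  note KD = proper_idealD[OF A K(1)]
  have inv: "\<exists>b\<in>A. (\<lambda>t. b t * a t - 1) \<in> K" if h: "a \<in> A" "a \<notin> K" for a
  proof (rule ccontr)
    assume "\<not> ?thesis"
    then obtain X where X: "proper_ideal A X" "K \<subseteq> X" "a \<in> X"
      using ideal_extension[OF A K(1) h(1)] by metis
    then have "X \<in> Z" using K(2) unfolding Z_def by (intro CollectI conjI) (assumption, rule subset_trans)
    then show False using max[of X] X h(2) by metis
  qed
  have pr: "prime_in A K"
    unfolding prime_in_def
  proof (intro ballI impI)
    fix f g assume fg: "f \<in> A" "g \<in> A" "(\<lambda>t. f t * g t) \<in> K"
    show "f \<in> K \<or> g \<in> K"
    proof (rule disjCI)
      assume "g \<notin> K"
      then obtain b where b: "b \<in> A" "(\<lambda>t. b t * g t - 1) \<in> K" using inv fg(2) by metis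
      \<comment> \<open>This function equals \<open>f\<close>.\<close>
      have "(\<lambda>t. b t * (f t * g t) - f t * (b t * g t - 1)) \<in> K"
        by (rule KD(6)[OF KD(4)[OF b(1) fg(3)] KD(4)[OF fg(1) b(2)]])
      then show "f \<in> K" by (simp add: algebra_simps)
    qed
  qed
  have ex: "\<exists>\<mu>. (\<lambda>t. a t - \<mu>) \<in> K" if "a \<in> A" for a
  proof (rule ccontr)
    assume no: "\<not> ?thesis"
    have "\<exists>b\<in>A. (\<lambda>t. b t * (a t - l) - 1) \<in> K" for l
      by (rule inv) (use AD(6)[OF that, where c = l] no in auto)
    then show False
      using countable_resolvents[OF A E K(1) pr that, of UNIV] no uncountable_UNIV_complex by metis
  qed
  define x where "x a = (SOME \<mu>. (\<lambda>t. a t - \<mu>) \<in> K)" for a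
  have x: "(\<lambda>t. a t - x a) \<in> K" if "a \<in> A" for a unfolding x_def using someI_ex[OF ex[OF that]] .
  have uniq: "x a = \<mu>" if "a \<in> A" "(\<lambda>t. a t - \<mu>) \<in> K" for a \<mu>
    using KD(6)[OF x[OF that(1)] that(2)] KD(7)[of "\<mu> - x a"] by simp
  have "character_on A x"
    unfolding character_on_def
  proof (intro conjI allI ballI)
    show "x (\<lambda>_. c) = c" for c by (rule uniq) (use AD(1) KD(2) in auto)
    fix f g assume fg: "f \<in> A" "g \<in> A"
    show "x (\<lambda>t. f t + g t) = x f + x g"
      using KD(3)[OF x[OF fg(1)] x[OF fg(2)]] by (intro uniq AD(2) fg) (simp add: algebra_simps)
    have "(\<lambda>t. f t * (g t - x g) + x g * (f t - x f)) \<in> K"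
      by (rule KD(3)[OF KD(4)[OF fg(1) x[OF fg(2)]] KD(5)[OF x[OF fg(1)]]])
    then show "x (\<lambda>t. f t * g t) = x f * x g"
      by (intro uniq AD(3) fg) (simp add: algebra_simps)
  qed
  moreover have "\<forall>f\<in>I. x f = 0"
    using uniq[of _ 0] K(2) KD(1) by auto
  ultimately show ?thesis by blast
qed

text \<open>If \<open>a - l\<close> is not invertible modulo \<open>I\<close>, some character
  killing \<open>I\<close> has the value \<open>l\<close> at \<open>a\<close>. A bound
  \<open>R\<close> on these values would make \<open>a - l\<close> invertible for the uncountably
  many \<open>l\<close> of norm above \<open>R\<close>, and \<open>countable_resolvents\<close>
  would make \<open>a\<close> constant modulo \<open>I\<close>.\<close>

lemma unbounded_characters:
  assumes A: "algebra_of_functions A" and E: "countable E" "A \<subseteq> complex_fun.span E"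
    and I: "proper_ideal A I" "prime_in A I" and a: "a \<in> A" "\<And>\<mu>. (\<lambda>t. a t - \<mu>) \<notin> I"
  shows "\<exists>x. character_on A x \<and> (\<forall>f\<in>I. x f = 0) \<and> norm (x a) > R"
proof (rule ccontr)
  assume contra: "\<not> ?thesis"
  note AD = algebra_of_functionsD[OF A]
  have "\<exists>b\<in>A. (\<lambda>t. b t * (a t - l) - 1) \<in> I" if l: "norm l > R" for l
  proof (rule ccontr)
    assume "\<not> ?thesis"
    then obtain K where K: "proper_ideal A K" "I \<subseteq> K" "(\<lambda>t. a t - l) \<in> K"
      using ideal_extension[OF A I(1) AD(6)[OF a(1), of l]] by blast
    obtain x where x: "character_on A x" "\<forall>f\<in>K. x f = 0"
      using exists_character[OF A E K(1)] by blast
    have "x (\<lambda>t. (a t - l) + l) = x (\<lambda>t. a t - l) + x (\<lambda>_. l)"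
      by (rule character_onD(2)[OF x(1) AD(6)[OF a(1)] AD(1)])
    then have "x a = l" using x K(3) by (simp add: character_on_def)
    then show False using contra x K(2) l by blast
  qed
  moreover have "uncountable {l::complex. norm l > R}"
  proof -
    have "{l. Re l > R} \<subseteq> {l::complex. norm l > R}" using complex_Re_le_cmod order.strict_trans2 by blast
    then show ?thesis using uncountable_halfspace_Re_gt countable_subset by blast
  qed
  ultimately show False
    using countable_resolvents[OF A E I a(1), of "{l. norm l > R}"] a(2) by blast
qed

lemma character_on_sum:
  assumes A: "algebra_of_functions A" and x: "character_on A x" and "finite I" "\<And>i. i \<in> I \<Longrightarrow> f i \<in> A"
  shows "x (\<lambda>t. \<Sum>i\<in>I. f i t * c i) = (\<Sum>i\<in>I. x (f i) * c i)"
  using assms(3,4)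
proof (induction rule: finite_induct)
  case empty
  then show ?case using character_onD(1)[OF x, of 0] by simp
next
  case (insert i I)
  have 1: "(\<lambda>t. f i t * c i) \<in> A" 
    by (rule algebra_of_functionsD(3)[OF A _ algebra_of_functionsD(1)[OF A]]) (use insert in auto)
  have 2: "(\<lambda>t. \<Sum>i\<in>I. f i t * c i) \<in> A"
    by (rule algebra_of_functions_sum[OF A insert.hyps(1)], 
        rule algebra_of_functionsD(3)[OF A _ algebra_of_functionsD(1)[OF A]]) (use insert in auto)
  have "x (\<lambda>t. f i t * c i) = x (f i) * x (\<lambda>_. c i)"
    by (rule character_onD(3)[OF x _ algebra_of_functionsD(1)[OF A]]) (use insert in auto)
  then show ?case
    using character_onD(2)[OF x 1 2] character_onD(1)[OF x, of "c i"] insert by simp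
qed

lemma character_on_eqI:
  assumes "algebra_of_functions A" "character_on A x" "f \<in> A" "g \<in> A" "x (\<lambda>t. f t - g t) = 0"
  shows "x f = x g"
  using character_onD(2)[OF assms(2) algebra_of_functionsD(5)[OF assms(1,3,4)] assms(4)] assms(5) by simp

section \<open>Algebras generated by finitely many holomorphic functions\<close>

definition monomials :: "('s \<Rightarrow> complex) set \<Rightarrow> ('s \<Rightarrow> complex) set" where
  "monomials G = (\<lambda>xs t. prod_list (map (\<lambda>f. f t) xs)) ` lists G"

lemma monomialsI: "xs \<in> lists G \<Longrightarrow> (\<lambda>t. prod_list (map (\<lambda>f. f t) xs)) \<in> monomials G"
  unfolding monomials_def by (rule imageI)

lemma monomialsE:
  assumes "f \<in> monomials G"
  obtains xs where "xs \<in> lists G" "f = (\<lambda>t. prod_list (map (\<lambda>f. f t) xs))"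
  using assms unfolding monomials_def by (rule imageE) (rule that)

text \<open>The span of the words in the generators is closed under products, and a finite alphabet
  has only countably many words.\<close>

lemma generated_algebra:
  assumes "finite G" "open D" "\<forall>f\<in>G. f holomorphic_on D"
  shows "\<exists>A E. algebra_of_functions A \<and> countable E \<and> A \<subseteq> complex_fun.span E \<and> G \<subseteq> A \<and>
    (\<forall>f\<in>A. f holomorphic_on D)"
proof (intro exI conjI ballI)
  define A where "A = complex_fun.span (monomials G)"
  show "countable (monomials G)"
    unfolding monomials_def using assms(1) by (intro countable_image countable_lists countable_finite)
  show "A \<subseteq> complex_fun.span (monomials G)" by (simp add: A_def)
  show "G \<subseteq> A"
  proof
    fix f assume "f \<in> G"
    then have "(\<lambda>t. prod_list (map (\<lambda>f. f t) [f])) \<in> monomials G" by (intro monomialsI) simp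
    then show "f \<in> A" unfolding A_def by (intro complex_fun.span_base) simp
  qed
  have one: "(\<lambda>t. 1) \<in> monomials G"
  proof -
    have "(\<lambda>t. prod_list (map (\<lambda>f. f t) [])) \<in> monomials G" by (intro monomialsI) simp
    then show ?thesis by simp
  qed
  have addA: "(\<lambda>t. f t + g t) \<in> A" if "f \<in> A" "g \<in> A" for f g
    using complex_fun.span_add[OF that[unfolded A_def]] by (simp add: A_def plus_fun_def)
  have scaleA: "(\<lambda>t. c * f t) \<in> A" if "f \<in> A" for f c
    using complex_fun.span_scale[OF that[unfolded A_def]] by (simp add: A_def)
  have zeroA: "(\<lambda>t. 0) \<in> A" using complex_fun.span_zero[of "monomials G"] by (simp add: A_def zero_fun_def)
  have mm: "(\<lambda>t. f t * g t) \<in> monomials G" if fg: "f \<in> monomials G" "g \<in> monomials G" for f g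
  proof -
    from fg(1) obtain xs where xs: "xs \<in> lists G" "f = (\<lambda>t. prod_list (map (\<lambda>f. f t) xs))"
      by (rule monomialsE)
    from fg(2) obtain ys where ys: "ys \<in> lists G" "g = (\<lambda>t. prod_list (map (\<lambda>f. f t) ys))"
      by (rule monomialsE)
    show ?thesis using monomialsI[of "xs @ ys" G] xs(1) ys(1) by (simp add: xs(2) ys(2))
  qed
  have mA: "(\<lambda>t. f t * g t) \<in> A" if "f \<in> monomials G" "g \<in> A" for f g
    using that(2) unfolding A_def
  proof (induction rule: complex_fun.span_induct_alt)
    case base
    then show ?case using zeroA by (simp add: A_def)
  next
    case (step c h y)
    have "(\<lambda>t. c * (f t * h t) + f t * y t) \<in> A"
      by (intro addA scaleA) (use mm[OF that(1) step(1)] step(2) in \<open>auto simp: A_def complex_fun.span_base\<close>)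
    then show ?case by (simp add: A_def algebra_simps)
  qed
  have AA: "(\<lambda>t. f t * g t) \<in> A" if "f \<in> A" "g \<in> A" for f g
    using that(1) unfolding A_def
  proof (induction rule: complex_fun.span_induct_alt)
    case base
    then show ?case using zeroA by (simp add: A_def)
  next
    case (step c h y)
    have "(\<lambda>t. c * (h t * g t) + y t * g t) \<in> A"
      by (intro addA scaleA) (use mA[OF step(1) that(2)] step(2) in \<open>auto simp: A_def\<close>)
    then show ?case by (simp add: A_def algebra_simps)
  qed
  have constA: "(\<lambda>t. c) \<in> A" for c
    using scaleA[of "\<lambda>t. 1" c] one by (simp add: A_def complex_fun.span_base)
  show "algebra_of_functions A"
    unfolding algebra_of_functions_def using addA AA constA by simp
  fix f assume "f \<in> A"
  then show "f holomorphic_on D" unfolding A_def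
  proof (induction rule: complex_fun.span_induct_alt)
    case base
    then show ?case by (simp add: zero_fun_def)
  next
    case (step c h y)
    have "h holomorphic_on D"
    proof -
      from step(1) obtain xs where xs: "xs \<in> lists G" "h = (\<lambda>t. prod_list (map (\<lambda>f. f t) xs))"
        by (rule monomialsE)
      have "(\<lambda>t. prod_list (map (\<lambda>f. f t) xs)) holomorphic_on D"
        using xs(1) by (induction xs) (simp_all add: holomorphic_on_mult assms(3))
      then show ?thesis using xs(2) by simp
    qed
    then show ?case using step(2) by (auto simp: plus_fun_def intro!: holomorphic_intros)
  qed
qed

text \<open>The elements of \<open>A\<close> are functions on the whole plane, but relations are
  known on \<open>D\<close> only, so the characters in use have to kill this ideal. It is prime by
  the identity theorem: a function vanishing wherever another one is nonzero vanishes on an open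
  set.\<close>

lemma vanishing_ideal:
  assumes A: "algebra_of_functions A" and hol: "\<And>f. f \<in> A \<Longrightarrow> f holomorphic_on D"
    and D: "open D" "connected D" "D \<noteq> {}"
  defines "I \<equiv> {f\<in>A. \<forall>t\<in>D. f t = 0}"
  shows "proper_ideal A I" "prime_in A I"
proof -
  note AD = algebra_of_functionsD[OF A]
  show "proper_ideal A I"
    unfolding proper_ideal_def I_def
    using AD(1)[of 0] AD(2,3) D(3) by auto
  show "prime_in A I"
    unfolding prime_in_def
  proof (intro ballI impI)
    fix f g assume fg: "f \<in> A" "g \<in> A" "(\<lambda>t. f t * g t) \<in> I"
    show "f \<in> I \<or> g \<in> I"
    proof (cases "\<forall>t\<in>D. f t = 0")
      case True
      then show ?thesis using fg(1) by (simp add: I_def)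
    next
      case False
      define U where "U = {t\<in>D. f t \<noteq> 0}"
      have "U = D \<inter> f -` (- {0})" by (auto simp: U_def)
      moreover have "open (D \<inter> f -` (- {0}))"
        using holomorphic_on_imp_continuous_on[OF hol[OF fg(1)]] D(1)
        by (intro continuous_open_preimage) auto
      ultimately have U: "open U" "U \<noteq> {}" "U \<subseteq> D" using False by (auto simp: U_def)
      have "g t = 0" if "t \<in> U" for t using that fg(3) by (auto simp: U_def I_def)
      then have "g t = 0" if "t \<in> D" for t
        using analytic_continuation_open[OF U(1) D(1) U(2) D(2) U(3) hol[OF fg(2)], of "\<lambda>_. 0" t] that
        by auto
      then show ?thesis using fg(2) by (simp add: I_def)
    qed
  qed
qed

section \<open>Limits of rescaled characters\<close>

lemma common_convergent_subsequence:
  fixes \<xi> :: "nat \<Rightarrow> 'i \<Rightarrow> complex"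
  assumes "finite I" "\<And>n i. i \<in> I \<Longrightarrow> norm (\<xi> n i) \<le> 1"
  shows "\<exists>\<sigma> \<zeta>. strict_mono (\<sigma> :: nat \<Rightarrow> nat) \<and> (\<forall>i\<in>I. (\<lambda>n. \<xi> (\<sigma> n) i) \<longlonglongrightarrow> \<zeta> i)"
  using assms
proof (induction rule: finite_induct)
  case empty
  then show ?case by (intro exI[of _ id]) (auto simp: strict_mono_def)
next
  case (insert j I)
  then obtain \<sigma> \<zeta> where \<sigma>: "strict_mono (\<sigma> :: nat \<Rightarrow> nat)" "\<forall>i\<in>I. (\<lambda>n. \<xi> (\<sigma> n) i) \<longlonglongrightarrow> \<zeta> i" by auto
  have "\<forall>n. \<xi> (\<sigma> n) j \<in> cball 0 1" using insert.prems by auto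
  then obtain l \<tau> where \<tau>: "strict_mono (\<tau> :: nat \<Rightarrow> nat)" "((\<lambda>n. \<xi> (\<sigma> n) j) \<circ> \<tau>) \<longlonglongrightarrow> l"
    using compact_cball[of "0::complex" 1] unfolding compact_def by meson
  show ?case
  proof (intro exI conjI ballI)
    show "strict_mono (\<sigma> \<circ> \<tau>)" using \<sigma>(1) \<tau>(1) by (rule strict_mono_o)
    fix i assume "i \<in> insert j I"
    then show "(\<lambda>n. \<xi> ((\<sigma> \<circ> \<tau>) n) i) \<longlonglongrightarrow> (\<zeta>(j := l)) i"
      using \<tau>(2) \<sigma>(2) LIMSEQ_subseq_LIMSEQ[OF _ \<tau>(1)] insert.hyps(2) by (auto simp: o_def)
  qed
qed

text \<open>Convergence of finitely many coefficients gives uniform convergence on compact sets, the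
  form in which Hurwitz's theorem is applied.\<close>

lemma uniform_limit_linear_combination:
  fixes \<xi> :: "nat \<Rightarrow> 'i \<Rightarrow> complex" and g :: "'i \<Rightarrow> complex \<Rightarrow> complex"
  assumes "finite I" "\<And>i. i \<in> I \<Longrightarrow> (\<lambda>n. \<xi> n i) \<longlonglongrightarrow> \<zeta> i" "\<And>i. i \<in> I \<Longrightarrow> bounded (g i ` K)"
  shows "uniform_limit K (\<lambda>n s. \<Sum>i\<in>I. \<xi> n i * g i s) (\<lambda>s. \<Sum>i\<in>I. \<zeta> i * g i s) sequentially"
  using assms
proof (induction rule: finite_induct)
  case (insert j I)
  have "uniform_limit K (\<lambda>n s. \<xi> n j) (\<lambda>s. \<zeta> j) sequentially"
    unfolding uniform_limit_iff
  proof (intro allI impI)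
    fix e :: real assume "e > 0"
    from tendstoD[OF insert.prems(1)[of j] this] show "\<forall>\<^sub>F n in sequentially. \<forall>x\<in>K. dist (\<xi> n j) (\<zeta> j) < e"
      by (auto elim: eventually_mono)
  qed
  then have "uniform_limit K (\<lambda>n s. \<xi> n j * g j s) (\<lambda>s. \<zeta> j * g j s) sequentially"
    by (rule uniform_lim_mult[OF _ uniform_limit_const])
       (use insert.prems(2)[of j] in \<open>auto intro!: finite_imp_bounded finite_subset[of _ "{\<zeta> j}"]\<close>)
  then show ?case using insert by (auto intro!: uniform_limit_add)
qed (simp add: uniform_limit_const)

text \<open>If the sum depended on \<open>t\<close>, some coefficient in a shortest expansion would
  be nonconstant and hence take unbounded values on characters. The images under such characters,
  divided by the size of their coefficients, have a nonzero limit that vanishes at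
  \<open>s = 0\<close>, whereas they have no zeros themselves. This contradicts Hurwitz's
  theorem.\<close>

lemma character_fiber_zero_free:
  fixes a b :: "nat \<Rightarrow> complex \<Rightarrow> complex" and r :: real
  defines "D \<equiv> ball (0::complex) r"
  assumes r: "r > 0"
    and A: "algebra_of_functions A" and E: "countable E" "A \<subseteq> complex_fun.span E"
    and hol: "\<And>f. f \<in> A \<Longrightarrow> f holomorphic_on D"
    and a: "\<And>i. i < k \<Longrightarrow> a i \<in> A" and b: "\<And>i. i < k \<Longrightarrow> b i holomorphic_on D"
    and R0: "\<And>t. t \<in> D \<Longrightarrow> (\<Sum>i<k. a i t * b i 0) = 1"
    and zf: "\<And>x s. character_on A x \<Longrightarrow> (\<And>f. f \<in> A \<Longrightarrow> (\<forall>t\<in>D. f t = 0) \<Longrightarrow> x f = 0) \<Longrightarrow> s \<in> D \<Longrightarrow>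
      (\<Sum>i<k. x (a i) * b i s) \<noteq> 0"
    and t: "t \<in> D" and s: "s \<in> D"
  shows "(\<Sum>i<k. a i t * b i s) = (\<Sum>i<k. a i 0 * b i s)"
proof -
  note AD = algebra_of_functionsD[OF A]
  define R where "R t s = (\<Sum>i<k. a i t * b i s)" for t s
  have D: "open D" "connected D" "D \<noteq> {}" "0 \<in> D" using r by (auto simp: D_def)
  define I where "I = {f\<in>A. \<forall>t\<in>D. f t = 0}"
  have I: "proper_ideal A I" "prime_in A I" unfolding I_def by (rule vanishing_ideal[OF A hol D(1-3)]; simp)+
  \<comment> \<open>Expansions around the value 1 at \<open>s = 0\<close>, with all
    \<open>g i\<close> vanishing there. Minimality of the number of terms makes the
    \<open>g i\<close> linearly independent.\<close>
  define Q where "Q n \<longleftrightarrow> (\<exists>(S::nat set) f g. finite S \<and> card S = n \<and>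
    (\<forall>i\<in>S. f i \<in> A \<and> g i holomorphic_on D \<and> g i 0 = 0) \<and>
    (\<forall>t\<in>D. \<forall>s\<in>D. R t s = 1 + (\<Sum>i\<in>S. f i t * g i s)))" for n
  have "Q k"
    unfolding Q_def
  proof (intro exI conjI ballI)
    show "R t s = 1 + (\<Sum>i\<in>{..<k}. a i t * (\<lambda>i s. b i s - b i 0) i s)" if "t \<in> D" for t s
      using R0[OF that] by (simp add: R_def algebra_simps sum_subtractf)
  qed (use a b in \<open>auto intro!: holomorphic_intros\<close>)
  define n where "n = (LEAST n. Q n)"
  have "Q n" unfolding n_def by (rule LeastI[of Q, OF \<open>Q k\<close>])
  then obtain S :: "nat set" and f g where "finite S \<and> card S = n \<and>
    (\<forall>i\<in>S. f i \<in> A \<and> g i holomorphic_on D \<and> g i 0 = 0) \<and>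
    (\<forall>t\<in>D. \<forall>s\<in>D. R t s = 1 + (\<Sum>i\<in>S. f i t * g i s))"
    unfolding Q_def by (elim exE) (rule that)
  then have S: "finite S" "card S = n" and fg: "\<And>i. i \<in> S \<Longrightarrow> f i \<in> A"
      "\<And>i. i \<in> S \<Longrightarrow> g i holomorphic_on D" "\<And>i. i \<in> S \<Longrightarrow> g i 0 = 0"
      and Rfg: "\<And>t s. t \<in> D \<Longrightarrow> s \<in> D \<Longrightarrow> R t s = 1 + (\<Sum>i\<in>S. f i t * g i s)"
    by simp_all
  have indep: "c j = 0" if cj: "\<And>s. s \<in> D \<Longrightarrow> (\<Sum>i\<in>S. c i * g i s) = 0" "j \<in> S" for c j
  proof (rule ccontr)
    assume c: "c j \<noteq> 0"
    \<comment> \<open>A linear relation solved for \<open>g j\<close> and substituted removes the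
      index \<open>j\<close> and alters the other coefficients by multiples of
      \<open>f j\<close>.\<close>
    have "Q (n - 1)"
      unfolding Q_def
    proof (intro exI conjI ballI)
      show "finite (S - {j})" "card (S - {j}) = n - 1" using S cj(2) by auto
      show "(\<lambda>i t. f i t - (c i / c j) * f j t) i \<in> A" if "i \<in> S - {j}" for i
        using AD(5)[OF fg(1) AD(4)[OF fg(1)[OF cj(2)], of "c i / c j"], of i] that by simp
      show "R t s = 1 + (\<Sum>i\<in>S - {j}. (\<lambda>i t. f i t - (c i / c j) * f j t) i t * g i s)"
        if ts: "t \<in> D" "s \<in> D" for t s
      proof -
        have "g j s = - (\<Sum>i\<in>S - {j}. c i * g i s) / c j"
          using cj(1)[OF ts(2)] sum.remove[OF S(1) cj(2), of "\<lambda>i. c i * g i s"] c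
          by (simp add: field_simps eq_neg_iff_add_eq_0)
        then have "f j t * g j s = - (\<Sum>i\<in>S - {j}. (c i / c j) * f j t * g i s)"
          by (simp add: sum_divide_distrib sum_distrib_left algebra_simps)
        then show ?thesis
          using Rfg[OF ts] sum.remove[OF S(1) cj(2), of "\<lambda>i. f i t * g i s"]
          by (simp add: algebra_simps sum_subtractf)
      qed
    qed (use fg in auto)
    then have "n \<le> n - 1" unfolding n_def by (rule Least_le)
    moreover have "n > 0" using S cj(2) card_gt_0_iff by blast
    ultimately show False by simp
  qed
  have const: "\<exists>\<mu>. \<forall>t\<in>D. f j t = \<mu>" if j: "j \<in> S" for j
  proof (rule ccontr)
    assume nc: "\<not> ?thesis"
    have ncI: "(\<lambda>t. f j t - \<mu>) \<notin> I" for \<mu>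
    proof
      assume "(\<lambda>t. f j t - \<mu>) \<in> I"
      then have "\<forall>t\<in>D. f j t = \<mu>" by (auto simp: I_def)
      then show False using nc by blast
    qed
    have "\<forall>m::nat. \<exists>x. character_on A x \<and> (\<forall>f\<in>I. x f = 0) \<and> norm (x (f j)) > real m"
      by (intro allI unbounded_characters[OF A E I fg(1)[OF j] ncI])
    from choice[OF this] obtain x where
      "\<forall>m. character_on A (x m) \<and> (\<forall>f\<in>I. x m f = 0) \<and> norm (x m (f j)) > real m" by (elim exE)
    then have x: "\<And>m. character_on A (x m)" "\<And>m f. f \<in> I \<Longrightarrow> x m f = 0"
      "\<And>m. norm (x m (f j)) > real m" by simp_all
    \<comment> \<open>After division by \<open>X m\<close> the coefficients have norms summing to 1,
      so their limit along a subsequence is not zero, while the constant term becomes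
      \<open>1 / X m\<close> and tends to zero.\<close>
    define X where "X m = (\<Sum>i\<in>S. norm (x m (f i)))" for m
    have Xge: "norm (x m (f i)) \<le> X m" if "i \<in> S" for m i
      unfolding X_def using S(1) that by (intro member_le_sum) auto
    have X: "X m > real m" for m using Xge[OF j, of m] x(3)[of m] by simp
    have X0: "X m > 0" for m using X[of m] by (meson of_nat_0_le_iff order.strict_trans1)
    define \<xi> where "\<xi> m i = x m (f i) / X m" for m i
    have "norm (\<xi> m i) \<le> 1" if "i \<in> S" for m i
      using Xge[OF that, of m] X0[of m] by (simp add: \<xi>_def norm_divide divide_simps)
    then obtain \<sigma> \<zeta> where \<sigma>: "strict_mono (\<sigma> :: nat \<Rightarrow> nat)" "\<And>i. i \<in> S \<Longrightarrow> (\<lambda>m. \<xi> (\<sigma> m) i) \<longlonglongrightarrow> \<zeta> i"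
      using common_convergent_subsequence[OF S(1), of \<xi>] by metis
    have "(\<Sum>i\<in>S. norm (\<xi> m i)) = 1" for m
    proof -
      have "norm (\<xi> m i) = norm (x m (f i)) / X m" for i using X0[of m] by (simp add: \<xi>_def norm_divide)
      then have "(\<Sum>i\<in>S. norm (\<xi> m i)) = X m / X m" by (simp add: X_def flip: sum_divide_distrib)
      then show ?thesis using X0[of m] by simp
    qed
    moreover have "(\<lambda>m. \<Sum>i\<in>S. norm (\<xi> (\<sigma> m) i)) \<longlonglongrightarrow> (\<Sum>i\<in>S. norm (\<zeta> i))"
      by (intro tendsto_sum tendsto_norm \<sigma>)
    ultimately have \<zeta>1: "(\<Sum>i\<in>S. norm (\<zeta> i)) = 1" by (simp add: LIMSEQ_const_iff)
    define F where "F m s = (1 / X (\<sigma> m)) + (\<Sum>i\<in>S. \<xi> (\<sigma> m) i * g i s)" for m s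
    define G where "G s = (\<Sum>i\<in>S. \<zeta> i * g i s)" for s
    have F0: "F m s \<noteq> 0" if s: "s \<in> D" for m s
    proof -
      let ?x = "x (\<sigma> m)"
      have aA: "(\<lambda>t. \<Sum>i<k. a i t * b i s) \<in> A"
        by (rule algebra_of_functions_sum[OF A finite_lessThan], rule AD(3)[OF a AD(1)]) simp
      have fA: "(\<lambda>t. \<Sum>i\<in>S. f i t * g i s) \<in> A"
        by (rule algebra_of_functions_sum[OF A S(1)], rule AD(3)[OF fg(1) AD(1)])
      have f1A: "(\<lambda>t. 1 + (\<Sum>i\<in>S. f i t * g i s)) \<in> A" by (rule AD(2)[OF AD(1) fA])
      have "(\<lambda>t. (\<Sum>i<k. a i t * b i s) - (1 + (\<Sum>i\<in>S. f i t * g i s))) \<in> I"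
        unfolding I_def using AD(5)[OF aA f1A] Rfg[OF _ s] by (simp add: R_def)
      from character_on_eqI[OF A x(1) aA f1A x(2)[OF this]]
      have "?x (\<lambda>t. \<Sum>i<k. a i t * b i s) = 1 + ?x (\<lambda>t. \<Sum>i\<in>S. f i t * g i s)"
        using character_onD(2)[OF x(1) AD(1)[of 1] fA, of "\<sigma> m"] character_onD(1)[OF x(1)[of "\<sigma> m"], of 1] by simp
      then have "(\<Sum>i<k. ?x (a i) * b i s) = 1 + (\<Sum>i\<in>S. ?x (f i) * g i s)"
        using character_on_sum[OF A x(1)[of "\<sigma> m"], of "{..<k}" a "\<lambda>i. b i s", OF finite_lessThan a]
          character_on_sum[OF A x(1)[of "\<sigma> m"] S(1), of f "\<lambda>i. g i s", OF fg(1)] by simp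
      also have "\<dots> = X (\<sigma> m) * F m s"
        using X0[of "\<sigma> m"] by (simp add: F_def \<xi>_def algebra_simps sum_distrib_left)
      finally have "X (\<sigma> m) * F m s \<noteq> 0"
        using zf[of ?x s, OF x(1) _ s] x(2)[of _ "\<sigma> m"] unfolding I_def by auto
      then show ?thesis by auto
    qed
    have "G 0 \<noteq> 0"
    proof (rule Hurwitz_no_zeros[of D F G 0, OF D(1,2)])
      show "F m holomorphic_on D" for m
        unfolding F_def[abs_def] by (intro holomorphic_intros fg(2)) auto
      show "G holomorphic_on D" unfolding G_def[abs_def] by (intro holomorphic_intros fg(2)) auto
      show "0 \<in> D" by fact
      show "F m s \<noteq> 0" if "s \<in> D" for m s by (rule F0[OF that])
      show "\<not> G constant_on D"
      proof
        assume "G constant_on D"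
        moreover have "G 0 = 0" using fg(3) by (simp add: G_def)
        ultimately have "G s = 0" if "s \<in> D" for s using D(4) that unfolding constant_on_def by metis
        then have "\<zeta> i = 0" if "i \<in> S" for i using indep[OF _ that, of \<zeta>] by (simp add: G_def)
        then show False using \<zeta>1 by simp
      qed
      fix K assume K: "compact K" "K \<subseteq> D"
      have "(\<lambda>m. 1 / complex_of_real (X (\<sigma> m))) \<longlonglongrightarrow> 0"
      proof (rule Lim_null_comparison)
        show "\<forall>\<^sub>F m in sequentially. norm (1 / complex_of_real (X (\<sigma> m))) \<le> inverse (real m)"
        proof (rule eventually_mono[OF eventually_gt_at_top[of 0]])
          fix m :: nat assume "m > 0"
          moreover have "real m \<le> X (\<sigma> m)" using X[of "\<sigma> m"] seq_suble[OF \<sigma>(1), of m] by linarith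
          ultimately show "norm (1 / complex_of_real (X (\<sigma> m))) \<le> inverse (real m)"
            by (simp add: norm_divide divide_simps)
        qed
        show "(\<lambda>m. inverse (real m)) \<longlonglongrightarrow> 0" using lim_inverse_n .
      qed
      then have "uniform_limit K (\<lambda>m s. 1 / complex_of_real (X (\<sigma> m))) (\<lambda>s. 0) sequentially"
        unfolding uniform_limit_iff tendsto_iff by (auto elim!: allE impE eventually_mono)
      moreover have "uniform_limit K (\<lambda>m s. \<Sum>i\<in>S. \<xi> (\<sigma> m) i * g i s) G sequentially"
        unfolding G_def[abs_def]
      proof (rule uniform_limit_linear_combination[OF S(1) \<sigma>(2)])
        show "bounded (g i ` K)" if "i \<in> S" for i
          using holomorphic_on_imp_continuous_on[OF fg(2)[OF that]] K
          by (meson compact_continuous_image compact_imp_bounded continuous_on_subset)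
      qed
      ultimately have "uniform_limit K (\<lambda>m s. 1 / complex_of_real (X (\<sigma> m)) + (\<Sum>i\<in>S. \<xi> (\<sigma> m) i * g i s))
          (\<lambda>s. 0 + G s) sequentially" by (rule uniform_limit_add)
      then show "uniform_limit K F G sequentially" by (simp add: F_def[abs_def])
    qed
    moreover have "G 0 = 0" using fg(3) by (simp add: G_def)
    ultimately show False by simp
  qed
  have "f i t = f i 0" if "i \<in> S" for i using const[OF that] t D(4) by metis
  then show ?thesis using Rfg[OF t s] Rfg[OF D(4) s] by (simp add: R_def)
qed

lemma ball_radius_pos: "z \<in> ball a r \<Longrightarrow> 0 < r" for a z :: complex
  by (metis ball_eq_empty empty_iff not_le)

text \<open>The factor \<open>x\<close> absorbs the case \<open>k = 0\<close>, where
  \<open>k - 1\<close> is truncated to 0.\<close>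

lemma power_rule_multiplied:
  "x * (of_nat k * x ^ (k - 1) * g + x ^ k * g') = x ^ k * (of_nat k * g + x * g')" for x g g' :: complex
  by (cases k) (auto simp: algebra_simps)

section \<open>Sums of products of holomorphic functions\<close>

lemma power_factor:
  fixes f :: "complex \<Rightarrow> complex"
  assumes "f holomorphic_on ball 0 r" "s0 \<in> ball 0 r" "z \<in> ball 0 r" "f z \<noteq> 0"
  obtains n g e where "e > 0" "ball s0 e \<subseteq> ball 0 r" "g holomorphic_on ball s0 e" "g s0 \<noteq> 0"
    "\<And>w. w \<in> ball s0 e \<Longrightarrow> f w = (w - s0) ^ n * g w" "f s0 = 0 \<Longrightarrow> n > 0"
proof (cases "f s0 = 0")
  case True
  have "\<not> f constant_on ball 0 r"
    using True assms(2-4) unfolding constant_on_def by metis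
  then obtain g e n where "0 < n" "0 < e" "ball s0 e \<subseteq> ball 0 r" "g holomorphic_on ball s0 e"
     "\<And>w. w \<in> ball s0 e \<Longrightarrow> f w = (w - s0) ^ n * g w" "\<And>w. w \<in> ball s0 e \<Longrightarrow> g w \<noteq> 0"
    using holomorphic_factor_zero_nonconstant[OF assms(1) open_ball connected_ball assms(2) True]
    by metis
  then show ?thesis using that[of e g n] by auto
next
  case False
  obtain e where e: "e > 0" "ball s0 e \<subseteq> ball 0 r"
    using assms(2) open_ball openE by metis
  show ?thesis
    using that[of e f 0] e False holomorphic_on_subset[OF assms(1) e(2)] by auto
qed

text \<open>The equation is \<open>H'/H = \<beta> F'/F + v\<close> cleared of denominators. Its
  residues at a zero of \<open>F\<close> give \<open>ord H = \<beta> ord F\<close> with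
  \<open>ord F\<close> positive.\<close>

lemma log_derivative_order:
  fixes F H v :: "complex \<Rightarrow> complex"
  assumes F: "F holomorphic_on ball 0 r" and H: "H holomorphic_on ball 0 r"
    and v: "v holomorphic_on ball 0 r"
    and eq: "\<And>s. s \<in> ball 0 r \<Longrightarrow> deriv H s * F s = (\<beta> * deriv F s + v s * F s) * H s"
    and nz: "F 0 \<noteq> 0" "H 0 \<noteq> 0" and s0: "s0 \<in> ball 0 r" "F s0 = 0"
  shows "\<beta> \<in> \<rat>"
proof -
  have r: "0 \<in> ball 0 r" using ball_radius_pos[OF s0(1)] by simp
  obtain m f e1 where f: "e1 > 0" "ball s0 e1 \<subseteq> ball 0 r" "f holomorphic_on ball s0 e1" "f s0 \<noteq> 0"
    "\<And>w. w \<in> ball s0 e1 \<Longrightarrow> F w = (w - s0) ^ m * f w" "m > 0"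
    by (rule power_factor[OF F s0(1) r nz(1)]) (use s0(2) in blast)
  obtain n h e2 where h: "e2 > 0" "ball s0 e2 \<subseteq> ball 0 r" "h holomorphic_on ball s0 e2" "h s0 \<noteq> 0"
    "\<And>w. w \<in> ball s0 e2 \<Longrightarrow> H w = (w - s0) ^ n * h w"
    by (rule power_factor[OF H s0(1) r nz(2)]) blast
  define e where "e = min e1 e2"
  have e: "e > 0" "ball s0 e \<subseteq> ball s0 e1" "ball s0 e \<subseteq> ball s0 e2" using f(1) h(1) by (auto simp: e_def)
  have fh: "f holomorphic_on ball s0 e" "h holomorphic_on ball s0 e"
    using f(3) h(3) e holomorphic_on_subset by blast+
  have D: "(w - s0) * deriv G w = (w - s0) ^ k * (of_nat k * g w + (w - s0) * deriv g w)"
    if g: "g holomorphic_on ball s0 e" "\<And>w. w \<in> ball s0 e \<Longrightarrow> G w = (w - s0) ^ k * g w"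
      and w: "w \<in> ball s0 e" for G g w k
  proof -
    have "(g has_field_derivative deriv g w) (at w)" using g(1) w by (intro holomorphic_derivI) auto
    then have "((\<lambda>w. (w - s0) ^ k * g w) has_field_derivative
       (of_nat k * (w - s0) ^ (k - 1) * g w + (w - s0) ^ k * deriv g w)) (at w)"
      by (auto intro!: derivative_eq_intros)
    then have "(G has_field_derivative (of_nat k * (w - s0) ^ (k - 1) * g w + (w - s0) ^ k * deriv g w)) (at w)"
      by (rule has_field_derivative_transform_within_open[OF _ open_ball w]) (simp add: g(2))
    then have "deriv G w = of_nat k * (w - s0) ^ (k - 1) * g w + (w - s0) ^ k * deriv g w"
      by (rule DERIV_imp_deriv)
    then show ?thesis by (simp only: power_rule_multiplied)
  qed
  \<comment> \<open>What is left of the equation after multiplication by \<open>w - s0\<close> and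
    cancellation of the powers of \<open>w - s0\<close>. By continuity it vanishes also at
    \<open>s0\<close>, where it equals \<open>(n - \<beta> m) f h\<close>.\<close>
  define L where "L w = (of_nat n * h w + (w - s0) * deriv h w) * f w -
     \<beta> * (of_nat m * f w + (w - s0) * deriv f w) * h w - (w - s0) * v w * f w * h w" for w
  have L0: "L w = 0" if w: "w \<in> ball s0 e" "w \<noteq> s0" for w
  proof -
    have wr: "w \<in> ball 0 r" and w1: "w \<in> ball s0 e1" and w2: "w \<in> ball s0 e2"
      using subsetD[OF f(2) subsetD[OF e(2) w(1)]] subsetD[OF e(2) w(1)] subsetD[OF e(3) w(1)] .
    have Fw: "F w = (w - s0) ^ m * f w" and Hw: "H w = (w - s0) ^ n * h w" using f(5)[OF w1] h(5)[OF w2] .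
    have dF: "(w - s0) * deriv F w = (w - s0) ^ m * (of_nat m * f w + (w - s0) * deriv f w)"
      by (rule D[OF fh(1) _ w(1)]) (use f(5) e in auto)
    have dH: "(w - s0) * deriv H w = (w - s0) ^ n * (of_nat n * h w + (w - s0) * deriv h w)"
      by (rule D[OF fh(2) _ w(1)]) (use h(5) e in auto)
    have "((w - s0) * deriv H w) * F w = (\<beta> * ((w - s0) * deriv F w) + (w - s0) * v w * F w) * H w"
      using arg_cong[OF eq[OF wr], of "\<lambda>z. (w - s0) * z"] by (simp add: algebra_simps)
    then have "(w - s0) ^ m * (w - s0) ^ n * L w = 0"
      unfolding dF dH unfolding Fw Hw L_def by (simp add: algebra_simps)
    then show ?thesis using w(2) by simp
  qed
  have cont: "isCont L s0"
  proof -
    have "s0 \<in> ball s0 e" "s0 \<in> ball 0 r" using e(1) s0 by auto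
    moreover have "isCont k s0" if "k holomorphic_on S" "open S" "s0 \<in> S" for k S
      using that holomorphic_on_imp_continuous_on continuous_on_eq_continuous_at by blast
    moreover have "deriv f holomorphic_on ball s0 e" "deriv h holomorphic_on ball s0 e"
      using fh by (auto intro: holomorphic_deriv)
    ultimately show ?thesis unfolding L_def[abs_def] using fh v
      by (intro continuous_intros) (meson open_ball)+
  qed
  have "L \<midarrow>s0\<rightarrow> L s0" using cont by (simp add: isCont_def)
  moreover have "\<forall>\<^sub>F w in at s0. L w = 0"
    unfolding eventually_at using e(1) L0 by (intro exI[of _ e]) (auto simp: dist_commute)
  ultimately have "L s0 = 0" using tendsto_unique[OF at_neq_bot _ tendsto_eventually] by blast
  then have "of_nat n = \<beta> * of_nat m" using f(4) h(4) by (simp add: L_def)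
  then have "\<beta> = of_nat n / of_nat m" using f(6) by (simp add: field_simps)
  then show ?thesis by (simp add: Rats_divide)
qed

text \<open>Multiplication by the exponential of minus a primitive of \<open>w\<close> turns
  \<open>F\<close> into a constant.\<close>

lemma zero_free_linear_ode:
  fixes F w :: "complex \<Rightarrow> complex"
  assumes F: "F holomorphic_on ball 0 r" and w: "w holomorphic_on ball 0 r"
    and eq: "\<And>s. s \<in> ball 0 r \<Longrightarrow> deriv F s = w s * F s"
    and nz: "F 0 \<noteq> 0" and s: "s \<in> ball 0 r"
  shows "F s \<noteq> 0"
proof -
  have r: "0 \<in> ball 0 r" using ball_radius_pos[OF s] by simp
  obtain W where W: "\<And>z. z \<in> ball 0 r \<Longrightarrow> (W has_field_derivative w z) (at z)"
    using holomorphic_convex_primitive'[OF convex_ball open_ball w] by (metis at_within_open open_ball)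
  have "((\<lambda>z. F z * exp (- W z)) has_field_derivative 0) (at z within ball 0 r)" if "z \<in> ball 0 r" for z
  proof -
    have d: "(F has_field_derivative w z * F z) (at z)"
      using holomorphic_derivI[OF F open_ball that] eq[OF that] by simp
    have "((\<lambda>z. F z * exp (- W z)) has_field_derivative
        w z * F z * exp (- W z) + exp (- W z) * - w z * F z) (at z)"
      by (rule DERIV_mult[OF d DERIV_fun_exp[OF DERIV_minus[OF W[OF that]]]])
    moreover have "w z * F z * exp (- W z) + exp (- W z) * - w z * F z = 0" by simp
    ultimately have "((\<lambda>z. F z * exp (- W z)) has_field_derivative 0) (at z)" by simp
    then show ?thesis by (rule has_field_derivative_at_within)
  qed
  from has_field_derivative_zero_constant[OF convex_ball this]
  obtain c where c: "\<forall>z\<in>ball 0 r. F z * exp (- W z) = c" by blast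
  have "F 0 * exp (- W 0) = F s * exp (- W s)" using c r s by simp
  then show ?thesis using nz by auto
qed

lemma identity_on_reals:
  fixes f :: "complex \<Rightarrow> complex"
  assumes "f holomorphic_on ball 0 r" "\<And>x::real. \<bar>x\<bar> < r \<Longrightarrow> f (of_real x) = 0" "z \<in> ball 0 r"
  shows "f z = 0"
proof -
  have r: "r > 0" by (rule ball_radius_pos[OF assms(3)])
  show ?thesis
  proof (rule analytic_continuation[OF assms(1) open_ball connected_ball, of "of_real ` {x. \<bar>x\<bar> < r}" 0])
    show "0 islimpt complex_of_real ` {x. \<bar>x\<bar> < r}"
      unfolding islimpt_approachable
    proof (intro allI impI)
      fix e :: real assume "e > 0"
      then show "\<exists>x'\<in>complex_of_real ` {x. \<bar>x\<bar> < r}. x' \<noteq> 0 \<and> dist x' 0 < e"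
        using r by (intro bexI[OF _ imageI[of "min e r / 2"]]) (auto simp del: of_real_divide)
    qed
  qed (use r assms in auto)
qed

section \<open>Functions of finite rank on a bidisc\<close>

text \<open>With lists of pairs, sums and products of such functions are concatenations;
  \<open>finite_rank_sum_form\<close> passes to indexed sums when the factors have to be
  named.\<close>

definition finite_rank :: "complex set \<Rightarrow> (complex \<Rightarrow> complex \<Rightarrow> complex) \<Rightarrow> bool" where
  "finite_rank D F \<longleftrightarrow> (\<exists>xs. (\<forall>p\<in>set xs. fst p holomorphic_on D \<and> snd p holomorphic_on D) \<and>
     (\<forall>t\<in>D. \<forall>s\<in>D. F t s = (\<Sum>p\<leftarrow>xs. fst p t * snd p s)))"

lemma finite_rank_sum_form:
  assumes "finite_rank D F"
  shows "\<exists>(k::nat) a b. (\<forall>i<k. a i holomorphic_on D \<and> b i holomorphic_on D) \<and>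
    (\<forall>t\<in>D. \<forall>s\<in>D. F t s = (\<Sum>i<k. a i t * b i s))"
proof -
  obtain xs where xs: "\<forall>p\<in>set xs. fst p holomorphic_on D \<and> snd p holomorphic_on D"
     "\<And>t s. t \<in> D \<Longrightarrow> s \<in> D \<Longrightarrow> F t s = (\<Sum>p\<leftarrow>xs. fst p t * snd p s)"
    using assms unfolding finite_rank_def by auto
  show ?thesis
  proof (intro exI conjI allI impI ballI)
    show "(\<lambda>i. fst (xs ! i)) i holomorphic_on D" "(\<lambda>i. snd (xs ! i)) i holomorphic_on D" if "i < length xs" for i
      using xs(1) nth_mem[OF that] by (auto simp: case_prod_beta)
    show "F t s = (\<Sum>i<length xs. (\<lambda>i. fst (xs ! i)) i t * (\<lambda>i. snd (xs ! i)) i s)" if "t \<in> D" "s \<in> D" for t s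
      using xs(2)[OF that] by (simp add: sum_list_sum_nth atLeast0LessThan case_prod_beta)
  qed
qed

lemma finite_rank_product:
  assumes "a holomorphic_on D" "b holomorphic_on D"
  shows "finite_rank D (\<lambda>t s. a t * b s)"
  unfolding finite_rank_def using assms by (intro exI[of _ "[(a, b)]"]) auto

lemma finite_rank_const: "finite_rank D (\<lambda>t s. c)"
  using finite_rank_product[of "\<lambda>_. c" D "\<lambda>_. 1"] by simp

lemma finite_rank_add:
  assumes "finite_rank D F" "finite_rank D G"
  shows "finite_rank D (\<lambda>t s. F t s + G t s)"
proof -
  obtain xs ys where "\<forall>p\<in>set xs. fst p holomorphic_on D \<and> snd p holomorphic_on D"
     "\<forall>t\<in>D. \<forall>s\<in>D. F t s = (\<Sum>p\<leftarrow>xs. fst p t * snd p s)"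
     "\<forall>p\<in>set ys. fst p holomorphic_on D \<and> snd p holomorphic_on D"
     "\<forall>t\<in>D. \<forall>s\<in>D. G t s = (\<Sum>p\<leftarrow>ys. fst p t * snd p s)"
    using assms unfolding finite_rank_def by auto
  then show ?thesis unfolding finite_rank_def by (intro exI[of _ "xs @ ys"]) auto
qed

lemma finite_rank_mult:
  assumes "finite_rank D F" "finite_rank D G"
  shows "finite_rank D (\<lambda>t s. F t s * G t s)"
proof -
  obtain xs ys where xs: "\<forall>p\<in>set xs. fst p holomorphic_on D \<and> snd p holomorphic_on D"
     "\<forall>t\<in>D. \<forall>s\<in>D. F t s = (\<Sum>p\<leftarrow>xs. fst p t * snd p s)"
     and ys: "\<forall>p\<in>set ys. fst p holomorphic_on D \<and> snd p holomorphic_on D"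
     "\<forall>t\<in>D. \<forall>s\<in>D. G t s = (\<Sum>p\<leftarrow>ys. fst p t * snd p s)"
    using assms unfolding finite_rank_def by auto
  define m where "m p = map (\<lambda>q. (\<lambda>t. fst p t * fst q t, \<lambda>s. snd p s * snd q s)) ys" for p :: "(complex \<Rightarrow> complex) \<times> (complex \<Rightarrow> complex)"
  have m: "(\<Sum>p\<leftarrow>m q. fst p t * snd p s) = (fst q t * snd q s) * (\<Sum>p\<leftarrow>ys. fst p t * snd p s)" for q t s
    unfolding m_def by (induction ys) (simp_all add: distrib_left mult.assoc mult.left_commute)
  have c: "(\<Sum>p\<leftarrow>concat (map m xs). fst p t * snd p s) =
      (\<Sum>p\<leftarrow>xs. fst p t * snd p s) * (\<Sum>p\<leftarrow>ys. fst p t * snd p s)" for t s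
    by (induction xs) (simp_all add: m distrib_right)
  have h: "\<forall>p\<in>set (concat (map m xs)). fst p holomorphic_on D \<and> snd p holomorphic_on D"
    using xs(1) ys(1) by (auto simp: m_def intro!: holomorphic_on_mult)
  have "\<forall>t\<in>D. \<forall>s\<in>D. F t s * G t s = (\<Sum>p\<leftarrow>concat (map m xs). fst p t * snd p s)"
    unfolding c using xs(2) ys(2) by simp
  with h show ?thesis unfolding finite_rank_def by (intro exI[of _ "concat (map m xs)"] conjI)
qed

lemma finite_rank_diff:
  assumes "finite_rank D F" "finite_rank D G"
  shows "finite_rank D (\<lambda>t s. F t s - G t s)"
  using finite_rank_add[OF assms(1) finite_rank_mult[OF finite_rank_const[of D "-1"] assms(2)]] by simp

lemma finite_rank_sum:
  assumes "finite I" "\<And>i. i \<in> I \<Longrightarrow> finite_rank D (F i)"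
  shows "finite_rank D (\<lambda>t s. \<Sum>i\<in>I. F i t s)"
  using assms by (induction rule: finite_induct) (auto intro: finite_rank_add finite_rank_const)

lemma finite_rank_prod:
  assumes "finite I" "\<And>i. i \<in> I \<Longrightarrow> finite_rank D (F i)"
  shows "finite_rank D (\<lambda>t s. \<Prod>i\<in>I. F i t s)"
  using assms by (induction rule: finite_induct) (auto intro: finite_rank_mult finite_rank_const)

text \<open>In the variables \<open>x = (t + s) / 2\<close> and
  \<open>y = (t - s) / (2 * \<i>)\<close> the diagonal \<open>s = cnj t\<close> consists of the
  pairs of real numbers, and the identity theorem applies to one variable after the other. Half the
  radius for \<open>x\<close> and \<open>y\<close> keeps \<open>t\<close> and \<open>s\<close> in
  the disc where \<open>F\<close> is expanded.\<close>

lemma polarization: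
  assumes F: "finite_rank (ball 0 r) F" and diag: "\<And>t. t \<in> ball 0 r \<Longrightarrow> F t (cnj t) = 0"
    and ts: "t \<in> ball 0 (r / 2)" "s \<in> ball 0 (r / 2)"
  shows "F t s = 0"
proof -
  obtain k :: nat and a b where ab: "\<forall>i<k. a i holomorphic_on ball 0 r \<and> b i holomorphic_on ball 0 r"
    "\<And>t s. t \<in> ball 0 r \<Longrightarrow> s \<in> ball 0 r \<Longrightarrow> F t s = (\<Sum>i<k. a i t * b i s)"
    using finite_rank_sum_form[OF F] by metis
  define \<Phi> where "\<Phi> x y = (\<Sum>i<k. a i (x + \<i> * y) * b i (x - \<i> * y))" for x y
  have inb: "x + \<i> * y \<in> ball 0 r" "x - \<i> * y \<in> ball 0 r" if "x \<in> ball 0 (r / 2)" "y \<in> ball 0 (r / 2)" for x y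
  proof -
    have "norm (\<i> * y) < r / 2" "norm x < r / 2" using that by (auto simp: norm_mult)
    then show "x + \<i> * y \<in> ball 0 r" "x - \<i> * y \<in> ball 0 r"
      using norm_triangle_ineq[of x "\<i> * y"] norm_triangle_ineq4[of x "\<i> * y"] by auto
  qed
  have hol1: "(\<lambda>x. \<Phi> x y) holomorphic_on ball 0 (r / 2)" if "y \<in> ball 0 (r / 2)" for y
    unfolding \<Phi>_def
  proof (intro holomorphic_on_sum holomorphic_on_mult)
    fix i assume "i \<in> {..<k}"
    then have *: "a i holomorphic_on ball 0 r" "b i holomorphic_on ball 0 r" using ab(1) by auto
    show "(\<lambda>x. a i (x + \<i> * y)) holomorphic_on ball 0 (r / 2)"
      by (rule holomorphic_on_compose_gen[of "\<lambda>x. x + \<i> * y" _ _ "ball 0 r", unfolded o_def])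
        (use inb that *(1) in \<open>auto intro!: holomorphic_intros\<close>)
    show "(\<lambda>x. b i (x - \<i> * y)) holomorphic_on ball 0 (r / 2)"
      by (rule holomorphic_on_compose_gen[of "\<lambda>x. x - \<i> * y" _ _ "ball 0 r", unfolded o_def])
        (use inb that *(2) in \<open>auto intro!: holomorphic_intros\<close>)
  qed
  have hol2: "(\<lambda>y. \<Phi> x y) holomorphic_on ball 0 (r / 2)" if "x \<in> ball 0 (r / 2)" for x
    unfolding \<Phi>_def
  proof (intro holomorphic_on_sum holomorphic_on_mult)
    fix i assume "i \<in> {..<k}"
    then have *: "a i holomorphic_on ball 0 r" "b i holomorphic_on ball 0 r" using ab(1) by auto
    show "(\<lambda>y. a i (x + \<i> * y)) holomorphic_on ball 0 (r / 2)"
      by (rule holomorphic_on_compose_gen[of "\<lambda>y. x + \<i> * y" _ _ "ball 0 r", unfolded o_def])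
        (use inb that *(1) in \<open>auto intro!: holomorphic_intros\<close>)
    show "(\<lambda>y. b i (x - \<i> * y)) holomorphic_on ball 0 (r / 2)"
      by (rule holomorphic_on_compose_gen[of "\<lambda>y. x - \<i> * y" _ _ "ball 0 r", unfolded o_def])
        (use inb that *(2) in \<open>auto intro!: holomorphic_intros\<close>)
  qed
  have real0: "\<Phi> (of_real x) (of_real y) = 0" if "\<bar>x\<bar> < r / 2" "\<bar>y\<bar> < r / 2" for x y :: real
  proof -
    have "F (of_real x + \<i> * of_real y) (of_real x - \<i> * of_real y) = 0"
      using diag[of "of_real x + \<i> * of_real y"] inb(1)[of "of_real x" "of_real y"] that by simp
    then show ?thesis
      using ab(2) inb[of "of_real x" "of_real y"] that by (simp add: \<Phi>_def)
  qed
  have "\<Phi> x (of_real y) = 0" if "x \<in> ball 0 (r / 2)" "\<bar>y\<bar> < r / 2" for x and y :: real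
    by (rule identity_on_reals[OF hol1 real0 that(1)]) (use that in auto)
  then have Z: "\<Phi> x y = 0" if "x \<in> ball 0 (r / 2)" "y \<in> ball 0 (r / 2)" for x y
    by (intro identity_on_reals[OF hol2 _ that(2)]) (use that in auto)
  define x y where "x = (t + s) / 2" and "y = (t - s) / (2 * \<i>)"
  have "norm x < r / 2" "norm y < r / 2"
    using ts norm_triangle_ineq[of t s] norm_triangle_ineq4[of t s] by (auto simp: x_def y_def norm_divide norm_mult)
  then have "\<Phi> x y = 0" by (intro Z) auto
  moreover have "x + \<i> * y = t" "x - \<i> * y = s" by (auto simp: x_def y_def field_simps)
  moreover have "t \<in> ball 0 r" "s \<in> ball 0 r" using ts ball_radius_pos[OF ts(1)] by auto
  ultimately show ?thesis using ab(2)[of t s] by (simp add: \<Phi>_def)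
qed

lemma finite_rank_cong:
  assumes "finite_rank D F" "\<And>t s. t \<in> D \<Longrightarrow> s \<in> D \<Longrightarrow> F t s = G t s"
  shows "finite_rank D G"
  using assms unfolding finite_rank_def by (elim exE) (rule exI, auto)

lemma finite_rank_subset:
  assumes "finite_rank D F" "D' \<subseteq> D"
  shows "finite_rank D' F"
proof -
  obtain xs where xs: "\<forall>p\<in>set xs. fst p holomorphic_on D \<and> snd p holomorphic_on D"
     "\<forall>t\<in>D. \<forall>s\<in>D. F t s = (\<Sum>p\<leftarrow>xs. fst p t * snd p s)"
    using assms unfolding finite_rank_def by auto
  then show ?thesis unfolding finite_rank_def using assms(2)
    by (intro exI[of _ xs]) (auto intro: holomorphic_on_subset)
qed

lemma has_field_derivative_linear_combination:
  assumes "\<And>i. i < k \<Longrightarrow> a i holomorphic_on D" "open D" "t \<in> D"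
  shows "((\<lambda>t. \<Sum>i<k. a i t * c i) has_field_derivative (\<Sum>i<k. deriv (a i) t * c i)) (at t)"
    "((\<lambda>t. \<Sum>i<k. c i * a i t) has_field_derivative (\<Sum>i<k. c i * deriv (a i) t)) (at t)"
  by (intro DERIV_sum DERIV_cmult_right DERIV_cmult holomorphic_derivI[OF assms(1) assms(2,3)]; simp)+

lemma finite_rank_derivs:
  assumes F: "finite_rank D F" and D: "open D"
  shows "\<exists>(k::nat) a b. (\<forall>i<k. a i holomorphic_on D \<and> b i holomorphic_on D) \<and>
    (\<forall>t\<in>D. \<forall>s\<in>D. F t s = (\<Sum>i<k. a i t * b i s) \<and>
      deriv (\<lambda>t. F t s) t = (\<Sum>i<k. deriv (a i) t * b i s) \<and>
      deriv (F t) s = (\<Sum>i<k. a i t * deriv (b i) s) \<and>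
      deriv (\<lambda>t. deriv (F t) s) t = (\<Sum>i<k. deriv (a i) t * deriv (b i) s))"
proof -
  obtain k :: nat and a b where ab: "\<forall>i<k. a i holomorphic_on D \<and> b i holomorphic_on D"
    "\<forall>t\<in>D. \<forall>s\<in>D. F t s = (\<Sum>i<k. a i t * b i s)"
    using finite_rank_sum_form[OF F] by auto
  have 1: "deriv (\<lambda>t. F t s) t = (\<Sum>i<k. deriv (a i) t * b i s)" if "t \<in> D" "s \<in> D" for t s
    by (rule DERIV_imp_deriv,
        rule has_field_derivative_transform_within_open[OF has_field_derivative_linear_combination(1) D that(1)])
       (use ab D that in auto)
  have 2: "deriv (F t) s = (\<Sum>i<k. a i t * deriv (b i) s)" if "t \<in> D" "s \<in> D" for t s
    by (rule DERIV_imp_deriv,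
        rule has_field_derivative_transform_within_open[OF has_field_derivative_linear_combination(2) D that(2)])
       (use ab D that in auto)
  have 3: "deriv (\<lambda>t. deriv (F t) s) t = (\<Sum>i<k. deriv (a i) t * deriv (b i) s)" if "t \<in> D" "s \<in> D" for t s
    by (rule DERIV_imp_deriv,
        rule has_field_derivative_transform_within_open[OF has_field_derivative_linear_combination(1) D that(1)])
       (use ab D that 2 in auto)
  show ?thesis using ab 1 2 3 by blast
qed

lemma finite_rank_deriv:
  assumes F: "finite_rank D F" and D: "open D"
  shows "finite_rank D (\<lambda>t s. deriv (\<lambda>t. F t s) t)" "finite_rank D (\<lambda>t s. deriv (F t) s)"
    "finite_rank D (\<lambda>t s. deriv (\<lambda>t. deriv (F t) s) t)"
proof -
  obtain k :: nat and a b where ab: "\<forall>i<k. a i holomorphic_on D \<and> b i holomorphic_on D"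
    "\<forall>t\<in>D. \<forall>s\<in>D. F t s = (\<Sum>i<k. a i t * b i s) \<and>
      deriv (\<lambda>t. F t s) t = (\<Sum>i<k. deriv (a i) t * b i s) \<and>
      deriv (F t) s = (\<Sum>i<k. a i t * deriv (b i) s) \<and>
      deriv (\<lambda>t. deriv (F t) s) t = (\<Sum>i<k. deriv (a i) t * deriv (b i) s)"
    using finite_rank_derivs[OF F D] by auto
  show "finite_rank D (\<lambda>t s. deriv (\<lambda>t. F t s) t)"
    by (rule finite_rank_cong[OF finite_rank_sum[of "{..<k}" D "\<lambda>i t s. deriv (a i) t * b i s"]])
       (use ab D in \<open>auto intro!: finite_rank_product holomorphic_deriv\<close>)
  show "finite_rank D (\<lambda>t s. deriv (F t) s)"
    by (rule finite_rank_cong[OF finite_rank_sum[of "{..<k}" D "\<lambda>i t s. a i t * deriv (b i) s"]])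
       (use ab D in \<open>auto intro!: finite_rank_product holomorphic_deriv\<close>)
  show "finite_rank D (\<lambda>t s. deriv (\<lambda>t. deriv (F t) s) t)"
    by (rule finite_rank_cong[OF finite_rank_sum[of "{..<k}" D "\<lambda>i t s. deriv (a i) t * deriv (b i) s"]])
       (use ab D in \<open>auto intro!: finite_rank_product holomorphic_deriv\<close>)
qed

lemma finite_rank_nonzero_nbhd:
  assumes F: "finite_rank (ball 0 r) F" and r: "r > 0" and nz: "F 0 0 \<noteq> 0"
  shows "\<exists>d>0. d \<le> r \<and> (\<forall>t\<in>ball 0 d. \<forall>s\<in>ball 0 d. F t s \<noteq> 0)"
proof -
  let ?D = "ball (0::complex) r"
  obtain k :: nat and a b where ab: "\<forall>i<k. a i holomorphic_on ?D \<and> b i holomorphic_on ?D"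
    "\<forall>t\<in>?D. \<forall>s\<in>?D. F t s = (\<Sum>i<k. a i t * b i s)"
    using finite_rank_sum_form[OF F] by metis
  define f where "f p = (\<Sum>i<k. a i (fst p) * b i (snd p))" for p
  have "continuous_on (?D \<times> ?D) f"
    unfolding f_def
  proof (intro continuous_on_sum continuous_on_mult)
    fix i assume "i \<in> {..<k}"
    then have c: "continuous_on ?D (a i)" "continuous_on ?D (b i)"
      using ab(1) by (auto intro: holomorphic_on_imp_continuous_on)
    show "continuous_on (?D \<times> ?D) (\<lambda>p. a i (fst p))"
      by (rule continuous_on_compose2[OF c(1)]) (auto intro!: continuous_intros)
    show "continuous_on (?D \<times> ?D) (\<lambda>p. b i (snd p))"
      by (rule continuous_on_compose2[OF c(2)]) (auto intro!: continuous_intros)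
  qed
  then have op: "open ((?D \<times> ?D) \<inter> f -` (- {0}))"
    by (intro continuous_open_preimage open_Times) auto
  have "(0, 0) \<in> (?D \<times> ?D) \<inter> f -` (- {0})" using r nz ab(2) by (auto simp: f_def)
  from open_prod_elim[OF op this] obtain U V where
    UV: "open U" "open V" "(0, 0) \<in> U \<times> V" "U \<times> V \<subseteq> (?D \<times> ?D) \<inter> f -` (- {0})" .
  have "open (U \<inter> V)" "0 \<in> U \<inter> V" using UV by auto
  then obtain d where d: "d > 0" "ball 0 d \<subseteq> U \<inter> V" by (rule openE)
  show ?thesis
  proof (intro exI conjI ballI)
    show "min d r > 0" "min d r \<le> r" using d r by auto
    fix t s :: complex assume ts: "t \<in> ball 0 (min d r)" "s \<in> ball 0 (min d r)"
    then have "(t, s) \<in> U \<times> V" "t \<in> ?D" "s \<in> ?D" using d(2) by auto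
    then show "F t s \<noteq> 0" using UV(4) ab(2) by (auto simp: f_def)
  qed
qed

text \<open>When \<open>g\<close> is the \<open>s\<close>-derivative of \<open>f\<close>, this is
  the mixed logarithmic derivative.\<close>

lemma has_field_derivative_log_derivative:
  assumes "(f has_field_derivative f') (at t)" "(g has_field_derivative g') (at t)" "f t \<noteq> (0::complex)"
  shows "((\<lambda>t. g t / f t) has_field_derivative (f t * g' - f' * g t) / (f t)\<^sup>2) (at t)"
  using DERIV_divide[OF assms(2,1,3)] by (simp add: power2_eq_square mult.commute)

lemma constant_on_ball_of_DERIV_zero:
  assumes "\<And>t. t \<in> ball 0 r \<Longrightarrow> (f has_field_derivative 0) (at t)" "t \<in> ball 0 r"
  shows "f t = f (0::complex)"
proof -
  have "\<exists>c. \<forall>x\<in>ball 0 r. f x = c"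
    by (rule has_field_derivative_zero_constant[OF convex_ball]) (rule has_field_derivative_at_within[OF assms(1)])
  then obtain c where "\<forall>x\<in>ball 0 r. f x = c" by blast
  then show ?thesis using assms(2) ball_radius_pos[OF assms(2)] by simp
qed

text \<open>The relation says that the mixed logarithmic derivative of \<open>E\<close> is \<open>\<alpha> * \<rho>\<close>.\<close>

lemma flat_rank_argument:
  fixes e k a b :: "nat \<Rightarrow> complex \<Rightarrow> complex" and \<alpha> :: complex
  assumes r: "r > 0"
    and hol: "\<And>i. i < n \<Longrightarrow> e i holomorphic_on ball 0 r" "\<And>i. i < n \<Longrightarrow> k i holomorphic_on ball 0 r"
      "\<And>i. i < q \<Longrightarrow> a i holomorphic_on ball 0 r" "\<And>i. i < q \<Longrightarrow> b i holomorphic_on ball 0 r"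
    and E: "\<And>t s. E t s = (\<Sum>i<n. e i t * k i s)"
    and Et: "\<And>t s. Et t s = (\<Sum>i<n. deriv (e i) t * k i s)"
    and Es: "\<And>t s. Es t s = (\<Sum>i<n. e i t * deriv (k i) s)"
    and Ets: "\<And>t s. Ets t s = (\<Sum>i<n. deriv (e i) t * deriv (k i) s)"
    and rho: "\<And>t s. \<rho> t s = (\<Sum>i<q. a i t * b i s)"
    and nz: "\<And>t s. t \<in> ball 0 r \<Longrightarrow> s \<in> ball 0 r \<Longrightarrow> E t s \<noteq> 0"
    and rel: "\<And>t s. t \<in> ball 0 r \<Longrightarrow> s \<in> ball 0 r \<Longrightarrow> E t s * Ets t s - Et t s * Es t s = \<alpha> * \<rho> t s * (E t s)\<^sup>2"
    and rho0: "\<rho> 0 0 \<noteq> 0"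
  shows "\<alpha> = 0"
proof -
  let ?D = "ball (0::complex) r"
  have D0: "0 \<in> ?D" using r by simp
  \<comment> \<open>The relation is going to be integrated once in \<open>t\<close>; the primitives
    of the \<open>a i\<close> become further generators of the algebra.\<close>
  have "\<exists>g. (\<forall>z\<in>?D. (g has_field_derivative a i z) (at z)) \<and> g 0 = 0" if i: "i < q" for i
  proof -
    obtain g where g: "\<And>z. z \<in> ?D \<Longrightarrow> (g has_field_derivative a i z) (at z within ?D)"
      using holomorphic_convex_primitive'[OF convex_ball open_ball hol(3)[OF i]] by blast
    show ?thesis
    proof (intro exI[of _ "\<lambda>z. g z - g 0"] conjI ballI)
      fix z assume z: "z \<in> ?D"
      then have "(g has_field_derivative a i z) (at z)" using g[OF z] at_within_open[OF z open_ball] by simp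
      from DERIV_diff[OF this DERIV_const] show "((\<lambda>z. g z - g 0) has_field_derivative a i z) (at z)" by simp
    qed simp
  qed
  then obtain aI where aI: "\<And>i z. i < q \<Longrightarrow> z \<in> ?D \<Longrightarrow> (aI i has_field_derivative a i z) (at z)"
      "\<And>i. i < q \<Longrightarrow> aI i 0 = 0" by metis
  have aIh: "aI i holomorphic_on ?D" if "i < q" for i
    unfolding holomorphic_on_open[OF open_ball] using aI(1)[OF that] by blast
  define N where "N t s = (\<Sum>i<q. aI i t * b i s)" for t s
  have dN: "((\<lambda>t. N t s) has_field_derivative \<rho> t s) (at t)" if "t \<in> ?D" for t s
    unfolding N_def rho by (intro DERIV_sum DERIV_cmult_right aI(1)[OF _ that]) simp
  have N0: "N 0 s = 0" for s using aI(2) by (simp add: N_def)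
  have dE: "((\<lambda>t. E t s) has_field_derivative Et t s) (at t)"
      "((\<lambda>t. Es t s) has_field_derivative Ets t s) (at t)"
      "(E t' has_field_derivative Es t' t) (at t)" if "t \<in> ?D" for t s t'
  proof -
    show "((\<lambda>t. E t s) has_field_derivative Et t s) (at t)" unfolding E Et
      by (rule has_field_derivative_linear_combination(1)[OF hol(1) open_ball that])
    show "((\<lambda>t. Es t s) has_field_derivative Ets t s) (at t)" unfolding Es Ets
      by (rule has_field_derivative_linear_combination(1)[OF hol(1) open_ball that])
    show "(E t' has_field_derivative Es t' t) (at t)" unfolding E[abs_def] Es
      by (rule has_field_derivative_linear_combination(2)[OF hol(2) open_ball that])
  qed
  \<comment> \<open>The constant of integration: the logarithmic \<open>s\<close>-derivative of
    \<open>E\<close> at \<open>t = 0\<close>, where \<open>N\<close> vanishes.\<close>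
  define v where "v s = Es 0 s / E 0 s" for s
  have EN: "Es t s = (\<alpha> * N t s + v s) * E t s" if t: "t \<in> ?D" and s: "s \<in> ?D" for t s
  proof -
    have "((\<lambda>t. Es t s / E t s - \<alpha> * N t s) has_field_derivative 0) (at z)" if z: "z \<in> ?D" for z
    proof -
      have z0: "(E z s * Ets z s - Et z s * Es z s) / (E z s)\<^sup>2 - \<alpha> * \<rho> z s = 0"
        using rel[OF z s] nz[OF z s] by simp
      show ?thesis
        by (rule DERIV_cong[OF DERIV_diff[OF has_field_derivative_log_derivative[OF dE(1,2)[OF z] nz[OF z s]]
            DERIV_cmult[OF dN[OF z]]] z0])
    qed
    from constant_on_ball_of_DERIV_zero[OF this t] have "Es t s / E t s - \<alpha> * N t s = v s"
      by (simp add: N0 v_def)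
    then show ?thesis using nz[OF t s] by (simp add: field_simps)
  qed
  have vh: "v holomorphic_on ?D"
    unfolding v_def[abs_def] E Es using nz[OF D0] 
    by (intro holomorphic_intros hol holomorphic_deriv) (auto simp: E)
  \<comment> \<open>Division by \<open>E t 0\<close> makes the value at \<open>s = 0\<close> equal
    to 1, a value that every character preserves.\<close>
  define u where "u t = 1 / E t 0" for t
  have uh: "u holomorphic_on ?D"
    unfolding u_def[abs_def] E using nz[OF _ D0] by (intro holomorphic_intros hol) (auto simp: E)
  have fin: "finite (e ` {..<n} \<union> aI ` {..<q} \<union> {u})" by simp
  have Gh: "\<forall>f\<in>e ` {..<n} \<union> aI ` {..<q} \<union> {u}. f holomorphic_on ?D"
    using hol(1) aIh uh by blast
  from generated_algebra[OF fin open_ball Gh] obtain A M where A: "algebra_of_functions A"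
    and M: "countable M" "A \<subseteq> complex_fun.span M" and GA: "e ` {..<n} \<union> aI ` {..<q} \<union> {u} \<subseteq> A"
    and Ah: "\<forall>f\<in>A. f holomorphic_on ?D" by (elim exE conjE)
  note AD = algebra_of_functionsD[OF A]
  have inA: "\<And>i. i < n \<Longrightarrow> e i \<in> A" "\<And>i. i < q \<Longrightarrow> aI i \<in> A" "u \<in> A" using GA by auto
  define f where "f i t = e i t * u t" for i t
  have fA: "f i \<in> A" if "i < n" for i unfolding f_def[abs_def] by (rule AD(3)[OF inA(1)[OF that] inA(3)])
  have lcA: "(\<lambda>t. \<Sum>i<m. g i t * c i) \<in> A" if "\<And>i. i < m \<Longrightarrow> g i \<in> A" for g c and m :: nat
    by (rule algebra_of_functions_sum[OF A finite_lessThan], rule AD(3)[OF that AD(1)]) simp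
  have fsum: "(\<Sum>i<n. f i t * c i) = (\<Sum>i<n. e i t * c i) * u t" for c t
    unfolding f_def sum_distrib_right by (rule sum.cong) (simp_all add: mult_ac)
  have fib: "(\<Sum>i<n. f i t * k i s) = (\<Sum>i<n. f i 0 * k i s)" if t: "t \<in> ?D" and s: "s \<in> ?D" for t s
  proof (rule character_fiber_zero_free[OF r A M _ fA hol(2) _ _ t s])
    show "(\<Sum>i<n. f i t * k i 0) = 1" if "t \<in> ?D" for t
      using nz[OF that D0] by (simp add: fsum u_def E)
    fix x s assume x: "character_on A x" and xv: "\<And>f. f \<in> A \<Longrightarrow> \<forall>t\<in>?D. f t = 0 \<Longrightarrow> x f = 0" and s: "s \<in> ?D"
    have xeq: "x g = x h" if "g \<in> A" "h \<in> A" "\<And>t. t \<in> ?D \<Longrightarrow> g t = h t" for g h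
      by (rule character_on_eqI[OF A x that(1,2) xv[OF AD(5)[OF that(1,2)]]]) (simp add: that(3))
    have xsum: "x (\<lambda>t. \<Sum>i<m. g i t * c i) = (\<Sum>i<m. x (g i) * c i)"
      if "\<And>i. i < m \<Longrightarrow> g i \<in> A" for g c and m :: nat
      by (rule character_on_sum[OF A x finite_lessThan that]) simp
    define F where "F s = (\<Sum>i<n. x (f i) * k i s)" for s
    define w where "w s = (\<Sum>i<q. x (aI i) * (\<alpha> * b i s)) + v s" for s
    \<comment> \<open>The logarithmic \<open>s\<close>-derivative of \<open>E\<close> is a
      combination of elements of the algebra without denominators, so the image \<open>F\<close>
      solves a linear equation with holomorphic coefficient.\<close>
    have "F s \<noteq> 0"
    proof (rule zero_free_linear_ode[of F r w, OF _ _ _ _ s])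
      show "F holomorphic_on ?D" unfolding F_def[abs_def] by (intro holomorphic_intros hol(2)) simp
      show "w holomorphic_on ?D" unfolding w_def[abs_def] by (intro holomorphic_intros hol(4) vh) simp
      have "x (\<lambda>t. \<Sum>i<n. f i t * k i 0) = x (\<lambda>_. 1)"
        by (rule xeq[OF lcA[OF fA] AD(1)]) (use nz[OF _ D0] in \<open>simp_all add: fsum u_def E\<close>)
      then show "F 0 \<noteq> 0" using xsum[OF fA] character_onD(1)[OF x] by (simp add: F_def)
      fix s assume s: "s \<in> ?D"
      have dF: "deriv F s = (\<Sum>i<n. x (f i) * deriv (k i) s)"
        unfolding F_def[abs_def]
        by (rule DERIV_imp_deriv[OF has_field_derivative_linear_combination(2)[OF hol(2) open_ball s]])
      have wA: "(\<lambda>t. \<Sum>i<q. aI i t * (\<alpha> * b i s)) \<in> A" by (rule lcA[OF inA(2)])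
      have wA': "(\<lambda>t. (\<Sum>i<q. aI i t * (\<alpha> * b i s)) + v s) \<in> A" by (rule AD(2)[OF wA AD(1)])
      have FA: "(\<lambda>t. \<Sum>i<n. f i t * k i s) \<in> A" by (rule lcA[OF fA])
      have "x (\<lambda>t. \<Sum>i<n. f i t * deriv (k i) s) =
        x (\<lambda>t. ((\<Sum>i<q. aI i t * (\<alpha> * b i s)) + v s) * (\<Sum>i<n. f i t * k i s))"
      proof (rule xeq[OF lcA[OF fA] AD(3)[OF wA' FA]])
        fix t assume t: "t \<in> ?D"
        have "(\<Sum>i<q. aI i t * (\<alpha> * b i s)) = \<alpha> * N t s" by (simp add: N_def sum_distrib_left mult_ac)
        then show "(\<Sum>i<n. f i t * deriv (k i) s) = ((\<Sum>i<q. aI i t * (\<alpha> * b i s)) + v s) * (\<Sum>i<n. f i t * k i s)"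
          using EN[OF t s] by (simp add: fsum E Es)
      qed simp
      also have "\<dots> = x (\<lambda>t. (\<Sum>i<q. aI i t * (\<alpha> * b i s)) + v s) * x (\<lambda>t. \<Sum>i<n. f i t * k i s)"
        by (rule character_onD(3)[OF x wA' FA])
      also have "x (\<lambda>t. (\<Sum>i<q. aI i t * (\<alpha> * b i s)) + v s) = w s"
        using character_onD(2)[OF x wA AD(1)[of "v s"]] character_onD(1)[OF x, of "v s"] xsum[OF inA(2)]
        by (simp add: w_def)
      finally show "deriv F s = w s * F s" by (simp add: dF F_def xsum[OF fA])
    qed
    then show "(\<Sum>i<n. x (f i) * k i s) \<noteq> 0" by (simp add: F_def)
  qed (use Ah in auto)
  \<comment> \<open>\<open>E\<close> has become a product of a function of \<open>t\<close> and a
    function of \<open>s\<close>, so its mixed logarithmic derivative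
    \<open>\<alpha> * \<rho>\<close> vanishes.\<close>
  have cst: "E t s * E 0 0 = E t 0 * E 0 s" if "t \<in> ?D" "s \<in> ?D" for t s
  proof -
    have "E t s * u t = E 0 s * u 0" using fib[OF that] unfolding fsum E .
    then show ?thesis using nz[OF that(1) D0] nz[OF D0 D0] by (simp add: u_def field_simps)
  qed
  have cst': "Es t s * E 0 0 = E t 0 * Es 0 s" if t: "t \<in> ?D" and s: "s \<in> ?D" for t s
  proof -
    have "((\<lambda>s. E t s * E 0 0) has_field_derivative Es t s * E 0 0) (at s)"
      by (intro DERIV_cmult_right dE(3)[OF s])
    moreover have "((\<lambda>s. E t s * E 0 0) has_field_derivative E t 0 * Es 0 s) (at s)"
      by (rule has_field_derivative_transform_within_open[OF DERIV_cmult[OF dE(3)[OF s]] open_ball s])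
         (simp add: cst[OF t])
    ultimately show ?thesis by (rule DERIV_unique)
  qed
  have "\<alpha> * N t 0 = 0" if t: "t \<in> ?D" for t
  proof -
    have "Es t 0 * E 0 0 = E t 0 * (v 0 * E 0 0)" using cst'[OF t D0] nz[OF D0 D0] by (simp add: v_def)
    then have "Es t 0 = v 0 * E t 0" using nz[OF D0 D0] by simp
    then show ?thesis using EN[OF t D0] nz[OF t D0] by (simp add: algebra_simps)
  qed
  then have "((\<lambda>t. \<alpha> * N t 0) has_field_derivative 0) (at 0)"
    by (intro has_field_derivative_transform_within_open[OF DERIV_const open_ball D0, of "0::complex"]) auto
  then have "\<alpha> * \<rho> 0 0 = 0" using DERIV_cmult[OF dN[OF D0, of 0], of \<alpha>] DERIV_unique by blast
  then show ?thesis using rho0 by simp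
qed

text \<open>Unlike in the flat case \<open>P\<close> occurs as a denominator, so the equation for
  the image of \<open>E\<close> may have poles at zeros of the image of \<open>P\<close>. An
  irrational \<open>\<beta>\<close> excludes such zeros, and then \<open>P\<close> splits as a
  product. This contradicts \<open>nondeg\<close>, which says that the mixed logarithmic derivative
  of \<open>P\<close> is nonzero at the origin.\<close>

lemma curved_rank_argument:
  fixes e k p l :: "nat \<Rightarrow> complex \<Rightarrow> complex" and \<beta> :: complex
  assumes r: "r > 0"
    and hol: "\<And>i. i < n \<Longrightarrow> e i holomorphic_on ball 0 r" "\<And>i. i < n \<Longrightarrow> k i holomorphic_on ball 0 r"
      "\<And>i. i < q \<Longrightarrow> p i holomorphic_on ball 0 r" "\<And>i. i < q \<Longrightarrow> l i holomorphic_on ball 0 r"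
    and E: "\<And>t s. E t s = (\<Sum>i<n. e i t * k i s)"
    and Et: "\<And>t s. Et t s = (\<Sum>i<n. deriv (e i) t * k i s)"
    and Es: "\<And>t s. Es t s = (\<Sum>i<n. e i t * deriv (k i) s)"
    and Ets: "\<And>t s. Ets t s = (\<Sum>i<n. deriv (e i) t * deriv (k i) s)"
    and P: "\<And>t s. P t s = (\<Sum>i<q. p i t * l i s)"
    and Pt: "\<And>t s. Pt t s = (\<Sum>i<q. deriv (p i) t * l i s)"
    and Ps: "\<And>t s. Ps t s = (\<Sum>i<q. p i t * deriv (l i) s)"
    and Pts: "\<And>t s. Pts t s = (\<Sum>i<q. deriv (p i) t * deriv (l i) s)"
    and nz: "\<And>t s. t \<in> ball 0 r \<Longrightarrow> s \<in> ball 0 r \<Longrightarrow> E t s \<noteq> 0"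
      "\<And>t s. t \<in> ball 0 r \<Longrightarrow> s \<in> ball 0 r \<Longrightarrow> P t s \<noteq> 0"
    and rel: "\<And>t s. t \<in> ball 0 r \<Longrightarrow> s \<in> ball 0 r \<Longrightarrow>
      (E t s * Ets t s - Et t s * Es t s) * (P t s)\<^sup>2 = \<beta> * (P t s * Pts t s - Pt t s * Ps t s) * (E t s)\<^sup>2"
    and nondeg: "P 0 0 * Pts 0 0 - Pt 0 0 * Ps 0 0 \<noteq> 0"
  shows "\<beta> \<in> \<rat>"
proof (rule ccontr)
  assume irr: "\<beta> \<notin> \<rat>"
  let ?D = "ball (0::complex) r"
  have D0: "0 \<in> ?D" using r by simp
  have dE: "((\<lambda>t. E t s) has_field_derivative Et t s) (at t)"
      "((\<lambda>t. Es t s) has_field_derivative Ets t s) (at t)"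
      "(E t' has_field_derivative Es t' t) (at t)" if "t \<in> ?D" for t s t'
  proof -
    show "((\<lambda>t. E t s) has_field_derivative Et t s) (at t)" unfolding E Et
      by (rule has_field_derivative_linear_combination(1)[OF hol(1) open_ball that])
    show "((\<lambda>t. Es t s) has_field_derivative Ets t s) (at t)" unfolding Es Ets
      by (rule has_field_derivative_linear_combination(1)[OF hol(1) open_ball that])
    show "(E t' has_field_derivative Es t' t) (at t)" unfolding E[abs_def] Es
      by (rule has_field_derivative_linear_combination(2)[OF hol(2) open_ball that])
  qed
  have dP: "((\<lambda>t. P t s) has_field_derivative Pt t s) (at t)"
      "((\<lambda>t. Ps t s) has_field_derivative Pts t s) (at t)"
      "(P t' has_field_derivative Ps t' t) (at t)" if "t \<in> ?D" for t s t'
  proof -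
    show "((\<lambda>t. P t s) has_field_derivative Pt t s) (at t)" unfolding P Pt
      by (rule has_field_derivative_linear_combination(1)[OF hol(3) open_ball that])
    show "((\<lambda>t. Ps t s) has_field_derivative Pts t s) (at t)" unfolding Ps Pts
      by (rule has_field_derivative_linear_combination(1)[OF hol(3) open_ball that])
    show "(P t' has_field_derivative Ps t' t) (at t)" unfolding P[abs_def] Ps
      by (rule has_field_derivative_linear_combination(2)[OF hol(4) open_ball that])
  qed
  \<comment> \<open>The constant of integration once the relation has been integrated in
    \<open>t\<close> from \<open>t = 0\<close>.\<close>
  define v where "v s = Es 0 s / E 0 s - \<beta> * (Ps 0 s / P 0 s)" for s
  have EP: "Es t s * P t s = (\<beta> * Ps t s + v s * P t s) * E t s" if t: "t \<in> ?D" and s: "s \<in> ?D" for t s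
  proof -
    have "((\<lambda>t. Es t s / E t s - \<beta> * (Ps t s / P t s)) has_field_derivative 0) (at z)" if z: "z \<in> ?D" for z
    proof -
      have z0: "(E z s * Ets z s - Et z s * Es z s) / (E z s)\<^sup>2 -
          \<beta> * ((P z s * Pts z s - Pt z s * Ps z s) / (P z s)\<^sup>2) = 0"
        using rel[OF z s] nz(1)[OF z s] nz(2)[OF z s] by (simp add: field_simps)
      show ?thesis
        by (rule DERIV_cong[OF DERIV_diff[OF has_field_derivative_log_derivative[OF dE(1,2)[OF z] nz(1)[OF z s]]
            DERIV_cmult[OF has_field_derivative_log_derivative[OF dP(1,2)[OF z] nz(2)[OF z s]]]] z0])
    qed
    from constant_on_ball_of_DERIV_zero[OF this t] have "Es t s / E t s - \<beta> * (Ps t s / P t s) = v s"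
      by (simp add: v_def)
    then show ?thesis using nz(1)[OF t s] nz(2)[OF t s] by (simp add: field_simps)
  qed
  have vh: "v holomorphic_on ?D"
    unfolding v_def[abs_def] E Es P Ps using nz(1)[OF D0] nz(2)[OF D0]
    by (intro holomorphic_intros hol holomorphic_deriv) (auto simp: E P)
  define u where "u t = 1 / E t 0" for t
  define y where "y t = 1 / P t 0" for t
  have uh: "u holomorphic_on ?D"
    unfolding u_def[abs_def] E using nz(1)[OF _ D0] by (intro holomorphic_intros hol) (auto simp: E)
  have yh: "y holomorphic_on ?D"
    unfolding y_def[abs_def] P using nz(2)[OF _ D0] by (intro holomorphic_intros hol) (auto simp: P)
  have fin: "finite (e ` {..<n} \<union> p ` {..<q} \<union> {u, y})" by simp
  have Gh: "\<forall>f\<in>e ` {..<n} \<union> p ` {..<q} \<union> {u, y}. f holomorphic_on ?D"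
    using hol(1,3) uh yh by blast
  from generated_algebra[OF fin open_ball Gh] obtain A M where A: "algebra_of_functions A"
    and M: "countable M" "A \<subseteq> complex_fun.span M" and GA: "e ` {..<n} \<union> p ` {..<q} \<union> {u, y} \<subseteq> A"
    and Ah: "\<forall>f\<in>A. f holomorphic_on ?D" by (elim exE conjE)
  note AD = algebra_of_functionsD[OF A]
  have inA: "\<And>i. i < n \<Longrightarrow> e i \<in> A" "\<And>i. i < q \<Longrightarrow> p i \<in> A" "u \<in> A" "y \<in> A" using GA by auto
  define f where "f i t = e i t * u t" for i t
  define g where "g i t = p i t * y t" for i t
  have fA: "f i \<in> A" if "i < n" for i unfolding f_def[abs_def] by (rule AD(3)[OF inA(1)[OF that] inA(3)])
  have gA: "g i \<in> A" if "i < q" for i unfolding g_def[abs_def] by (rule AD(3)[OF inA(2)[OF that] inA(4)])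
  have lcA: "(\<lambda>t. \<Sum>i<m. h i t * c i) \<in> A" if "\<And>i. i < m \<Longrightarrow> h i \<in> A" for h c and m :: nat
    by (rule algebra_of_functions_sum[OF A finite_lessThan], rule AD(3)[OF that AD(1)]) simp
  have fsum: "(\<Sum>i<n. f i t * c i) = (\<Sum>i<n. e i t * c i) * u t" for c t
    unfolding f_def sum_distrib_right by (rule sum.cong) (simp_all add: mult_ac)
  have gsum: "(\<Sum>i<q. g i t * c i) = (\<Sum>i<q. p i t * c i) * y t" for c t
    unfolding g_def sum_distrib_right by (rule sum.cong) (simp_all add: mult_ac)
  have fib: "(\<Sum>i<q. g i t * l i s) = (\<Sum>i<q. g i 0 * l i s)" if t: "t \<in> ?D" and s: "s \<in> ?D" for t s
  proof (rule character_fiber_zero_free[OF r A M _ gA hol(4) _ _ t s])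
    show "(\<Sum>i<q. g i t * l i 0) = 1" if "t \<in> ?D" for t
      using nz(2)[OF that D0] by (simp add: gsum y_def P)
    fix x s assume x: "character_on A x" and xv: "\<And>f. f \<in> A \<Longrightarrow> \<forall>t\<in>?D. f t = 0 \<Longrightarrow> x f = 0" and s: "s \<in> ?D"
    have xeq: "x g = x h" if "g \<in> A" "h \<in> A" "\<And>t. t \<in> ?D \<Longrightarrow> g t = h t" for g h
      by (rule character_on_eqI[OF A x that(1,2) xv[OF AD(5)[OF that(1,2)]]]) (simp add: that(3))
    have xsum: "x (\<lambda>t. \<Sum>i<m. g i t * c i) = (\<Sum>i<m. x (g i) * c i)"
      if "\<And>i. i < m \<Longrightarrow> g i \<in> A" for g c and m :: nat
      by (rule character_on_sum[OF A x finite_lessThan that]) simp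
    define F where "F s = (\<Sum>i<q. x (g i) * l i s)" for s
    define H where "H s = (\<Sum>i<n. x (f i) * k i s)" for s
    have Fh: "F holomorphic_on ?D" unfolding F_def[abs_def] by (intro holomorphic_intros hol(4)) simp
    have Hh: "H holomorphic_on ?D" unfolding H_def[abs_def] by (intro holomorphic_intros hol(2)) simp
    have "x (\<lambda>t. \<Sum>i<n. f i t * k i 0) = x (\<lambda>_. 1)"
      by (rule xeq[OF lcA[OF fA] AD(1)]) (use nz(1)[OF _ D0] in \<open>simp_all add: fsum u_def E\<close>)
    then have H0: "H 0 \<noteq> 0" using xsum[OF fA] character_onD(1)[OF x] by (simp add: H_def)
    have "x (\<lambda>t. \<Sum>i<q. g i t * l i 0) = x (\<lambda>_. 1)"
      by (rule xeq[OF lcA[OF gA] AD(1)]) (use nz(2)[OF _ D0] in \<open>simp_all add: gsum y_def P\<close>)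
    then have F0: "F 0 \<noteq> 0" using xsum[OF gA] character_onD(1)[OF x] by (simp add: F_def)
    have eq: "deriv H s * F s = (\<beta> * deriv F s + v s * F s) * H s" if s: "s \<in> ?D" for s
    proof -
      have dF: "deriv F s = (\<Sum>i<q. x (g i) * deriv (l i) s)"
        unfolding F_def[abs_def]
        by (rule DERIV_imp_deriv[OF has_field_derivative_linear_combination(2)[OF hol(4) open_ball s]])
      have dH: "deriv H s = (\<Sum>i<n. x (f i) * deriv (k i) s)"
        unfolding H_def[abs_def]
        by (rule DERIV_imp_deriv[OF has_field_derivative_linear_combination(2)[OF hol(2) open_ball s]])
      define h0 where "h0 = (\<lambda>t. \<Sum>i<n. f i t * k i s)"
      define h1 where "h1 = (\<lambda>t. \<Sum>i<n. f i t * deriv (k i) s)"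
      define f0 where "f0 = (\<lambda>t. \<Sum>i<q. g i t * l i s)"
      define f1 where "f1 = (\<lambda>t. \<Sum>i<q. g i t * deriv (l i) s)"
      have hA: "h0 \<in> A" "h1 \<in> A" "f0 \<in> A" "f1 \<in> A"
        unfolding h0_def h1_def f0_def f1_def by (rule lcA[OF fA] lcA[OF gA]; simp)+
      have xh: "x h0 = H s" "x h1 = deriv H s" "x f0 = F s" "x f1 = deriv F s"
        unfolding h0_def h1_def f0_def f1_def dF dH unfolding H_def F_def by (simp_all add: xsum fA gA)
      have sA: "(\<lambda>t. \<beta> * f1 t + v s * f0 t) \<in> A" by (rule AD(2)[OF AD(4)[OF hA(4)] AD(4)[OF hA(3)]])
      have "x (\<lambda>t. h1 t * f0 t) = x (\<lambda>t. (\<beta> * f1 t + v s * f0 t) * h0 t)"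
      proof (rule xeq[OF AD(3)[OF hA(2,3)] AD(3)[OF sA hA(1)]])
        fix t assume t: "t \<in> ?D"
        \<comment> \<open>The factor \<open>u t * y t\<close> passes from \<open>E\<close> and
          \<open>P\<close> to their versions normalised at \<open>s = 0\<close>.\<close>
        have "(Es t s * P t s) * (u t * y t) = ((\<beta> * Ps t s + v s * P t s) * E t s) * (u t * y t)"
          using EP[OF t s] by simp
        then show "h1 t * f0 t = (\<beta> * f1 t + v s * f0 t) * h0 t"
          unfolding h0_def h1_def f0_def f1_def fsum gsum E P Es Ps by (simp add: algebra_simps)
      qed
      also have "\<dots> = x (\<lambda>t. \<beta> * f1 t + v s * f0 t) * x h0" by (rule character_onD(3)[OF x sA hA(1)])
      also have "x (\<lambda>t. \<beta> * f1 t + v s * f0 t) = x (\<lambda>t. \<beta> * f1 t) + x (\<lambda>t. v s * f0 t)"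
        by (rule character_onD(2)[OF x AD(4)[OF hA(4)] AD(4)[OF hA(3)]])
      also have "x (\<lambda>t. \<beta> * f1 t) = \<beta> * x f1"
        using character_onD(3)[OF x AD(1)[of \<beta>] hA(4)] character_onD(1)[OF x, of \<beta>] by simp
      also have "x (\<lambda>t. v s * f0 t) = v s * x f0"
        using character_onD(3)[OF x AD(1)[of "v s"] hA(3)] character_onD(1)[OF x, of "v s"] by simp
      finally show ?thesis using character_onD(3)[OF x hA(2,3)] by (simp add: xh)
    qed
    have "F s \<noteq> 0" using log_derivative_order[OF Fh Hh vh eq F0 H0 s] irr by auto
    then show "(\<Sum>i<q. x (g i) * l i s) \<noteq> 0" by (simp add: F_def)
  qed (use Ah in auto)
  have cst: "P t s * P 0 0 = P t 0 * P 0 s" if "t \<in> ?D" "s \<in> ?D" for t s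
  proof -
    have "P t s * y t = P 0 s * y 0" using fib[OF that] unfolding gsum P .
    then show ?thesis using nz(2)[OF that(1) D0] nz(2)[OF D0 D0] by (simp add: y_def field_simps)
  qed
  have cst': "Ps t 0 * P 0 0 = P t 0 * Ps 0 0" if t: "t \<in> ?D" for t
  proof -
    have "((\<lambda>s. P t s * P 0 0) has_field_derivative Ps t 0 * P 0 0) (at 0)"
      by (intro DERIV_cmult_right dP(3)[OF D0])
    moreover have "((\<lambda>s. P t s * P 0 0) has_field_derivative P t 0 * Ps 0 0) (at 0)"
      by (rule has_field_derivative_transform_within_open[OF DERIV_cmult[OF dP(3)[OF D0]] open_ball D0])
         (simp add: cst[OF t])
    ultimately show ?thesis by (rule DERIV_unique)
  qed
  have "((\<lambda>t. Ps t 0 * P 0 0) has_field_derivative Pts 0 0 * P 0 0) (at 0)"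
    by (intro DERIV_cmult_right dP(2)[OF D0])
  moreover have "((\<lambda>t. Ps t 0 * P 0 0) has_field_derivative Pt 0 0 * Ps 0 0) (at 0)"
    by (rule has_field_derivative_transform_within_open[OF DERIV_cmult_right[OF dP(1)[OF D0]] open_ball D0])
       (simp add: cst')
  ultimately have "Pts 0 0 * P 0 0 = Pt 0 0 * Ps 0 0" by (rule DERIV_unique)
  then show False using nondeg by (simp add: mult.commute)
qed

no_notation fps_nth (infixl "$" 75)

section \<open>Holomorphic linear differential equations and Wirtinger derivatives\<close>

lemma power_series_eval:
  assumes "\<And>w. w \<in> ball 0 r \<Longrightarrow> (\<lambda>n. fps_nth F n * w ^ n) sums f w" "r > 0"
  shows "fps_conv_radius F \<ge> ereal r" "w \<in> ball 0 r \<Longrightarrow> eval_fps F w = (f w :: complex)"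
proof -
  have "conv_radius (fps_nth F) \<ge> ereal \<rho>" if "0 < \<rho>" "\<rho> < r" for \<rho>
    using conv_radius_geI[of "fps_nth F" "of_real \<rho>"] assms(1)[of "of_real \<rho>"] that
    by (auto dest: sums_summable)
  note le = this
  show "fps_conv_radius F \<ge> ereal r"
  proof (rule ccontr)
    assume "\<not> ?thesis"
    then obtain \<rho> where \<rho>: "conv_radius (fps_nth F) < ereal \<rho>" "ereal \<rho> < ereal r"
      unfolding fps_conv_radius_def not_le using ereal_dense2 by blast
    moreover have "0 \<le> conv_radius (fps_nth F)" by (rule conv_radius_nonneg)
    ultimately have "0 < ereal \<rho>" by (meson order.strict_trans1)
    then show False using le[of \<rho>] \<rho> by simp
  qed
  show "w \<in> ball 0 r \<Longrightarrow> eval_fps F w = f w"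
    unfolding eval_fps_def using sums_unique[OF assms(1)] by metis
qed

text \<open>Comparing power series in \<open>X' = M X\<close> with \<open>X 0 = 1\<close> gives this
  recursion, \<open>m j\<close> being the matrix coefficients of \<open>M\<close>.\<close>

fun ode_coeffs :: "(nat \<Rightarrow> 'k::finite \<Rightarrow> 'k \<Rightarrow> complex) \<Rightarrow> nat \<Rightarrow> 'k \<Rightarrow> 'k \<Rightarrow> complex" where
  "ode_coeffs m 0 = (\<lambda>a b. if a = b then 1 else 0)"
| "ode_coeffs m (Suc n) = (\<lambda>a b. (\<Sum>j\<le>n. \<Sum>c\<in>UNIV. m j a c * ode_coeffs m (n - j) c b) / of_nat (Suc n))"

text \<open>A majorant argument: the convolution for the index \<open>k + 1\<close> has
  \<open>k + 1\<close> summands with a common bound, and the division by \<open>k + 1\<close>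
  cancels their number. The summand \<open>q\<close> in the base lets the powers of \<open>q\<close>
  be absorbed.\<close>

lemma ode_coeffs_bound:
  fixes m :: "nat \<Rightarrow> 'k::finite \<Rightarrow> 'k \<Rightarrow> complex"
  assumes m: "\<And>j a b. norm (m j a b) \<le> K * q ^ j" and q: "q > 0" "K \<ge> 0"
  shows "norm (ode_coeffs m n a b) \<le> (real CARD('k) * K + q) ^ n"
proof (induction n arbitrary: a b rule: less_induct)
  case (less n)
  define Q where "Q = real CARD('k) * K + q"
  have Q: "q \<le> Q" "Q > 0" "real CARD('k) * K \<le> Q" using q by (auto simp: Q_def add_nonneg_pos)
  show ?case
  proof (cases n)
    case (Suc k)
    have "norm (\<Sum>j\<le>k. \<Sum>c\<in>UNIV. m j a c * ode_coeffs m (k - j) c b) \<le>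
        (\<Sum>j\<le>k. real CARD('k) * K * Q ^ k)"
    proof (rule sum_norm_le)
      fix j assume j: "j \<in> {..k}"
      have "norm (m j a c * ode_coeffs m (k - j) c b) \<le> K * Q ^ k" for c
      proof -
        have "norm (m j a c * ode_coeffs m (k - j) c b) \<le> (K * q ^ j) * Q ^ (k - j)"
          unfolding norm_mult using m[of j a c] less.IH[of "k - j" c b] Suc q
          by (intro mult_mono) (auto simp: Q_def)
        also have "\<dots> \<le> (K * Q ^ j) * Q ^ (k - j)"
          using q Q by (intro mult_right_mono mult_left_mono power_mono) auto
        also have "\<dots> = K * Q ^ k" using j by (simp flip: power_add)
        finally show ?thesis .
      qed
      then have "norm (\<Sum>c\<in>UNIV. m j a c * ode_coeffs m (k - j) c b) \<le> (\<Sum>c\<in>(UNIV::'k set). K * Q ^ k)"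
        by (intro sum_norm_le)
      then show "norm (\<Sum>c\<in>UNIV. m j a c * ode_coeffs m (k - j) c b) \<le> real CARD('k) * K * Q ^ k"
        by simp
    qed
    then have "norm (ode_coeffs m n a b) \<le> real CARD('k) * K * Q ^ k"
      by (simp add: Suc norm_divide divide_simps mult.commute del: of_nat_Suc)
    also have "\<dots> \<le> Q * Q ^ k" using Q by (intro mult_right_mono) auto
    finally show ?thesis by (simp add: Suc Q_def)
  qed simp
qed

text \<open>Solution by power series, convergent for \<open>norm t < 1 / Q\<close>. The smaller disc
  is harmless, since the whole argument is local.\<close>

lemma holomorphic_linear_ode:
  fixes M :: "'k::finite \<Rightarrow> 'k \<Rightarrow> complex \<Rightarrow> complex"
  assumes r: "r > 0" and hol: "\<And>a b. M a b holomorphic_on ball 0 r"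
  shows "\<exists>d X. 0 < d \<and> d \<le> r \<and> (\<forall>a b. X a b 0 = (if a = b then 1 else 0)) \<and>
    (\<forall>a b. \<forall>t\<in>ball 0 d. (X a b has_field_derivative (\<Sum>c\<in>UNIV. M a c t * X c b t)) (at t))"
proof -
  define m where "m j a b = (deriv ^^ j) (M a b) 0 / fact j" for j a b
  have sums: "(\<lambda>j. m j a b * w ^ j) sums M a b w" if "w \<in> ball 0 r" for a b w
    using holomorphic_power_series[OF hol that, of a b] by (simp add: m_def)
  \<comment> \<open>The series converges at \<open>r / 2\<close>, so its terms there are
    bounded.\<close>
  have "\<exists>B. \<forall>j. norm (m j a b) \<le> B * (2 / r) ^ j" for a b
  proof -
    have "summable (\<lambda>j. m j a b * of_real (r / 2) ^ j)"
      using sums[of "of_real (r / 2)" a b] r sums_summable by auto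
    then have "Bseq (\<lambda>j. m j a b * of_real (r / 2) ^ j)"
      by (intro convergent_imp_Bseq convergentI[OF summable_LIMSEQ_zero])
    then obtain B where B: "\<And>j. norm (m j a b * of_real (r / 2) ^ j) \<le> B" unfolding Bseq_def by auto
    have "norm (m j a b) \<le> B * (2 / r) ^ j" for j
    proof -
      have "norm (m j a b) * (r / 2) ^ j \<le> B" using B[of j] r unfolding norm_mult norm_power norm_of_real by simp
      then have "norm (m j a b) * (r / 2) ^ j * (2 / r) ^ j \<le> B * (2 / r) ^ j"
        using r by (intro mult_right_mono) auto
      moreover have "(r / 2) ^ j * (2 / r) ^ j = 1" using r by (simp flip: power_mult_distrib)
      ultimately show ?thesis by (simp add: mult.assoc)
    qed
    then show ?thesis by blast
  qed
  then obtain B where B: "\<And>a b j. norm (m j a b) \<le> B a b * (2 / r) ^ j" by metis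
  define K where "K = (\<Sum>a\<in>UNIV. \<Sum>b\<in>UNIV. \<bar>B a b\<bar>)"
  have BK: "B a b \<le> K" for a b
  proof -
    have "B a b \<le> \<bar>B a b\<bar>" by simp
    also have "\<dots> \<le> (\<Sum>b\<in>UNIV. \<bar>B a b\<bar>)" by (intro member_le_sum) auto
    also have "\<dots> \<le> K" unfolding K_def by (intro member_le_sum[of a UNIV "\<lambda>a. \<Sum>b\<in>UNIV. \<bar>B a b\<bar>"]) (auto intro: sum_nonneg)
    finally show ?thesis .
  qed
  have K0: "K \<ge> 0" unfolding K_def by (intro sum_nonneg) auto
  have mK: "norm (m j a b) \<le> K * (2 / r) ^ j" for j a b
    by (rule order_trans[OF B mult_right_mono[OF BK]]) (use r in simp)
  define Q where "Q = real CARD('k) * K + 2 / r"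
  have Q: "Q > 0" using K0 r by (auto simp: Q_def add_nonneg_pos)
  define x where "x = ode_coeffs m"
  have xb: "norm (x n a b) \<le> Q ^ n" for n a b
    unfolding x_def Q_def using r K0 by (intro ode_coeffs_bound mK) auto
  define F where "F a b = Abs_fps (\<lambda>n. m n a b)" for a b
  define X where "X a b = Abs_fps (\<lambda>n. x n a b)" for a b
  have F: "fps_conv_radius (F a b) \<ge> ereal r" "w \<in> ball 0 r \<Longrightarrow> eval_fps (F a b) w = M a b w" for a b w
    using power_series_eval[of r "F a b" "M a b"] sums r by (auto simp: F_def)
  define d where "d = min r (1 / Q)"
  have d: "0 < d" "d \<le> r" "d \<le> 1 / Q" using r Q by (auto simp: d_def)
  have XR: "fps_conv_radius (X a b) \<ge> ereal d" for a b
  proof (rule power_series_eval(1)[of d "X a b" "\<lambda>w. \<Sum>n. fps_nth (X a b) n * w ^ n"])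
    fix w :: complex assume w: "w \<in> ball 0 d"
    have "Q * norm w < Q * d" using w Q by (intro mult_strict_left_mono) auto
    moreover have "Q * d \<le> 1" using d(3) Q by (simp add: field_simps)
    ultimately have "Q * norm w < 1" by linarith
    moreover have "norm (fps_nth (X a b) n * w ^ n) \<le> (Q * norm w) ^ n" for n
      using xb[of n a b] by (simp add: X_def norm_mult norm_power power_mult_distrib mult_right_mono)
    ultimately have "summable (\<lambda>n. fps_nth (X a b) n * w ^ n)"
      using Q by (intro summable_comparison_test[OF _ summable_geometric[of "Q * norm w"]]) auto
    then show "(\<lambda>n. fps_nth (X a b) n * w ^ n) sums (\<Sum>n. fps_nth (X a b) n * w ^ n)"
      by (rule summable_sums)
  qed (use d in auto)
  have ode: "fps_deriv (X a b) = (\<Sum>c\<in>UNIV. F a c * X c b)" for a b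
  proof (rule fps_ext)
    fix n
    have "fps_nth (fps_deriv (X a b)) n = (\<Sum>j\<le>n. \<Sum>c\<in>UNIV. m j a c * x (n - j) c b)"
      by (simp add: X_def x_def del: of_nat_Suc)
    also have "\<dots> = (\<Sum>c\<in>UNIV. \<Sum>j\<le>n. m j a c * x (n - j) c b)" by (rule sum.swap)
    also have "\<dots> = fps_nth (\<Sum>c\<in>UNIV. F a c * X c b) n"
      by (simp add: fps_sum_nth fps_mult_nth F_def X_def atLeast0AtMost)
    finally show "fps_nth (fps_deriv (X a b)) n = fps_nth (\<Sum>c\<in>UNIV. F a c * X c b) n" .
  qed
  have rad: "ereal (norm t) < fps_conv_radius (F a b)" "ereal (norm t) < fps_conv_radius (X a b)" if "t \<in> ball 0 d" for t a b
    using that d F(1)[of a b] XR[of a b] by (auto intro: less_le_trans[of _ "ereal d"] less_le_trans[of _ "ereal r"])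
  have ev: "eval_fps (\<Sum>c\<in>S. F a c * X c b) t = (\<Sum>c\<in>S. M a c t * eval_fps (X c b) t) \<and>
      ereal (norm t) < fps_conv_radius (\<Sum>c\<in>S. F a c * X c b)" if t: "t \<in> ball 0 d" for S a b t
  proof (induction S rule: infinite_finite_induct)
    case (insert c S)
    have "ereal (norm t) < fps_conv_radius (F a c * X c b)"
      by (rule less_le_trans[OF _ fps_conv_radius_mult]) (simp add: rad[OF t])
    moreover from this insert have "ereal (norm t) < fps_conv_radius (F a c * X c b + (\<Sum>c\<in>S. F a c * X c b))"
      by (intro less_le_trans[OF _ fps_conv_radius_add]) simp
    ultimately show ?case
      using insert t d F(2)[of t a c] rad[OF t] by (simp add: eval_fps_add eval_fps_mult)
  qed auto
  show ?thesis
  proof (intro exI conjI allI ballI)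
    show "0 < d" "d \<le> r" by fact+
    show "eval_fps (X a b) 0 = (if a = b then 1 else 0)" for a b
      by (simp add: eval_fps_at_0 X_def x_def)
    show "(eval_fps (X a b) has_field_derivative (\<Sum>c\<in>UNIV. M a c t * eval_fps (X c b) t)) (at t)"
      if "t \<in> ball 0 d" for a b t
    proof -
      have "eval_fps (\<Sum>c\<in>UNIV. F a c * X c b) t = (\<Sum>c\<in>UNIV. M a c t * eval_fps (X c b) t)"
        using ev[OF that] by blast
      then show ?thesis
        using has_field_derivative_eval_fps[OF rad(2)[OF that], of a b UNIV] by (simp add: ode)
    qed
  qed
qed

section \<open>Wirtinger derivatives in one variable\<close>

text \<open>The numbers \<open>a\<close> and \<open>b\<close> are the derivatives with respect to
  \<open>t\<close> and to its conjugate. As a relation it carries real differentiability along, and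
  \<open>b = 0\<close> is complex differentiability.\<close>

definition wirtinger :: "(complex \<Rightarrow> complex) \<Rightarrow> complex \<Rightarrow> complex \<Rightarrow> complex \<Rightarrow> bool" where
  "wirtinger f a b t \<longleftrightarrow> (f has_derivative (\<lambda>d. a * d + b * cnj d)) (at t)"

lemma wirtinger_unique:
  assumes "wirtinger f a b t" "wirtinger f a' b' t"
  shows "a = a'" "b = b'"
proof -
  have "(\<lambda>d. a * d + b * cnj d) = (\<lambda>d. a' * d + b' * cnj d)"
    using assms unfolding wirtinger_def by (rule has_derivative_unique)
  from fun_cong[OF this, of 1] fun_cong[OF this, of \<i>]
  have 1: "a + b = a' + b'" and "(a - b) * \<i> = (a' - b') * \<i>" by (simp_all add: left_diff_distrib)
  then have 2: "a - b = a' - b'" by simp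
  have "a = ((a + b) + (a - b)) / 2" "b = ((a + b) - (a - b)) / 2" by simp_all
  then show "a = a'" "b = b'" unfolding 1 2 by simp_all
qed

lemma wirtinger_const: "wirtinger (\<lambda>t. c) 0 0 t"
  unfolding wirtinger_def by simp

lemma wirtinger_add:
  assumes "wirtinger f a b t" "wirtinger g a' b' t"
  shows "wirtinger (\<lambda>t. f t + g t) (a + a') (b + b') t"
  using has_derivative_add[OF assms[unfolded wirtinger_def]] unfolding wirtinger_def
  by (simp add: algebra_simps)

lemma wirtinger_mult:
  assumes "wirtinger f a b t" "wirtinger g a' b' t"
  shows "wirtinger (\<lambda>t. f t * g t) (a * g t + f t * a') (b * g t + f t * b') t"
  using has_derivative_mult[OF assms[unfolded wirtinger_def]] unfolding wirtinger_def
  by (simp add: algebra_simps)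

lemma wirtinger_cmult:
  assumes "wirtinger f a b t"
  shows "wirtinger (\<lambda>t. c * f t) (c * a) (c * b) t"
  using wirtinger_mult[OF wirtinger_const assms, of c] by simp

lemma wirtinger_minus:
  assumes "wirtinger f a b t"
  shows "wirtinger (\<lambda>t. - f t) (- a) (- b) t"
  using wirtinger_cmult[OF assms, of "-1"] by simp

lemma wirtinger_diff:
  assumes "wirtinger f a b t" "wirtinger g a' b' t"
  shows "wirtinger (\<lambda>t. f t - g t) (a - a') (b - b') t"
  using wirtinger_add[OF assms(1) wirtinger_minus[OF assms(2)]] by simp

lemma wirtinger_sum:
  assumes "\<And>i. i \<in> I \<Longrightarrow> wirtinger (f i) (a i) (b i) t"
  shows "wirtinger (\<lambda>t. \<Sum>i\<in>I. f i t) (\<Sum>i\<in>I. a i) (\<Sum>i\<in>I. b i) t"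
  using assms by (induction I rule: infinite_finite_induct) (auto intro: wirtinger_add wirtinger_const)

lemma wirtinger_cnj:
  assumes "wirtinger f a b t"
  shows "wirtinger (\<lambda>t. cnj (f t)) (cnj b) (cnj a) t"
  using bounded_linear.has_derivative[OF bounded_linear_cnj assms[unfolded wirtinger_def]]
  unfolding wirtinger_def by (simp add: algebra_simps)

lemma wirtinger_holomorphic:
  assumes "(f has_field_derivative f') (at t)"
  shows "wirtinger f f' 0 t"
  using assms unfolding wirtinger_def has_field_derivative_def by simp

lemma wirtinger_antiholomorphic:
  assumes "(f has_field_derivative f') (at (cnj t))"
  shows "wirtinger (\<lambda>t. f (cnj t)) 0 f' t"
  unfolding wirtinger_def
  using has_derivative_compose[OF has_derivative_cnj[OF has_derivative_ident], of f "\<lambda>d. f' * d" t UNIV] assms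
  by (simp add: has_field_derivative_def)

lemma wirtinger_holomorphicD:
  assumes "wirtinger f a 0 t"
  shows "(f has_field_derivative a) (at t)"
  using assms unfolding wirtinger_def has_field_derivative_def by simp

lemma wirtinger_cong:
  assumes "wirtinger f a b t" "open D" "t \<in> D" "\<And>s. s \<in> D \<Longrightarrow> f s = g s"
  shows "wirtinger g a b t"
  using has_derivative_transform_within_open[OF assms(1)[unfolded wirtinger_def] assms(2,3)] assms(4)
  unfolding wirtinger_def by blast

lemma wirtinger_prod:
  assumes "\<And>i. i \<in> I \<Longrightarrow> wirtinger (f i) (a i) (b i) t"
  shows "wirtinger (\<lambda>t. \<Prod>i\<in>I. f i t) (\<Sum>i\<in>I. a i * (\<Prod>j\<in>I - {i}. f j t))
     (\<Sum>i\<in>I. b i * (\<Prod>j\<in>I - {i}. f j t)) t"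
  using has_derivative_prod[of I f "\<lambda>i d. a i * d + b i * cnj d" t UNIV] assms
  unfolding wirtinger_def
  by (simp add: algebra_simps sum.distrib sum_distrib_left)

lemma wirtinger_zero_const:
  assumes "\<And>t. t \<in> ball 0 r \<Longrightarrow> wirtinger f 0 0 t" "t \<in> ball 0 r"
  shows "f t = f 0"
proof -
  have "\<exists>c. \<forall>x\<in>ball 0 r. f x = c"
    by (rule has_derivative_zero_constant[OF convex_ball])
      (use assms(1) in \<open>auto simp: wirtinger_def intro: has_derivative_at_withinI\<close>)
  then show ?thesis using assms(2) ball_radius_pos[OF assms(2)] by force
qed

text \<open>Jacobi's formula for a solution of \<open>W' = N W\<close>.\<close>

lemma wirtinger_det:
  fixes W :: "complex \<Rightarrow> complex ^ 'k ^ 'k::finite"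
  assumes "\<And>a b. wirtinger (\<lambda>t. W t $ a $ b) (\<Sum>c\<in>UNIV. N a c * W t $ c $ b) (B a b) t"
  shows "\<exists>b. wirtinger (\<lambda>t. det (W t)) ((\<Sum>a\<in>UNIV. N a a) * det (W t)) b t"
proof -
  define A where "A i j = (\<Sum>c\<in>UNIV. N i c * W t $ c $ j)" for i j
  let ?U = "UNIV :: 'k set"
  have row: "(\<Sum>p | p permutes ?U. of_int (sign p) * (A i (p i) * (\<Prod>j\<in>?U - {i}. W t $ j $ p j))) = N i i * det (W t)" for i
  proof -
    have "(\<Sum>p | p permutes ?U. of_int (sign p) * (A i (p i) * (\<Prod>j\<in>?U - {i}. W t $ j $ p j))) =
      det (\<chi> r. if r = i then (\<Sum>c\<in>?U. N i c *s W t $ c) else W t $ r)"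
      unfolding det_def
    proof (rule sum.cong[OF refl])
      fix p
      have "(\<Prod>r\<in>?U. (\<chi> r. if r = i then (\<Sum>c\<in>?U. N i c *s W t $ c) else W t $ r) $ r $ p r) =
        A i (p i) * (\<Prod>j\<in>?U - {i}. W t $ j $ p j)"
        by (subst prod.remove[of _ i]) (auto simp: A_def intro!: prod.cong)
      then show "of_int (sign p) * (A i (p i) * (\<Prod>j\<in>?U - {i}. W t $ j $ p j)) =
        of_int (sign p) * (\<Prod>r\<in>?U. (\<chi> r. if r = i then (\<Sum>c\<in>?U. N i c *s W t $ c) else W t $ r) $ r $ p r)"
        by simp
    qed
    \<comment> \<open>The differentiated row is a combination of the rows of \<open>W t\<close>;
      every summand except \<open>c = i\<close> then has two equal rows.\<close>
    also have "\<dots> = (\<Sum>c\<in>?U. det (\<chi> r. if r = i then N i c *s W t $ c else W t $ r))"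
      using det_linear_row_sum[of ?U i "\<lambda>r c. N r c *s W t $ c" "\<lambda>r. W t $ r"]
      by (simp cong: if_cong)
    also have "\<dots> = (\<Sum>c\<in>?U. if c = i then N i i * det (W t) else 0)"
    proof (rule sum.cong[OF refl])
      fix c
      have "det (\<chi> r. if r = i then N i c *s W t $ c else W t $ r) = N i c * det (\<chi> r. if r = i then W t $ c else W t $ r)"
        by (rule det_row_mul)
      moreover have "det (\<chi> r. if r = i then W t $ c else W t $ r) = 0" if "c \<noteq> i"
        by (rule det_identical_rows[OF that]) (simp add: row_def vec_eq_iff that)
      moreover have "(\<chi> r. if r = i then W t $ i else W t $ r) = W t" by (simp add: vec_eq_iff)
      ultimately show "det (\<chi> r. if r = i then N i c *s W t $ c else W t $ r) = (if c = i then N i i * det (W t) else 0)"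
        by auto
    qed
    finally show ?thesis by simp
  qed
  have "wirtinger (\<lambda>t. det (W t))
     (\<Sum>p | p permutes ?U. of_int (sign p) * (\<Sum>i\<in>?U. A i (p i) * (\<Prod>j\<in>?U - {i}. W t $ j $ p j)))
     (\<Sum>p | p permutes ?U. of_int (sign p) * (\<Sum>i\<in>?U. B i (p i) * (\<Prod>j\<in>?U - {i}. W t $ j $ p j))) t"
    unfolding det_def A_def
    by (intro wirtinger_sum wirtinger_cmult wirtinger_prod assms)
  moreover have "(\<Sum>p | p permutes ?U. of_int (sign p) * (\<Sum>i\<in>?U. A i (p i) * (\<Prod>j\<in>?U - {i}. W t $ j $ p j)))
      = (\<Sum>a\<in>?U. N a a) * det (W t)"
    unfolding sum_distrib_left by (subst sum.swap) (simp add: row flip: sum_distrib_left sum_distrib_right)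
  ultimately show ?thesis by auto
qed

section \<open>Smooth functions\<close>

lemma has_derivative_dir_deriv: "f differentiable (at x) \<Longrightarrow> (f has_derivative dir_deriv f x) (at x)"
  by (simp add: frechet_derivative_works)

lemma dir_deriv_eqI: "(f has_derivative D) (at x) \<Longrightarrow> dir_deriv f x u = D u"
  using frechet_derivative_at by metis

lemma dir_deriv_cong:
  assumes "open S" "x \<in> S" "\<And>y. y \<in> S \<Longrightarrow> f y = g y"
  shows "dir_deriv f x u = dir_deriv g x u" "f differentiable (at x) \<longleftrightarrow> g differentiable (at x)"
proof -
  have *: "(f has_derivative D) (at x) \<longleftrightarrow> (g has_derivative D) (at x)" for D
    using has_derivative_transform_within_open[OF _ assms(1,2), of f D UNIV g]
      has_derivative_transform_within_open[OF _ assms(1,2), of g D UNIV f] assms(3) by auto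
  then show "dir_deriv f x u = dir_deriv g x u" by (simp add: frechet_derivative_def)
  show "f differentiable (at x) \<longleftrightarrow> g differentiable (at x)" using * by (simp add: differentiable_def)
qed

lemma C_on_cong:
  assumes "open S" "\<And>x. x \<in> S \<Longrightarrow> f x = g x" "C_on k S f"
  shows "C_on k S g"
  using assms(2,3)
proof (induction k arbitrary: f g)
  case 0
  then show ?case using continuous_on_cong[of S S f g] by simp
next
  case (Suc k)
  have "C_on k S (\<lambda>x. dir_deriv g x u)" for u
  proof (rule Suc.IH[of "\<lambda>x. dir_deriv f x u"])
    show "dir_deriv f x u = dir_deriv g x u" if "x \<in> S" for x
      by (rule dir_deriv_cong(1)[OF assms(1) that Suc.prems(1)])
    show "C_on k S (\<lambda>x. dir_deriv f x u)" using Suc.prems(2) by simp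
  qed
  moreover have "g differentiable (at x)" if "x \<in> S" for x
    using dir_deriv_cong(2)[of S x f g, OF assms(1) that Suc.prems(1)] Suc.prems(2) that by simp
  ultimately show ?case by simp
qed

lemma C_on_Suc_imp: "C_on (Suc k) S f \<Longrightarrow> C_on k S f"
proof (induction k arbitrary: f)
  case 0
  then show ?case
    by (auto intro!: continuous_at_imp_continuous_on differentiable_imp_continuous_within)
next
  case (Suc k)
  then show ?case by (metis C_on.simps(2))
qed

lemma C_on_const: "C_on k S (\<lambda>x. c)"
  by (induction k arbitrary: c) auto

lemma C_on_bounded_linear:
  assumes "open S" "bounded_linear L" "C_on k S f"
  shows "C_on k S (\<lambda>x. L (f x))"
  using assms(3)
proof (induction k arbitrary: f)
  case 0
  then show ?case using bounded_linear.continuous_on[OF assms(2)] by simp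
next
  case (Suc k)
  have d: "((\<lambda>x. L (f x)) has_derivative (\<lambda>u. L (dir_deriv f x u))) (at x)" if "x \<in> S" for x
    by (rule bounded_linear.has_derivative[OF assms(2) has_derivative_dir_deriv]) (use Suc.prems that in simp)
  have "C_on k S (\<lambda>x. dir_deriv (\<lambda>x. L (f x)) x u)" for u
    by (rule C_on_cong[OF assms(1) _ Suc.IH[of "\<lambda>x. dir_deriv f x u"]])
       (use dir_deriv_eqI[OF d] Suc.prems in auto)
  then show ?case using d by (auto simp: differentiable_def)
qed

lemma C_on_add:
  assumes "open S" "C_on k S f" "C_on k S g"
  shows "C_on k S (\<lambda>x. f x + g x)"
  using assms(2,3)
proof (induction k arbitrary: f g)
  case 0
  then show ?case by (simp add: continuous_on_add)
next
  case (Suc k)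
  have d: "((\<lambda>x. f x + g x) has_derivative (\<lambda>u. dir_deriv f x u + dir_deriv g x u)) (at x)" if "x \<in> S" for x
    by (rule has_derivative_add[OF has_derivative_dir_deriv has_derivative_dir_deriv]) (use Suc.prems that in simp_all)
  have "C_on k S (\<lambda>x. dir_deriv (\<lambda>x. f x + g x) x u)" for u
    by (rule C_on_cong[OF assms(1) _ Suc.IH[of "\<lambda>x. dir_deriv f x u" "\<lambda>x. dir_deriv g x u"]])
       (use dir_deriv_eqI[OF d] Suc.prems in auto)
  then show ?case using d by (auto simp: differentiable_def)
qed

lemma C_on_mult:
  fixes f g :: "'v::euclidean_space \<Rightarrow> 'w::real_normed_algebra"
  assumes "open S" "C_on k S f" "C_on k S g"
  shows "C_on k S (\<lambda>x. f x * g x)"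
  using assms(2,3)
proof (induction k arbitrary: f g)
  case 0
  then show ?case by (simp add: continuous_on_mult)
next
  case (Suc k)
  have d: "((\<lambda>x. f x * g x) has_derivative (\<lambda>u. f x * dir_deriv g x u + dir_deriv f x u * g x)) (at x)" if "x \<in> S" for x
    by (rule has_derivative_mult[OF has_derivative_dir_deriv has_derivative_dir_deriv]) (use Suc.prems that in simp_all)
  have c: "C_on k S f" "C_on k S g" using Suc.prems C_on_Suc_imp by blast+
  have "C_on k S (\<lambda>x. dir_deriv (\<lambda>x. f x * g x) x u)" for u
    by (rule C_on_cong[OF assms(1) _ C_on_add[OF assms(1) Suc.IH[of f "\<lambda>x. dir_deriv g x u"]
          Suc.IH[of "\<lambda>x. dir_deriv f x u" g]]])
       (use dir_deriv_eqI[OF d] Suc.prems c in auto)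
  then show ?case using d by (auto simp: differentiable_def)
qed

lemma C_on_inverse:
  fixes f :: "'v::euclidean_space \<Rightarrow> complex"
  assumes "open S" "C_on k S f" "\<And>x. x \<in> S \<Longrightarrow> f x \<noteq> 0"
  shows "C_on k S (\<lambda>x. inverse (f x))"
  using assms(2)
proof (induction k)
  case 0
  then show ?case using assms(3) by (auto intro: continuous_on_inverse)
next
  case (Suc k)
  have d: "((\<lambda>x. inverse (f x)) has_derivative (\<lambda>u. - (inverse (f x) * dir_deriv f x u * inverse (f x)))) (at x)" if "x \<in> S" for x
    by (rule Deriv.has_derivative_inverse[where f = f and x = x, OF assms(3)[OF that] has_derivative_dir_deriv]) (use Suc.prems that in simp)
  have c: "C_on k S (\<lambda>x. inverse (f x))" using Suc C_on_Suc_imp by blast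
  have "C_on k S (\<lambda>x. dir_deriv (\<lambda>x. inverse (f x)) x u)" for u
    by (rule C_on_cong[OF assms(1) _ C_on_mult[OF assms(1) C_on_const[of k S "-1"]
          C_on_mult[OF assms(1) C_on_mult[OF assms(1) c] c]], of "\<lambda>x. dir_deriv f x u"])
       (use dir_deriv_eqI[OF d] Suc.prems in auto)
  then show ?case using d by (auto simp: differentiable_def)
qed

lemma smooth_onD:
  assumes "smooth_on S f"
  shows "x \<in> S \<Longrightarrow> f differentiable (at x)" "smooth_on S (\<lambda>x. dir_deriv f x u)" "continuous_on S f"
proof -
  have "C_on (Suc 0) S f" "C_on 0 S f" using assms unfolding smooth_on_def by blast+
  then show "x \<in> S \<Longrightarrow> f differentiable (at x)" "continuous_on S f" by auto
  have "C_on (Suc k) S f" for k using assms unfolding smooth_on_def by blast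
  then show "smooth_on S (\<lambda>x. dir_deriv f x u)" unfolding smooth_on_def by simp
qed

lemma smooth_on_const: "smooth_on S (\<lambda>x. c)"
  unfolding smooth_on_def using C_on_const by blast

lemma smooth_on_bounded_linear: "open S \<Longrightarrow> bounded_linear L \<Longrightarrow> smooth_on S f \<Longrightarrow> smooth_on S (\<lambda>x. L (f x))"
  unfolding smooth_on_def using C_on_bounded_linear by blast

lemma smooth_on_add: "open S \<Longrightarrow> smooth_on S f \<Longrightarrow> smooth_on S g \<Longrightarrow> smooth_on S (\<lambda>x. f x + g x)"
  unfolding smooth_on_def using C_on_add by blast

lemma smooth_on_mult:
  fixes f g :: "'v::euclidean_space \<Rightarrow> 'w::real_normed_algebra"
  shows "open S \<Longrightarrow> smooth_on S f \<Longrightarrow> smooth_on S g \<Longrightarrow> smooth_on S (\<lambda>x. f x * g x)"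
  unfolding smooth_on_def using C_on_mult by blast

lemma smooth_on_sum:
  assumes "open S" "finite I" "\<And>i. i \<in> I \<Longrightarrow> smooth_on S (f i)"
  shows "smooth_on S (\<lambda>x. \<Sum>i\<in>I. f i x)"
  using assms(2,3)
  by (induction rule: finite_induct) (auto intro: smooth_on_const smooth_on_add[OF assms(1)])

lemma smooth_on_prod:
  fixes f :: "'i \<Rightarrow> 'v::euclidean_space \<Rightarrow> complex"
  assumes "open S" "finite I" "\<And>i. i \<in> I \<Longrightarrow> smooth_on S (f i)"
  shows "smooth_on S (\<lambda>x. \<Prod>i\<in>I. f i x)"
  using assms(2,3)
  by (induction rule: finite_induct) (auto intro: smooth_on_const smooth_on_mult[OF assms(1)])

lemma smooth_on_divide:
  fixes f g :: "'v::euclidean_space \<Rightarrow> complex"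
  assumes "open S" "smooth_on S f" "smooth_on S g" "\<And>x. x \<in> S \<Longrightarrow> g x \<noteq> 0"
  shows "smooth_on S (\<lambda>x. f x / g x)"
proof -
  have "smooth_on S (\<lambda>x. inverse (g x))"
    using C_on_inverse[where f = g, OF assms(1) _ assms(4)] assms(3) unfolding smooth_on_def by blast
  then show ?thesis using smooth_on_mult[OF assms(1,2)] by (simp add: divide_inverse)
qed

lemma smooth_on_det:
  fixes A :: "'v::euclidean_space \<Rightarrow> complex ^ 'k ^ 'k::finite"
  assumes "open S" "\<And>i j. smooth_on S (\<lambda>x. A x $ i $ j)"
  shows "smooth_on S (\<lambda>x. det (A x))"
  unfolding det_def
  by (intro smooth_on_sum smooth_on_mult smooth_on_const smooth_on_prod assms) (auto simp: finite_permutations)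

text \<open>The second difference quotient is evaluated with the mean value theorem in both orders.\<close>

lemma second_difference_mvt:
  fixes f :: "'v::euclidean_space \<Rightarrow> real"
  assumes f: "smooth_on S f" and "d > 0"
    and sub: "\<And>s t. 0 \<le> s \<Longrightarrow> s \<le> d \<Longrightarrow> 0 \<le> t \<Longrightarrow> t \<le> d \<Longrightarrow> x + s *\<^sub>R u + t *\<^sub>R v \<in> S"
  shows "\<exists>s t. 0 < s \<and> s < d \<and> 0 < t \<and> t < d \<and>
    f (x + d *\<^sub>R u + d *\<^sub>R v) - f (x + d *\<^sub>R u) - f (x + d *\<^sub>R v) + f x =
    d * d * dir_deriv (\<lambda>y. dir_deriv f y u) (x + s *\<^sub>R u + t *\<^sub>R v) v"
proof -
  have du: "((\<lambda>s. f (x + s *\<^sub>R u + t *\<^sub>R v)) has_real_derivative dir_deriv f (x + s *\<^sub>R u + t *\<^sub>R v) u) (at s)"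
    if "0 \<le> s" "s \<le> d" "0 \<le> t" "t \<le> d" for s t
  proof -
    have "((\<lambda>s. x + s *\<^sub>R u + t *\<^sub>R v) has_derivative (\<lambda>h. h *\<^sub>R u)) (at s)"
      by (auto intro!: derivative_eq_intros)
    from has_derivative_compose[OF this has_derivative_dir_deriv[OF smooth_onD(1)[OF f sub[OF that]]]]
    have "((\<lambda>s. f (x + s *\<^sub>R u + t *\<^sub>R v)) has_derivative (\<lambda>h. dir_deriv f (x + s *\<^sub>R u + t *\<^sub>R v) (h *\<^sub>R u))) (at s)" .
    moreover have "dir_deriv f (x + s *\<^sub>R u + t *\<^sub>R v) (h *\<^sub>R u) = dir_deriv f (x + s *\<^sub>R u + t *\<^sub>R v) u * h" for h
      using linear_scale[OF linear_frechet_derivative[OF smooth_onD(1)[OF f sub[OF that]]]] by (simp add: mult.commute)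
    ultimately show ?thesis by (simp add: has_field_derivative_def)
  qed
  have dv: "((\<lambda>t. dir_deriv f (x + s *\<^sub>R u + t *\<^sub>R v) u) has_real_derivative
      dir_deriv (\<lambda>y. dir_deriv f y u) (x + s *\<^sub>R u + t *\<^sub>R v) v) (at t)"
    if "0 \<le> s" "s \<le> d" "0 \<le> t" "t \<le> d" for s t
  proof -
    note df = smooth_onD(1)[OF smooth_onD(2)[OF f] sub[OF that], of u]
    have "((\<lambda>t. x + s *\<^sub>R u + t *\<^sub>R v) has_derivative (\<lambda>h. h *\<^sub>R v)) (at t)"
      by (auto intro!: derivative_eq_intros)
    from has_derivative_compose[OF this has_derivative_dir_deriv[OF df]]
    have "((\<lambda>t. dir_deriv f (x + s *\<^sub>R u + t *\<^sub>R v) u) has_derivative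
      (\<lambda>h. dir_deriv (\<lambda>y. dir_deriv f y u) (x + s *\<^sub>R u + t *\<^sub>R v) (h *\<^sub>R v))) (at t)" .
    moreover have "dir_deriv (\<lambda>y. dir_deriv f y u) (x + s *\<^sub>R u + t *\<^sub>R v) (h *\<^sub>R v) =
      dir_deriv (\<lambda>y. dir_deriv f y u) (x + s *\<^sub>R u + t *\<^sub>R v) v * h" for h
      using linear_scale[OF linear_frechet_derivative[OF df]] by (simp add: mult.commute)
    ultimately show ?thesis by (simp add: has_field_derivative_def)
  qed
  define g where "g s = f (x + s *\<^sub>R u + d *\<^sub>R v) - f (x + s *\<^sub>R u + 0 *\<^sub>R v)" for s
  have "\<exists>s. 0 < s \<and> s < d \<and> g d - g 0 =
      (d - 0) * (dir_deriv f (x + s *\<^sub>R u + d *\<^sub>R v) u - dir_deriv f (x + s *\<^sub>R u + 0 *\<^sub>R v) u)"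
    unfolding g_def by (rule MVT2[OF \<open>d > 0\<close>]) (use \<open>d > 0\<close> in \<open>auto intro!: DERIV_diff du[of _ d] du[of _ 0, simplified]\<close>)
  then obtain s where s: "0 < s" "s < d" "g d - g 0 =
      d * (dir_deriv f (x + s *\<^sub>R u + d *\<^sub>R v) u - dir_deriv f (x + s *\<^sub>R u + 0 *\<^sub>R v) u)" by auto
  have "\<exists>t. 0 < t \<and> t < d \<and> dir_deriv f (x + s *\<^sub>R u + d *\<^sub>R v) u - dir_deriv f (x + s *\<^sub>R u + 0 *\<^sub>R v) u =
      (d - 0) * dir_deriv (\<lambda>y. dir_deriv f y u) (x + s *\<^sub>R u + t *\<^sub>R v) v"
    by (rule MVT2[OF \<open>d > 0\<close>]) (use s in \<open>auto intro!: dv\<close>)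
  then obtain t where t: "0 < t" "t < d" "dir_deriv f (x + s *\<^sub>R u + d *\<^sub>R v) u - dir_deriv f (x + s *\<^sub>R u + 0 *\<^sub>R v) u =
      d * dir_deriv (\<lambda>y. dir_deriv f y u) (x + s *\<^sub>R u + t *\<^sub>R v) v" by auto
  have "g d - g 0 = d * (d * dir_deriv (\<lambda>y. dir_deriv f y u) (x + s *\<^sub>R u + t *\<^sub>R v) v)"
    using s(3) t(3) by simp
  then have "f (x + d *\<^sub>R u + d *\<^sub>R v) - f (x + d *\<^sub>R u) - f (x + d *\<^sub>R v) + f x =
    d * d * dir_deriv (\<lambda>y. dir_deriv f y u) (x + s *\<^sub>R u + t *\<^sub>R v) v"
    by (simp add: g_def)
  with s(1,2) t(1,2) show ?thesis by blast
qed

lemma dir_deriv_commute_real: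
  fixes f :: "'v::euclidean_space \<Rightarrow> real"
  assumes S: "open S" and f: "smooth_on S f" and x: "x \<in> S"
  shows "dir_deriv (\<lambda>y. dir_deriv f y u) x v = dir_deriv (\<lambda>y. dir_deriv f y v) x u"
proof (rule ccontr)
  let ?A = "\<lambda>y. dir_deriv (\<lambda>y. dir_deriv f y u) y v" and ?B = "\<lambda>y. dir_deriv (\<lambda>y. dir_deriv f y v) y u"
  assume ne: "?A x \<noteq> ?B x"
  define e where "e = \<bar>?A x - ?B x\<bar> / 2"
  have e: "e > 0" using ne by (simp add: e_def)
  have cA: "isCont ?A x" "isCont ?B x"
    using smooth_onD(3)[OF smooth_onD(2)[OF smooth_onD(2)[OF f]]] S x continuous_on_eq_continuous_at by blast+
  obtain r1 where r1: "r1 > 0" "ball x r1 \<subseteq> S" using S x openE by blast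
  obtain r2 where r21: "r2 > 0" "\<forall>y. y \<noteq> x \<and> dist y x < r2 \<longrightarrow> dist (?A y) (?A x) < e"
    using metric_LIM_D[OF cA(1)[unfolded isCont_def] e] by blast
  have r2: "r2 > 0" "dist y x < r2 \<Longrightarrow> dist (?A y) (?A x) < e" for y
    using r21 e by (auto, cases "y = x") auto
  obtain r3 where r31: "r3 > 0" "\<forall>y. y \<noteq> x \<and> dist y x < r3 \<longrightarrow> dist (?B y) (?B x) < e"
    using metric_LIM_D[OF cA(2)[unfolded isCont_def] e] by blast
  have r3: "r3 > 0" "dist y x < r3 \<Longrightarrow> dist (?B y) (?B x) < e" for y
    using r31 e by (auto, cases "y = x") auto
  define r where "r = min r1 (min r2 r3)"
  \<comment> \<open>A parallelogram with edges \<open>d u\<close> and \<open>d v\<close> stays in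
    the ball where both mixed derivatives differ by less than \<open>e\<close> from their values at
    \<open>x\<close>; the summand 1 covers \<open>u = v = 0\<close>.\<close>
  define d where "d = r / (2 * (norm u + norm v + 1))"
  have r: "r > 0" using r1 r2 r3 by (simp add: r_def)
  have nn: "norm u + norm v + 1 > 0" by (simp add: add_nonneg_pos)
  have d: "d > 0" unfolding d_def using r nn by simp
  have near: "dist (x + s *\<^sub>R u + t *\<^sub>R v) x < r" if "0 \<le> s" "s \<le> d" "0 \<le> t" "t \<le> d" for s t
  proof -
    have "norm (s *\<^sub>R u + t *\<^sub>R v) \<le> s * norm u + t * norm v"
      using norm_triangle_ineq[of "s *\<^sub>R u" "t *\<^sub>R v"] that by simp
    also have "\<dots> \<le> d * norm u + d * norm v" using that by (intro add_mono mult_right_mono) auto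
    also have "\<dots> \<le> d * (norm u + norm v + 1)" using d by (simp add: algebra_simps)
    also have "\<dots> = r / 2"
    proof -
      have "r / (2 * n) * n = r / 2" if "n > 0" for n using that by simp
      from this[OF nn] show ?thesis unfolding d_def .
    qed
    also have "\<dots> < r" using r by simp
    finally show ?thesis by (simp add: dist_norm add.assoc)
  qed
  have sub: "x + s *\<^sub>R u + t *\<^sub>R v \<in> S" "x + s *\<^sub>R v + t *\<^sub>R u \<in> S" if "0 \<le> s" "s \<le> d" "0 \<le> t" "t \<le> d" for s t
    using near[OF that] near[OF that(3,4,1,2)] r1(2) unfolding r_def
    by (auto simp: mem_ball dist_commute algebra_simps)
  obtain s t where st: "0 < s" "s < d" "0 < t" "t < d"
    "f (x + d *\<^sub>R u + d *\<^sub>R v) - f (x + d *\<^sub>R u) - f (x + d *\<^sub>R v) + f x = d * d * ?A (x + s *\<^sub>R u + t *\<^sub>R v)"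
    using second_difference_mvt[OF f d sub(1)] by blast
  obtain s' t' where st': "0 < s'" "s' < d" "0 < t'" "t' < d"
    "f (x + d *\<^sub>R v + d *\<^sub>R u) - f (x + d *\<^sub>R v) - f (x + d *\<^sub>R u) + f x = d * d * ?B (x + s' *\<^sub>R v + t' *\<^sub>R u)"
    using second_difference_mvt[OF f d sub(2)] by blast
  have "d * d * ?A (x + s *\<^sub>R u + t *\<^sub>R v) = d * d * ?B (x + s' *\<^sub>R v + t' *\<^sub>R u)"
    using st(5) st'(5) by (simp add: algebra_simps)
  then have eq: "?A (x + s *\<^sub>R u + t *\<^sub>R v) = ?B (x + s' *\<^sub>R v + t' *\<^sub>R u)" using d by simp
  have "dist (x + s *\<^sub>R u + t *\<^sub>R v) x < r2" "dist (x + s' *\<^sub>R v + t' *\<^sub>R u) x < r3"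
    using near[of s t] near[of t' s'] st st' by (auto simp: r_def algebra_simps)
  from r2(2)[OF this(1)] r3(2)[OF this(2)]
  have "\<bar>?B (x + s' *\<^sub>R v + t' *\<^sub>R u) - ?A x\<bar> < e" "\<bar>?B (x + s' *\<^sub>R v + t' *\<^sub>R u) - ?B x\<bar> < e"
    by (simp_all add: dist_real_def eq)
  moreover have "\<bar>a - b\<bar> \<le> \<bar>c - a\<bar> + \<bar>c - b\<bar>" for a b c :: real by arith
  ultimately have "\<bar>?A x - ?B x\<bar> < e + e" by (meson add_strict_mono order.strict_trans1)
  then show False by (simp add: e_def)
qed

lemma dir_deriv_commute:
  fixes f :: "'v::euclidean_space \<Rightarrow> complex"
  assumes S: "open S" and f: "smooth_on S f" and x: "x \<in> S"
  shows "dir_deriv (\<lambda>y. dir_deriv f y u) x v = dir_deriv (\<lambda>y. dir_deriv f y v) x u"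
proof -
  have L: "L (dir_deriv (\<lambda>y. dir_deriv f y u) x v) = dir_deriv (\<lambda>y. dir_deriv (\<lambda>y. L (f y)) y u) x v"
    if L: "bounded_linear L" for L :: "complex \<Rightarrow> real" and u v
  proof -
    have 1: "dir_deriv (\<lambda>y. L (f y)) y u = L (dir_deriv f y u)" if "y \<in> S" for y
      by (rule dir_deriv_eqI[OF bounded_linear.has_derivative[OF L has_derivative_dir_deriv[OF smooth_onD(1)[OF f that]]]])
    have "dir_deriv (\<lambda>y. dir_deriv (\<lambda>y. L (f y)) y u) x v = dir_deriv (\<lambda>y. L (dir_deriv f y u)) x v"
      by (rule dir_deriv_cong(1)[OF S x 1])
    also have "\<dots> = L (dir_deriv (\<lambda>y. dir_deriv f y u) x v)"
      by (rule dir_deriv_eqI[OF bounded_linear.has_derivative[OF L has_derivative_dir_deriv[OF smooth_onD(1)[OF smooth_onD(2)[OF f] x]]]])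
    finally show ?thesis by simp
  qed
  have "L (dir_deriv (\<lambda>y. dir_deriv f y u) x v) = L (dir_deriv (\<lambda>y. dir_deriv f y v) x u)"
    if "bounded_linear L" for L :: "complex \<Rightarrow> real"
    unfolding L[OF that] by (rule dir_deriv_commute_real[OF S smooth_on_bounded_linear[OF S that f] x])
  from this[OF bounded_linear_Re] this[OF bounded_linear_Im] show ?thesis by (rule complex_eqI)
qed

section \<open>Wirtinger derivatives in several variables\<close>

text \<open>The part of the real derivative that is complex linear in \<open>u\<close>;
  \<open>dzb\<close> is the antilinear part.\<close>

definition dz :: "(complex ^ 'k::finite \<Rightarrow> complex) \<Rightarrow> complex ^ 'k \<Rightarrow> complex ^ 'k \<Rightarrow> complex" where
  "dz f x u = (dir_deriv f x u - \<i> * dir_deriv f x (J u)) / 2"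

definition dzb :: "(complex ^ 'k::finite \<Rightarrow> complex) \<Rightarrow> complex ^ 'k \<Rightarrow> complex ^ 'k \<Rightarrow> complex" where
  "dzb f x u = (dir_deriv f x u + \<i> * dir_deriv f x (J u)) / 2"

lemma dir_deriv_eq_dz_dzb: "dir_deriv f x u = dz f x u + dzb f x u"
  by (simp add: dz_def dzb_def field_simps)

lemma scale_eq_real_combination: "d *s v = Re d *\<^sub>R v + Im d *\<^sub>R (J v)" for v :: "complex ^ 'k"
  by (auto simp: vec_eq_iff complex_eq_iff)

lemma dir_deriv_scale:
  fixes f :: "complex ^ 'k::finite \<Rightarrow> complex"
  assumes "f differentiable (at x)"
  shows "dir_deriv f x (d *s v) = dz f x v * d + dzb f x v * cnj d"
proof -
  have lin: "linear (dir_deriv f x)" by (rule linear_frechet_derivative[OF assms])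
  have "dir_deriv f x (d *s v) = of_real (Re d) * dir_deriv f x v + of_real (Im d) * dir_deriv f x (J v)"
    unfolding scale_eq_real_combination[of d v] by (simp add: linear_add[OF lin] linear_scale[OF lin] scaleR_conv_of_real[where 'a = complex])
  then show ?thesis by (simp add: dz_def dzb_def complex_eq_iff field_simps)
qed

text \<open>Along a curve with complex linear derivative the operators of several variables become
  those of one variable. Restriction to lines, together with \<open>wirtinger_lineD\<close>, imports
  the sum, product and conjugation rules from there.\<close>

lemma wirtinger_compose:
  fixes f :: "complex ^ 'k::finite \<Rightarrow> complex"
  assumes "f differentiable (at (\<gamma> t))" "(\<gamma> has_derivative (\<lambda>d. d *s v)) (at t)"
  shows "wirtinger (\<lambda>t. f (\<gamma> t)) (dz f (\<gamma> t) v) (dzb f (\<gamma> t) v) t"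
  using has_derivative_compose[OF assms(2) has_derivative_dir_deriv[OF assms(1)]]
  unfolding wirtinger_def dir_deriv_scale[OF assms(1)] .

lemma bounded_linear_scale_vec: "bounded_linear (\<lambda>d. d *s v)" for v :: "complex ^ 'k::finite"
proof -
  have "linear (\<lambda>d::complex. d *s v)"
    by (rule linearI) (auto simp: vec_eq_iff algebra_simps)
  then show ?thesis by (simp add: linear_conv_bounded_linear)
qed

lemma has_derivative_line: "((\<lambda>t. x + t *s v) has_derivative (\<lambda>d. d *s v)) (at t)" for x v :: "complex ^ 'k::finite"
  using has_derivative_add[OF has_derivative_const bounded_linear.has_derivative[OF bounded_linear_scale_vec has_derivative_ident]]
  by simp

lemma wirtinger_line:
  fixes f :: "complex ^ 'k::finite \<Rightarrow> complex"
  assumes "f differentiable (at x)"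
  shows "wirtinger (\<lambda>t. f (x + t *s v)) (dz f x v) (dzb f x v) 0"
  using wirtinger_compose[of f "\<lambda>t. x + t *s v" 0 v, OF _ has_derivative_line] assms by simp

lemma wirtinger_lineD:
  fixes f :: "complex ^ 'k::finite \<Rightarrow> complex"
  assumes "f differentiable (at x)" "wirtinger (\<lambda>t. f (x + t *s v)) a b 0"
  shows "dz f x v = a" "dzb f x v = b"
  using wirtinger_unique[OF wirtinger_line[OF assms(1)] assms(2)] by auto

lemma dz_cong:
  assumes "open S" "x \<in> S" "\<And>y. y \<in> S \<Longrightarrow> f y = g y"
  shows "dz f x u = dz g x u" "dzb f x u = dzb g x u"
  unfolding dz_def dzb_def by (simp_all add: dir_deriv_cong(1)[OF assms])

lemma dz_linear:
  fixes f :: "complex ^ 'k::finite \<Rightarrow> complex"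
  assumes "f differentiable (at x)"
  shows "dz f x (u + v) = dz f x u + dz f x v" "dz f x (d *s u) = d * dz f x u"
    "dzb f x (u + v) = dzb f x u + dzb f x v" "dzb f x (d *s u) = cnj d * dzb f x u"
proof -
  have lin: "linear (dir_deriv f x)" by (rule linear_frechet_derivative[OF assms])
  have Ja: "J (u + v) = J u + J v" for u v :: "complex ^ 'k" by (simp add: vec_eq_iff algebra_simps)
  show "dz f x (u + v) = dz f x u + dz f x v" "dzb f x (u + v) = dzb f x u + dzb f x v"
    by (simp_all add: dz_def dzb_def Ja linear_add[OF lin] algebra_simps add_divide_distrib diff_divide_distrib)
  have JJ: "J (d *s u) = (\<i> * d) *s u" by (simp add: vec_eq_iff)
  show "dz f x (d *s u) = d * dz f x u" "dzb f x (d *s u) = cnj d * dzb f x u"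
    unfolding dz_def[of f x "d *s u"] dzb_def[of f x "d *s u"] JJ dir_deriv_scale[OF assms]
    by (simp_all add: algebra_simps)
qed

lemma dz_sum_axis:
  fixes f :: "complex ^ 'k::finite \<Rightarrow> complex"
  assumes "f differentiable (at x)"
  shows "dz f x u = (\<Sum>i\<in>UNIV. u $ i * dz f x (axis i 1))"
    "dzb f x u = (\<Sum>i\<in>UNIV. cnj (u $ i) * dzb f x (axis i 1))"
proof -
  have 0: "dz f x 0 = 0" "dzb f x 0 = 0"
    using dz_linear(2,4)[OF assms, of 0 0] by simp_all
  have "dz f x (\<Sum>i\<in>I. u $ i *s axis i 1) = (\<Sum>i\<in>I. u $ i * dz f x (axis i 1))" for I
    by (induction I rule: infinite_finite_induct) (simp_all add: 0 dz_linear[OF assms])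
  from this[of UNIV] show "dz f x u = (\<Sum>i\<in>UNIV. u $ i * dz f x (axis i 1))" by (simp only: basis_expansion)
  have "dzb f x (\<Sum>i\<in>I. u $ i *s axis i 1) = (\<Sum>i\<in>I. cnj (u $ i) * dzb f x (axis i 1))" for I
    by (induction I rule: infinite_finite_induct) (simp_all add: 0 dz_linear[OF assms])
  from this[of UNIV] show "dzb f x u = (\<Sum>i\<in>UNIV. cnj (u $ i) * dzb f x (axis i 1))" by (simp only: basis_expansion)
qed

lemma smooth_on_dz:
  fixes f :: "complex ^ 'k::finite \<Rightarrow> complex"
  assumes "open S" "smooth_on S f"
  shows "smooth_on S (\<lambda>x. dz f x u)" "smooth_on S (\<lambda>x. dzb f x u)"
proof -
  have "smooth_on S (\<lambda>x. 1/2 * (dir_deriv f x u + (- \<i>) * dir_deriv f x (J u)))"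
    "smooth_on S (\<lambda>x. 1/2 * (dir_deriv f x u + \<i> * dir_deriv f x (J u)))"
    by (intro smooth_on_mult smooth_on_add smooth_on_const smooth_onD(2)[OF assms(2)] assms(1))+
  then show "smooth_on S (\<lambda>x. dz f x u)" "smooth_on S (\<lambda>x. dzb f x u)"
    by (simp_all add: dz_def[abs_def] dzb_def[abs_def])
qed

text \<open>Symmetry of the real second derivative, sorted by type.\<close>

lemma dz_commute:
  fixes f :: "complex ^ 'k::finite \<Rightarrow> complex"
  assumes S: "open S" and f: "smooth_on S f" and x: "x \<in> S"
  shows "dz (\<lambda>y. dz f y u) x v = dz (\<lambda>y. dz f y v) x u"
    "dzb (\<lambda>y. dz f y u) x v = dz (\<lambda>y. dzb f y v) x u"
proof -
  define D where "D u v = dir_deriv (\<lambda>y. dir_deriv f y u) x v" for u v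
  have D: "D u v = D v u" for u v unfolding D_def by (rule dir_deriv_commute[OF S f x])
  have diff: "((\<lambda>y. dir_deriv f y u) has_derivative D u) (at x)" for u
    unfolding D_def by (rule has_derivative_dir_deriv[OF smooth_onD(1)[OF smooth_onD(2)[OF f] x]])
  have 1: "dir_deriv (\<lambda>y. dz f y u) x v = (D u v - \<i> * D (J u) v) / 2" for u v
    by (rule dir_deriv_eqI[where D = "\<lambda>v. (D u v - \<i> * D (J u) v) / 2"])
      (unfold dz_def[abs_def], auto intro!: derivative_eq_intros diff)
  have 2: "dir_deriv (\<lambda>y. dzb f y u) x v = (D u v + \<i> * D (J u) v) / 2" for u v
    by (rule dir_deriv_eqI[where D = "\<lambda>v. (D u v + \<i> * D (J u) v) / 2"])
      (unfold dzb_def[abs_def], auto intro!: derivative_eq_intros diff)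
  have zz: "dz (\<lambda>y. dz f y u) x v = ((D u v - \<i> * D (J u) v) / 2 - \<i> * ((D u (J v) - \<i> * D (J u) (J v)) / 2)) / 2" for u v
    unfolding dz_def[of "\<lambda>y. dz f y u" x v] 1 ..
  have bz: "dzb (\<lambda>y. dz f y u) x v = ((D u v - \<i> * D (J u) v) / 2 + \<i> * ((D u (J v) - \<i> * D (J u) (J v)) / 2)) / 2" for u v
    unfolding dzb_def[of "\<lambda>y. dz f y u" x v] 1 ..
  have zb: "dz (\<lambda>y. dzb f y v) x u = ((D v u + \<i> * D (J v) u) / 2 - \<i> * ((D v (J u) + \<i> * D (J v) (J u)) / 2)) / 2" for u v
    unfolding dz_def[of "\<lambda>y. dzb f y v" x u] 2 ..
  show "dz (\<lambda>y. dz f y u) x v = dz (\<lambda>y. dz f y v) x u" "dzb (\<lambda>y. dz f y u) x v = dz (\<lambda>y. dzb f y v) x u"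
    unfolding zz bz zb D[of v u] D[of v "J u"] D[of "J v" u] D[of "J v" "J u"] by (simp_all add: field_simps)
qed

lemma dz_cnj:
  fixes f :: "complex ^ 'k::finite \<Rightarrow> complex"
  assumes "f differentiable (at x)"
  shows "dz (\<lambda>y. cnj (f y)) x u = cnj (dzb f x u)" "dzb (\<lambda>y. cnj (f y)) x u = cnj (dz f x u)"
proof -
  have "(\<lambda>y. cnj (f y)) differentiable (at x)"
    using bounded_linear.has_derivative[OF bounded_linear_cnj has_derivative_dir_deriv[OF assms]]
    by (auto simp: differentiable_def)
  from wirtinger_lineD[OF this wirtinger_cnj[OF wirtinger_line[OF assms]]]
  show "dz (\<lambda>y. cnj (f y)) x u = cnj (dzb f x u)" "dzb (\<lambda>y. cnj (f y)) x u = cnj (dz f x u)" .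
qed

section \<open>Indefinite Kaehler metrics in coordinates\<close>

lemma J_J: "J (J v) = - v" for v :: "complex ^ 'k"
  by (simp add: vec_eq_iff)

lemma dz_sum:
  fixes f :: "'i \<Rightarrow> complex ^ 'k::finite \<Rightarrow> complex"
  assumes S: "open S" "x \<in> S" and f: "\<And>i. i \<in> I \<Longrightarrow> f i differentiable (at x)" and "F differentiable (at x)"
    and F: "\<And>y. y \<in> S \<Longrightarrow> F y = (\<Sum>i\<in>I. c i * f i y)"
  shows "dz F x u = (\<Sum>i\<in>I. c i * dz (f i) x u)"
    "dzb F x u = (\<Sum>i\<in>I. c i * dzb (f i) x u)"
proof -
  have w: "wirtinger (\<lambda>t. \<Sum>i\<in>I. c i * f i (x + t *s u)) (\<Sum>i\<in>I. c i * dz (f i) x u) (\<Sum>i\<in>I. c i * dzb (f i) x u) 0"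
    by (intro wirtinger_sum wirtinger_cmult wirtinger_line f)
  have op: "open ((\<lambda>t. x + t *s u) -` S)"
    using has_derivative_continuous[OF has_derivative_line[of x u]] S(1)
    by (intro open_vimage) (auto simp: continuous_at_imp_continuous_on)
  have "wirtinger (\<lambda>t. F (x + t *s u)) (\<Sum>i\<in>I. c i * dz (f i) x u) (\<Sum>i\<in>I. c i * dzb (f i) x u) 0"
    by (rule wirtinger_cong[OF w op]) (use S F in auto)
  from wirtinger_lineD[OF assms(4) this]
  show "dz F x u = (\<Sum>i\<in>I. c i * dz (f i) x u)" "dzb F x u = (\<Sum>i\<in>I. c i * dzb (f i) x u)" .
qed

lemma dz_sum_mult:
  fixes f g :: "'i \<Rightarrow> complex ^ 'k::finite \<Rightarrow> complex"
  assumes S: "open S" "x \<in> S" and f: "\<And>i. i \<in> I \<Longrightarrow> f i differentiable (at x)" 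
    and g: "\<And>i. i \<in> I \<Longrightarrow> g i differentiable (at x)" and "F differentiable (at x)"
    and F: "\<And>y. y \<in> S \<Longrightarrow> F y = (\<Sum>i\<in>I. f i y * g i y)"
  shows "dz F x u = (\<Sum>i\<in>I. dz (f i) x u * g i x + f i x * dz (g i) x u)"
    "dzb F x u = (\<Sum>i\<in>I. dzb (f i) x u * g i x + f i x * dzb (g i) x u)"
proof -
  have w: "wirtinger (\<lambda>t. \<Sum>i\<in>I. f i (x + t *s u) * g i (x + t *s u))
      (\<Sum>i\<in>I. dz (f i) x u * g i x + f i x * dz (g i) x u) (\<Sum>i\<in>I. dzb (f i) x u * g i x + f i x * dzb (g i) x u) 0"
  proof (rule wirtinger_sum)
    fix i assume i: "i \<in> I"
    from wirtinger_mult[OF wirtinger_line[OF f[OF i], of u] wirtinger_line[OF g[OF i], of u]]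
    show "wirtinger (\<lambda>t. f i (x + t *s u) * g i (x + t *s u))
      (dz (f i) x u * g i x + f i x * dz (g i) x u) (dzb (f i) x u * g i x + f i x * dzb (g i) x u) 0" by simp
  qed
  have op: "open ((\<lambda>t. x + t *s u) -` S)"
    using has_derivative_continuous[OF has_derivative_line[of x u]] S(1)
    by (intro open_vimage) (auto simp: continuous_at_imp_continuous_on)
  have "wirtinger (\<lambda>t. F (x + t *s u)) (\<Sum>i\<in>I. dz (f i) x u * g i x + f i x * dz (g i) x u)
      (\<Sum>i\<in>I. dzb (f i) x u * g i x + f i x * dzb (g i) x u) 0"
    by (rule wirtinger_cong[OF w op]) (use S F in auto)
  from wirtinger_lineD[OF assms(5) this]
  show "dz F x u = (\<Sum>i\<in>I. dz (f i) x u * g i x + f i x * dz (g i) x u)"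
    "dzb F x u = (\<Sum>i\<in>I. dzb (f i) x u * g i x + f i x * dzb (g i) x u)" .
qed

lemma has_derivative_vec_lambda:
  fixes f :: "'k::finite \<Rightarrow> 'v::euclidean_space \<Rightarrow> complex"
  assumes "\<And>k. (f k has_derivative D k) (at x)"
  shows "((\<lambda>y. \<chi> k. f k y) has_derivative (\<lambda>u. \<chi> k. D k u)) (at x)"
proof -
  have "((\<lambda>y. \<Sum>k\<in>UNIV. f k y *s axis k 1) has_derivative (\<lambda>u. \<Sum>k\<in>UNIV. D k u *s axis k 1)) (at x)"
    by (intro has_derivative_sum bounded_linear.has_derivative[OF bounded_linear_scale_vec] assms)
  moreover have "(\<Sum>k\<in>UNIV. c k *s axis k 1) = (\<chi> k. c k)" for c :: "'k \<Rightarrow> complex"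
    using basis_expansion[of "\<chi> k. c k"] by simp
  ultimately show ?thesis by simp
qed

text \<open>A chart image or an open part of one. The signature is left open, so the locale serves
  the ambient space and the submanifold alike.\<close>

locale kaehler_domain =
  fixes U :: "(complex ^ 'k::finite) set" and G :: "complex ^ 'k \<Rightarrow> complex ^ 'k \<Rightarrow> complex ^ 'k \<Rightarrow> real"
  assumes open_U: "open U" and kaehler: "kaehler_on U G"
begin

text \<open>The Hermitian form whose real part is \<open>G\<close>, complex linear in the first argument.\<close>

definition h :: "complex ^ 'k \<Rightarrow> complex ^ 'k \<Rightarrow> complex ^ 'k \<Rightarrow> complex" where
  "h x u v = Complex (G x u v) (G x u (J v))"

lemma G_linear: "x \<in> U \<Longrightarrow> linear (G x u)" "x \<in> U \<Longrightarrow> linear (\<lambda>u. G x u v)"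
  using kaehler unfolding kaehler_on_def pseudo_riemannian_on_def bilinear_def by blast+

lemma G_sym: "x \<in> U \<Longrightarrow> G x u v = G x v u"
  using kaehler unfolding kaehler_on_def pseudo_riemannian_on_def by blast

lemma G_nondegenerate: "x \<in> U \<Longrightarrow> (\<And>v. G x u v = 0) \<Longrightarrow> u = 0"
  using kaehler unfolding kaehler_on_def pseudo_riemannian_on_def by blast

lemma G_smooth: "smooth_on U (\<lambda>x. G x u v)"
  using kaehler unfolding kaehler_on_def pseudo_riemannian_on_def by blast

lemma G_J: "x \<in> U \<Longrightarrow> G x (J u) (J v) = G x u v"
  using kaehler unfolding kaehler_on_def by blast

lemma G_J_skew: assumes "x \<in> U" shows "G x (J u) v = - G x u (J v)"
  using G_J[OF assms, of "J u" v] linear_neg[OF G_linear(2)[OF assms]] by (simp add: J_J)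

lemma closed:
  "x \<in> U \<Longrightarrow> dir_deriv (\<lambda>y. G y (J v) w) x u + dir_deriv (\<lambda>y. G y (J w) u) x v
     + dir_deriv (\<lambda>y. G y (J u) v) x w = 0"
  using kaehler unfolding kaehler_on_def by blast

lemma h_cnj: assumes "x \<in> U" shows "cnj (h x u v) = h x v u"
  using G_sym[OF assms, of u v] G_J_skew[OF assms, of u v] G_sym[OF assms, of v "J u"]
  by (simp add: h_def complex_eq_iff)

lemma h_add_left: "x \<in> U \<Longrightarrow> h x (u + v) w = h x u w + h x v w"
  using linear_add[OF G_linear(2)] by (simp add: h_def complex_eq_iff)

lemma h_scale_left: assumes "x \<in> U" shows "h x (d *s u) w = d * h x u w"
proof -
  have "G x (d *s u) z = Re d * G x u z + Im d * G x (J u) z" for z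
    unfolding scale_eq_real_combination[of d u]
    using linear_add[OF G_linear(2)[OF assms]] linear_scale[OF G_linear(2)[OF assms]] by simp
  then show ?thesis
    using G_J_skew[OF assms, of u w] G_J[OF assms, of u w] by (simp add: h_def complex_eq_iff)
qed

lemma h_add_right: assumes "x \<in> U" shows "h x w (u + v) = h x w u + h x w v"
proof -
  have "cnj (h x (u + v) w) = cnj (h x u w) + cnj (h x v w)" using h_add_left[OF assms] by simp
  then show ?thesis by (simp only: h_cnj[OF assms])
qed

lemma h_scale_right: assumes "x \<in> U" shows "h x w (d *s u) = cnj d * h x w u"
proof -
  have "cnj (h x (d *s u) w) = cnj d * cnj (h x u w)" using h_scale_left[OF assms] by simp
  then show ?thesis by (simp only: h_cnj[OF assms])
qed

lemma h_zero: assumes "x \<in> U" shows "h x 0 v = 0" "h x v 0 = 0"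
  using h_scale_left[OF assms, of 0 0 v] h_scale_right[OF assms, of v 0 0] by simp_all

lemma h_diff_left: "x \<in> U \<Longrightarrow> h x (u - v) w = h x u w - h x v w"
  using h_add_left[of x "u - v" v w] by simp

lemma h_expand_left: assumes "x \<in> U" shows "h x u v = (\<Sum>i\<in>UNIV. u $ i * h x (axis i 1) v)"
proof -
  have "h x (\<Sum>i\<in>I. u $ i *s axis i 1) v = (\<Sum>i\<in>I. u $ i * h x (axis i 1) v)" for I
    by (induction I rule: infinite_finite_induct) (simp_all add: h_zero h_add_left h_scale_left assms)
  from this[of UNIV] show ?thesis by (simp only: basis_expansion)
qed

lemma h_expand_right: assumes "x \<in> U" shows "h x u v = (\<Sum>i\<in>UNIV. cnj (v $ i) * h x u (axis i 1))"
proof -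
  have "h x u (\<Sum>i\<in>I. v $ i *s axis i 1) = (\<Sum>i\<in>I. cnj (v $ i) * h x u (axis i 1))" for I
    by (induction I rule: infinite_finite_induct) (simp_all add: h_zero h_add_right h_scale_right assms)
  from this[of UNIV] show ?thesis by (simp only: basis_expansion)
qed

lemma h_nondegenerate: assumes "x \<in> U" "\<And>v. h x u v = 0" shows "u = 0"
  by (rule G_nondegenerate[OF assms(1)]) (use assms(2) in \<open>simp add: h_def complex_eq_iff\<close>)

lemma h_eqI: assumes "x \<in> U" "\<And>z. h x u z = h x v z" shows "u = v"
  using h_nondegenerate[OF assms(1), of "u - v"] assms by (simp add: h_diff_left)

lemma h_smooth: "smooth_on U (\<lambda>x. h x u v)"
proof -
  have "smooth_on U (\<lambda>x. of_real (G x u v) + \<i> * of_real (G x u (J v)))"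
    by (intro smooth_on_add smooth_on_mult smooth_on_const smooth_on_bounded_linear[OF _ bounded_linear_of_real] G_smooth open_U)
  then show ?thesis by (simp add: h_def Complex_eq)
qed

lemma h_diff: "x \<in> U \<Longrightarrow> (\<lambda>x. h x u v) differentiable (at x)"
  by (rule smooth_onD(1)[OF h_smooth])

lemma dir_deriv_h: assumes "x \<in> U"
  shows "dir_deriv (\<lambda>y. h y a b) x u = Complex (dir_deriv (\<lambda>y. G y a b) x u) (dir_deriv (\<lambda>y. G y a (J b)) x u)"
proof (rule dir_deriv_eqI)
  have 1: "((\<lambda>y. of_real (G y a b) + \<i> * of_real (G y a (J b))) has_derivative
     (\<lambda>u. of_real (dir_deriv (\<lambda>y. G y a b) x u) + \<i> * of_real (dir_deriv (\<lambda>y. G y a (J b)) x u))) (at x)"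
    by (intro has_derivative_add has_derivative_mult_right has_derivative_of_real has_derivative_dir_deriv
        smooth_onD(1)[OF G_smooth assms])
  then show "((\<lambda>y. h y a b) has_derivative (\<lambda>u. Complex (dir_deriv (\<lambda>y. G y a b) x u) (dir_deriv (\<lambda>y. G y a (J b)) x u))) (at x)"
    by (simp add: h_def Complex_eq)
qed

definition gram :: "complex ^ 'k \<Rightarrow> complex ^ 'k ^ 'k" where
  "gram x = (\<chi> i j. h x (axis j 1) (axis i 1))"

lemma gram_mult: "x \<in> U \<Longrightarrow> (gram x *v u) $ i = h x u (axis i 1)"
  by (simp add: gram_def matrix_vector_mult_def h_expand_left[of x u] mult.commute)

lemma det_gram: assumes "x \<in> U" shows "det (gram x) \<noteq> 0"
proof -
  have "u = 0" if "gram x *v u = 0" for u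
  proof (rule h_nondegenerate[OF assms])
    have "h x u (axis i 1) = 0" for i using gram_mult[OF assms, of u i] that by simp
    then show "h x u v = 0" for v using h_expand_right[OF assms, of u v] by simp
  qed
  then have "\<exists>B. B ** gram x = mat 1" unfolding matrix_left_invertible_ker by blast
  then have "invertible (gram x)" by (simp add: invertible_left_inverse)
  then show ?thesis by (simp add: invertible_det_nz)
qed

text \<open>The Christoffel symbols, solved for by Cramer's rule; see \<open>h_gam\<close> and \<open>christoffel_eq_gam\<close>.\<close>

definition gam :: "complex ^ 'k \<Rightarrow> complex ^ 'k \<Rightarrow> complex ^ 'k \<Rightarrow> complex ^ 'k" where
  "gam x v a = (\<chi> k. det (\<chi> i j. if j = k then dz (\<lambda>x. h x a (axis i 1)) x v else gram x $ i $ j) / det (gram x))"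

lemma gam_smooth: "smooth_on U (\<lambda>x. gam x v a $ k)"
proof -
  have "smooth_on U (\<lambda>x. det (\<chi> i j. if j = k then dz (\<lambda>x. h x a (axis i 1)) x v else gram x $ i $ j) / det (gram x))"
  proof (rule smooth_on_divide[OF open_U smooth_on_det[OF open_U] smooth_on_det[OF open_U] det_gram])
    show "smooth_on U (\<lambda>x. (\<chi> i j. if j = k then dz (\<lambda>x. h x a (axis i 1)) x v else gram x $ i $ j) $ i $ j)" for i j
      using h_smooth smooth_on_dz(1)[OF open_U h_smooth] by (cases "j = k") (simp_all add: gram_def)
    show "smooth_on U (\<lambda>x. gram x $ i $ j)" for i j using h_smooth by (simp add: gram_def)
  qed
  then show ?thesis by (simp add: gam_def)
qed

lemma h_gam: assumes "x \<in> U" shows "h x (gam x v a) b = dz (\<lambda>y. h y a b) x v"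
proof -
  have "gram x *v gam x v a = (\<chi> i. dz (\<lambda>x. h x a (axis i 1)) x v)"
    unfolding cramer[OF det_gram[OF assms]] gam_def by (simp cong: if_cong)
  then have 1: "h x (gam x v a) (axis i 1) = dz (\<lambda>x. h x a (axis i 1)) x v" for i
    unfolding gram_mult[OF assms, symmetric] by simp
  have "dz (\<lambda>y. h y a b) x v = (\<Sum>i\<in>UNIV. cnj (b $ i) * dz (\<lambda>y. h y a (axis i 1)) x v)"
    by (rule dz_sum(1)[OF open_U assms h_diff[OF assms] h_diff[OF assms] h_expand_right])
  then show ?thesis using h_expand_right[OF assms, of "gam x v a" b] 1 by simp
qed

lemma dz_h: "x \<in> U \<Longrightarrow> dz (\<lambda>y. h y a b) x v = h x (gam x v a) b"
  by (simp add: h_gam)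

lemma dzb_h: assumes "x \<in> U" shows "dzb (\<lambda>y. h y a b) x v = h x a (gam x v b)"
proof -
  have "dzb (\<lambda>y. h y a b) x v = dzb (\<lambda>y. cnj (h y b a)) x v"
    by (rule dz_cong(2)[OF open_U assms]) (simp add: h_cnj)
  also have "\<dots> = cnj (h x (gam x v b) a)" by (simp add: dz_cnj h_diff assms dz_h)
  finally show ?thesis by (simp add: h_cnj assms)
qed

text \<open>For a Kaehler metric the Chern connection \<open>gam\<close>, fixed by
  \<open>h_gam\<close>, is the Levi-Civita connection. Twice the real part of \<open>dz\<close> has
  two terms; closedness applied to \<open>a\<close>, \<open>z\<close> and \<open>J v\<close> turns
  the second one into the two missing Koszul terms.\<close>

lemma koszul: assumes "x \<in> U"
  shows "2 * G x (gam x v a) z = dir_deriv (\<lambda>y. G y a z) x v + dir_deriv (\<lambda>y. G y v z) x a - dir_deriv (\<lambda>y. G y v a) x z"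
proof -
  have "2 * G x (gam x v a) z = 2 * Re (dz (\<lambda>y. h y a z) x v)"
    using h_gam[OF assms, of v a z] by (simp add: h_def complex_eq_iff)
  also have "\<dots> = dir_deriv (\<lambda>y. G y a z) x v + dir_deriv (\<lambda>y. G y a (J z)) x (J v)"
    by (simp add: dz_def dir_deriv_h[OF assms])
  also have "dir_deriv (\<lambda>y. G y a (J z)) x (J v) = dir_deriv (\<lambda>y. G y v z) x a - dir_deriv (\<lambda>y. G y v a) x z"
  proof -
    have neg: "dir_deriv (\<lambda>y. G y (- p) q) x w = - dir_deriv (\<lambda>y. G y p q) x w" for p q w
    proof -
      have "dir_deriv (\<lambda>y. G y (- p) q) x w = dir_deriv (\<lambda>y. - G y p q) x w"
        by (rule dir_deriv_cong(1)[OF open_U assms]) (rule linear_neg[OF G_linear(2)])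
      also have "\<dots> = - dir_deriv (\<lambda>y. G y p q) x w"
        by (rule dir_deriv_eqI[OF has_derivative_minus[OF has_derivative_dir_deriv[OF smooth_onD(1)[OF G_smooth assms]]]])
      finally show ?thesis .
    qed
    have "dir_deriv (\<lambda>y. G y (J a) z) x (J v) = dir_deriv (\<lambda>y. - G y a (J z)) x (J v)"
      by (rule dir_deriv_cong(1)[OF open_U assms]) (rule G_J_skew)
    also have "\<dots> = - dir_deriv (\<lambda>y. G y a (J z)) x (J v)"
      by (rule dir_deriv_eqI[OF has_derivative_minus[OF has_derivative_dir_deriv[OF smooth_onD(1)[OF G_smooth assms]]]])
    finally have 1: "dir_deriv (\<lambda>y. G y (J a) z) x (J v) = - dir_deriv (\<lambda>y. G y a (J z)) x (J v)" .
    have 2: "dir_deriv (\<lambda>y. G y (J z) (J v)) x a = dir_deriv (\<lambda>y. G y v z) x a"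
      by (rule dir_deriv_cong(1)[OF open_U assms]) (simp add: G_J G_sym)
    have 3: "dir_deriv (\<lambda>y. G y (J (J v)) a) x z = - dir_deriv (\<lambda>y. G y v a) x z"
      by (simp only: J_J neg)
    show ?thesis using closed[OF assms, of a z "J v"] 1 2 3 by simp
  qed
  finally show ?thesis by simp
qed

lemma christoffel_eq_gam: assumes "x \<in> U" shows "christoffel G x v a = gam x v a"
  unfolding christoffel_def
proof (rule the_equality)
  show "\<forall>z. 2 * G x (gam x v a) z = dir_deriv (\<lambda>y. G y a z) x v + dir_deriv (\<lambda>y. G y v z) x a - dir_deriv (\<lambda>y. G y v a) x z"
    using koszul[OF assms] by blast
  fix w assume w: "\<forall>z. 2 * G x w z = dir_deriv (\<lambda>y. G y a z) x v + dir_deriv (\<lambda>y. G y v z) x a - dir_deriv (\<lambda>y. G y v a) x z"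
  have "G x (w - gam x v a) z = 0" for z
  proof -
    have "G x w z = G x (gam x v a) z" using spec[OF w, of z] koszul[OF assms, of v a z] by simp
    then show ?thesis using linear_diff[OF G_linear(2)[OF assms], of w "gam x v a" z] by simp
  qed
  then show "w = gam x v a" using G_nondegenerate[OF assms, of "w - gam x v a"] by simp
qed

lemma gam_commute: assumes "x \<in> U" shows "gam x v a = gam x a v"
proof -
  have "dir_deriv (\<lambda>y. G y v a) x z = dir_deriv (\<lambda>y. G y a v) x z" for z
    by (rule dir_deriv_cong(1)[OF open_U assms]) (rule G_sym)
  then have "G x (gam x v a - gam x a v) z = 0" for z
    using koszul[OF assms, of v a z] koszul[OF assms, of a v z] linear_diff[OF G_linear(2)[OF assms]] by simp
  then show ?thesis using G_nondegenerate[OF assms, of "gam x v a - gam x a v"] by simp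
qed

lemma gam_linear: assumes "x \<in> U"
  shows "gam x (u + v) a = gam x u a + gam x v a" "gam x (d *s v) a = d *s gam x v a"
    "gam x a (u + v) = gam x a u + gam x a v" "gam x a (d *s v) = d *s gam x a v"
proof -
  show 1: "gam x (u + v) a = gam x u a + gam x v a" for u v a
    by (rule h_eqI[OF assms]) (simp add: h_gam assms h_add_left dz_linear(1)[OF h_diff[OF assms]])
  show 2: "gam x (d *s v) a = d *s gam x v a" for v a
    by (rule h_eqI[OF assms]) (simp add: h_gam assms h_scale_left dz_linear(2)[OF h_diff[OF assms]])
  show "gam x a (u + v) = gam x a u + gam x a v" using 1[of u v a] by (simp only: gam_commute[OF assms, of _ a])
  show "gam x a (d *s v) = d *s gam x a v" using 2[of v a] by (simp only: gam_commute[OF assms, of _ a])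
qed

lemma gam_diff: "x \<in> U \<Longrightarrow> (\<lambda>x. gam x v a $ k) differentiable (at x)"
  by (rule smooth_onD(1)[OF gam_smooth])

text \<open>The antiholomorphic derivative of the connection, complex linear in \<open>v\<close> and
  \<open>w\<close> and antilinear in \<open>u\<close>. By \<open>riemann_eq\<close> it carries the
  whole curvature.\<close>

definition curv :: "complex ^ 'k \<Rightarrow> complex ^ 'k \<Rightarrow> complex ^ 'k \<Rightarrow> complex ^ 'k \<Rightarrow> complex ^ 'k" where
  "curv x v w u = (\<chi> k. dzb (\<lambda>y. gam y v w $ k) x u)"

text \<open>The product rule for \<open>h y (gam y v w) z\<close>. It translates the commutation of
  \<open>dz\<close> and \<open>dzb\<close> derivatives of \<open>h\<close> into symmetries of the
  curvature.\<close>

lemma dz_dz_h: assumes "x \<in> U"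
  shows "dz (\<lambda>y. dz (\<lambda>y. h y w z) y v) x u = h x (\<chi> k. dz (\<lambda>y. gam y v w $ k) x u) z + h x (gam x u (gam x v w)) z"
    "dzb (\<lambda>y. dz (\<lambda>y. h y w z) y v) x u = h x (curv x v w u) z + h x (gam x v w) (gam x u z)"
proof -
  have F: "(\<lambda>y. dz (\<lambda>y. h y w z) y v) differentiable (at x)"
    by (rule smooth_onD(1)[OF smooth_on_dz(1)[OF open_U h_smooth] assms])
  have eq: "dz (\<lambda>y. h y w z) y v = (\<Sum>k\<in>UNIV. gam y v w $ k * h y (axis k 1) z)" if "y \<in> U" for y
    by (subst dz_h[OF that], rule h_expand_left[OF that])
  have "dz (\<lambda>y. dz (\<lambda>y. h y w z) y v) x u =
     (\<Sum>k\<in>UNIV. dz (\<lambda>y. gam y v w $ k) x u * h x (axis k 1) z + gam x v w $ k * dz (\<lambda>y. h y (axis k 1) z) x u)"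
    by (rule dz_sum_mult(1)[OF open_U assms gam_diff[OF assms] h_diff[OF assms] F eq])
  moreover have "dz (\<lambda>y. h y (gam x v w) z) x u = (\<Sum>k\<in>UNIV. gam x v w $ k * dz (\<lambda>y. h y (axis k 1) z) x u)"
    by (rule dz_sum(1)[OF open_U assms h_diff[OF assms] h_diff[OF assms] h_expand_left])
  ultimately show "dz (\<lambda>y. dz (\<lambda>y. h y w z) y v) x u = h x (\<chi> k. dz (\<lambda>y. gam y v w $ k) x u) z + h x (gam x u (gam x v w)) z"
    using h_expand_left[OF assms, of "\<chi> k. dz (\<lambda>y. gam y v w $ k) x u" z] dz_h[OF assms, of "gam x v w" z u]
    by (simp add: sum.distrib)
  have "dzb (\<lambda>y. dz (\<lambda>y. h y w z) y v) x u =
     (\<Sum>k\<in>UNIV. dzb (\<lambda>y. gam y v w $ k) x u * h x (axis k 1) z + gam x v w $ k * dzb (\<lambda>y. h y (axis k 1) z) x u)"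
    by (rule dz_sum_mult(2)[OF open_U assms gam_diff[OF assms] h_diff[OF assms] F eq])
  moreover have "dzb (\<lambda>y. h y (gam x v w) z) x u = (\<Sum>k\<in>UNIV. gam x v w $ k * dzb (\<lambda>y. h y (axis k 1) z) x u)"
    by (rule dz_sum(2)[OF open_U assms h_diff[OF assms] h_diff[OF assms] h_expand_left])
  ultimately show "dzb (\<lambda>y. dz (\<lambda>y. h y w z) y v) x u = h x (curv x v w u) z + h x (gam x v w) (gam x u z)"
    using h_expand_left[OF assms, of "curv x v w u" z] dzb_h[OF assms, of "gam x v w" z u]
    by (simp add: sum.distrib curv_def)
qed

text \<open>Both sides come from the same mixed second derivative of \<open>h\<close>, and the
  quadratic terms in \<open>gam\<close> are conjugate to each other.\<close>

lemma curv_hermitian: assumes "x \<in> U" shows "cnj (h x (curv x v w u) z) = h x (curv x u z v) w"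
proof -
  have "dzb (\<lambda>y. dz (\<lambda>y. h y z w) y u) x v = dz (\<lambda>y. dzb (\<lambda>y. h y z w) y v) x u"
    by (rule dz_commute(2)[OF open_U h_smooth assms])
  also have "\<dots> = dz (\<lambda>y. cnj (dz (\<lambda>y. h y w z) y v)) x u"
  proof (rule dz_cong(1)[OF open_U assms])
    fix y assume y: "y \<in> U"
    have "dzb (\<lambda>y. h y z w) y v = dzb (\<lambda>y. cnj (h y w z)) y v"
      by (rule dz_cong(2)[OF open_U y]) (simp add: h_cnj)
    then show "dzb (\<lambda>y. h y z w) y v = cnj (dz (\<lambda>y. h y w z) y v)" by (simp add: dz_cnj h_diff y)
  qed
  also have "\<dots> = cnj (dzb (\<lambda>y. dz (\<lambda>y. h y w z) y v) x u)"
    by (rule dz_cnj(1)[OF smooth_onD(1)[OF smooth_on_dz(1)[OF open_U h_smooth] assms]])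
  finally show ?thesis
    unfolding dz_dz_h(2)[OF assms] using h_cnj[OF assms, of "gam x v w" "gam x u z"] by simp
qed

lemma curv_commute: assumes "x \<in> U" shows "curv x v w u = curv x w v u"
  unfolding curv_def by (simp add: vec_eq_iff) (intro allI dz_cong(2)[OF open_U assms], simp add: gam_commute)

lemma curv_linear: assumes "x \<in> U"
  shows "curv x v w (p + q) = curv x v w p + curv x v w q" "curv x v w (d *s u) = cnj d *s curv x v w u"
  unfolding curv_def by (simp_all add: vec_eq_iff dz_linear[OF gam_diff[OF assms]])

lemma dir_deriv_gam: assumes "x \<in> U" shows "dir_deriv (\<lambda>y. gam y v w) x u $ k = dir_deriv (\<lambda>y. gam y v w $ k) x u"
proof -
  have "((\<lambda>y. gam y v w $ k) has_derivative (\<lambda>u. dir_deriv (\<lambda>y. gam y v w $ k) x u)) (at x)" for k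
    by (rule has_derivative_dir_deriv[OF gam_diff[OF assms]])
  from has_derivative_vec_lambda[of "\<lambda>k y. gam y v w $ k" "\<lambda>k. dir_deriv (\<lambda>y. gam y v w $ k) x" x, OF this]
  have "((\<lambda>y. gam y v w) has_derivative (\<lambda>u. \<chi> k. dir_deriv (\<lambda>y. gam y v w $ k) x u)) (at x)"
    by simp
  from dir_deriv_eqI[OF this, of u] show ?thesis by simp
qed

text \<open>The \<open>dz\<close> derivatives of \<open>gam\<close> cancel against the quadratic
  terms because \<open>dz\<close> derivatives of \<open>h\<close> commute; only the antiholomorphic
  parts remain.\<close>

lemma riemann_eq: assumes "x \<in> U" shows "riemann G x u v w = curv x v w u - curv x u w v"
proof -
  define Z where "Z v u = (\<chi> k. dz (\<lambda>y. gam y v w $ k) x u)" for u v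
  have d: "dir_deriv (\<lambda>y. christoffel G y v w) x u = Z v u + curv x v w u" for u v
  proof -
    have "dir_deriv (\<lambda>y. christoffel G y v w) x u = dir_deriv (\<lambda>y. gam y v w) x u"
      by (rule dir_deriv_cong(1)[OF open_U assms]) (rule christoffel_eq_gam)
    then show ?thesis by (simp add: vec_eq_iff dir_deriv_gam[OF assms] Z_def curv_def dir_deriv_eq_dz_dzb)
  qed
  have "Z v u + gam x u (gam x v w) = Z u v + gam x v (gam x u w)"
  proof (rule h_eqI[OF assms])
    fix z
    show "h x (Z v u + gam x u (gam x v w)) z = h x (Z u v + gam x v (gam x u w)) z"
      using dz_commute(1)[OF open_U h_smooth assms, of w z v u]
      unfolding dz_dz_h(1)[OF assms] Z_def[symmetric] by (simp add: h_add_left assms)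
  qed
  then show ?thesis unfolding riemann_def d by (simp add: christoffel_eq_gam assms algebra_simps)
qed

end

section \<open>Curvature tensor of an indefinite space form\<close>

text \<open>The sectional curvature is prescribed for nonnull vectors only. Along
  \<open>v + s w\<close> the null vectors are the real roots of a nonzero polynomial
  \<open>q\<close> in \<open>s\<close>, so identities that are polynomial in \<open>s\<close>
  survive.\<close>

lemma poly_zero_on_reals:
  fixes p q :: "complex poly"
  assumes "q \<noteq> 0" "\<And>s::real. poly q (of_real s) \<noteq> 0 \<Longrightarrow> poly p (of_real s) = 0"
  shows "p = 0"
proof -
  have "poly (p * q) (of_real s) = 0" for s :: real using assms(2)[of s] by auto
  then have "range (of_real :: real \<Rightarrow> complex) \<subseteq> {x. poly (p * q) x = 0}" by auto
  moreover have "infinite (range (of_real :: real \<Rightarrow> complex))"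
    using infinite_UNIV_char_0 finite_imageD inj_of_real by blast
  ultimately have "p * q = 0" using poly_roots_finite[of "p * q"] finite_subset by blast
  then show ?thesis using assms(1) by simp
qed

locale kaehler_space_form = kaehler_domain U G
  for U :: "(complex ^ 'k::finite) set" and G +
  fixes c :: real
  assumes sectional: "\<And>x v. x \<in> U \<Longrightarrow> G x v v \<noteq> 0 \<Longrightarrow> sectional_curvature G x v (J v) = 2 * c"

context kaehler_domain
begin

lemma h_diagonal: assumes "x \<in> U" shows "h x v v = of_real (G x v v)"
proof -
  have "G x v (J v) = - G x v (J v)" using G_J_skew[OF assms, of v v] G_sym[OF assms, of v "J v"] by simp
  then show ?thesis by (simp add: h_def complex_eq_iff)
qed

text \<open>Hermitian symmetry exchanges the first slot with the last one, where antilinearity is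
  that of \<open>dzb\<close>.\<close>

lemma curv_linear_left: assumes "x \<in> U"
  shows "curv x (p + q) w u = curv x p w u + curv x q w u" "curv x (d *s p) w u = d *s curv x p w u"
proof -
  have r: "h x (curv x v w u) z = cnj (h x (curv x u z v) w)" for v w u z
    using curv_hermitian[OF assms, of u z v w] by simp
  show "curv x (p + q) w u = curv x p w u + curv x q w u"
  proof (rule h_eqI[OF assms])
    fix z
    have "h x (curv x (p + q) w u) z = h x (curv x p w u) z + h x (curv x q w u) z"
      unfolding r[of "p + q"] r[of p] r[of q] curv_linear(1)[OF assms] h_add_left[OF assms] by simp
    then show "h x (curv x (p + q) w u) z = h x (curv x p w u + curv x q w u) z" by (simp add: h_add_left assms)
  qed
  show "curv x (d *s p) w u = d *s curv x p w u"
  proof (rule h_eqI[OF assms])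
    fix z
    have "h x (curv x (d *s p) w u) z = d * h x (curv x p w u) z"
      unfolding r[of "d *s p"] r[of p] curv_linear(2)[OF assms] h_scale_left[OF assms] by simp
    then show "h x (curv x (d *s p) w u) z = h x (d *s curv x p w u) z" by (simp add: h_scale_left assms)
  qed
qed

lemma curv_linear_mid: assumes "x \<in> U"
  shows "curv x w (p + q) u = curv x w p u + curv x w q u" "curv x w (d *s p) u = d *s curv x w p u"
  using curv_linear_left[OF assms] by (simp_all only: curv_commute[OF assms, of w])

end

context kaehler_space_form
begin

text \<open>For the plane of \<open>v\<close> and \<open>J v\<close> the complex structure
  contributes the factor \<open>\<i> * \<i> - cnj \<i> * \<i> = -2\<close>, which cancels the 2 in
  \<open>2 * c\<close>. The denominator is the square of \<open>G x v v\<close>, since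
  \<open>v\<close> and \<open>J v\<close> are orthogonal.\<close>

lemma curv_diagonal: assumes x: "x \<in> U" and v: "G x v v \<noteq> 0"
  shows "h x (curv x v v v) v = - of_real c * (h x v v * h x v v)"
proof -
  have "riemann G x v (J v) (J v) = curv x (J v) (J v) v - curv x v (J v) (J v)" by (rule riemann_eq[OF x])
  also have "\<dots> = (\<i> * \<i>) *s curv x v v v - (cnj \<i> * \<i>) *s curv x v v v"
    by (simp only: curv_linear_left(2)[OF x] curv_linear_mid(2)[OF x] curv_linear(2)[OF x] vector_smult_assoc)
  also have "\<dots> = (-2) *s curv x v v v" by (simp add: vec_eq_iff)
  finally have R: "riemann G x v (J v) (J v) = (-2) *s curv x v v v" .
  have Gh: "G x u w = Re (h x u w)" for u w by (simp add: h_def)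
  have "G x v (J v) = 0" using h_diagonal[OF x, of v] by (simp add: h_def complex_eq_iff)
  then have "G x (riemann G x v (J v) (J v)) v / (G x v v)\<^sup>2 = 2 * c"
    using sectional[OF x v] unfolding sectional_curvature_def by (simp add: G_J x power2_eq_square)
  then have "G x (riemann G x v (J v) (J v)) v = 2 * c * (G x v v)\<^sup>2" using v by (simp add: field_simps)
  moreover have "G x (riemann G x v (J v) (J v)) v = - 2 * Re (h x (curv x v v v) v)"
  proof -
    have "h x (riemann G x v (J v) (J v)) v = (-2) * h x (curv x v v v) v" unfolding R by (rule h_scale_left[OF x])
    then show ?thesis using Gh[of "riemann G x v (J v) (J v)" v] by simp
  qed
  ultimately have "Re (h x (curv x v v v) v) = - c * (G x v v)\<^sup>2" by simp
  moreover have "Im (h x (curv x v v v) v) = 0"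
    using curv_hermitian[OF x, of v v v v] by (simp add: complex_eq_iff)
  ultimately show ?thesis by (simp add: h_diagonal x complex_eq_iff power2_eq_square)
qed

text \<open>The deviation of the curvature from the model of constant holomorphic sectional
  curvature \<open>2 * c\<close>, with the symmetries of the curvature. It vanishes on the diagonal
  for nonnull vectors, and polarisation extends this.\<close>

definition T :: "complex ^ 'k \<Rightarrow> complex ^ 'k \<Rightarrow> complex ^ 'k \<Rightarrow> complex ^ 'k \<Rightarrow> complex ^ 'k \<Rightarrow> complex" where
  "T x v w u z = h x (curv x v w u) z + of_real (c / 2) * (h x v u * h x w z + h x v z * h x w u)"

lemma T_add: assumes "x \<in> U"
  shows "T x (p + q) w u z = T x p w u z + T x q w u z" "T x v (p + q) u z = T x v p u z + T x v q u z"
    "T x v w (p + q) z = T x v w p z + T x v w q z" "T x v w u (p + q) = T x v w u p + T x v w u q"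
  unfolding T_def
  by (simp_all add: h_add_left h_add_right curv_linear_left curv_linear_mid curv_linear assms algebra_simps)

lemma T_scale: assumes "x \<in> U"
  shows "T x (d *s v) w u z = d * T x v w u z" "T x v (d *s w) u z = d * T x v w u z"
    "T x v w (d *s u) z = cnj d * T x v w u z" "T x v w u (d *s z) = cnj d * T x v w u z"
  unfolding T_def
  by (simp_all add: h_scale_left h_scale_right curv_linear_left curv_linear_mid curv_linear assms algebra_simps)

lemma T_sym: assumes "x \<in> U" shows "T x v w u z = T x w v u z" "T x v w u z = T x v w z u"
proof -
  show 1: "T x v w u z = T x w v u z" for v w u z
    unfolding T_def by (simp add: curv_commute[OF assms, of v w] algebra_simps)
  have "h x (curv x v w u) z = h x (curv x v w z) u"
    by (simp only: curv_hermitian[OF assms, of u z v w, symmetric] curv_hermitian[OF assms, of z u v w, symmetric]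
        curv_commute[OF assms, of u z])
  then show "T x v w u z = T x v w z u" unfolding T_def by (simp add: algebra_simps)
qed

lemma G_line_poly: fixes w assumes x: "x \<in> U" and v: "G x v v \<noteq> 0"
  defines "q \<equiv> [:of_real (G x v v), of_real (2 * G x v w), of_real (G x w w):] :: complex poly"
  shows "q \<noteq> 0" "poly q (of_real s) = of_real (G x (v + of_real s *s w) (v + of_real s *s w))"
proof -
  show "q \<noteq> 0" using v by (simp add: q_def)
  have s: "of_real s *s w = s *\<^sub>R w" by (simp add: vec_eq_iff scaleR_conv_of_real[where 'a = complex])
  have "G x (v + s *\<^sub>R w) (v + s *\<^sub>R w) = G x v v + 2 * s * G x v w + s * s * G x w w"
    using linear_add[OF G_linear(1)[OF x]] linear_add[OF G_linear(2)[OF x]]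
      linear_scale[OF G_linear(1)[OF x]] linear_scale[OF G_linear(2)[OF x]] G_sym[OF x, of w v]
    by (simp add: algebra_simps)
  then show "poly q (of_real s) = of_real (G x (v + of_real s *s w) (v + of_real s *s w))"
    unfolding s by (simp add: q_def algebra_simps)
qed

text \<open>The coefficient of the square of \<open>s\<close> along \<open>v + s w\<close> has three
  terms. Replacing \<open>w\<close> by \<open>\<i> *s w\<close> changes the sign of two of them, so
  the third vanishes on its own.\<close>

lemma T_polarize1: assumes x: "x \<in> U" and v: "G x v v \<noteq> 0"
  shows "T x v w v w = 0"
proof -
  have z: "T x v v v v = 0" if "G x v v \<noteq> 0" for v
    unfolding T_def curv_diagonal[OF x that] by simp
  have c2: "T x w w v v + T x v v w w + 4 * T x v w v w = 0" for w
  proof -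
    have s1: "T x w v a b = T x v w a b" for a b by (rule T_sym(1)[OF x])
    have s2: "T x a b w v = T x a b v w" for a b by (rule T_sym(2)[OF x])
    define p where "p = [:T x v v v v, 2 * T x v w v v + 2 * T x v v v w, T x w w v v + T x v v w w + 4 * T x v w v w,
      2 * T x w w v w + 2 * T x v w w w, T x w w w w:]"
    have "poly p (of_real s) = T x (v + of_real s *s w) (v + of_real s *s w) (v + of_real s *s w) (v + of_real s *s w)" for s
      unfolding p_def T_add[OF x] T_scale[OF x] s1 s2 by (simp add: algebra_simps)
    then have "p = 0"
      using poly_zero_on_reals[OF G_line_poly(1)[OF x v, of w], of p] z G_line_poly(2)[OF x v, of w] by simp
    then show ?thesis by (simp add: p_def)
  qed
  have n: "- T x w w v v - T x v v w w + 4 * T x v w v w = 0"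
    using c2[of "\<i> *s w"] by (simp add: T_scale x)
  have "8 * T x v w v w = (T x w w v v + T x v v w w + 4 * T x v w v w) +
      (- T x w w v v - T x v v w w + 4 * T x v w v w)" by simp
  also have "\<dots> = 0" unfolding c2 n by simp
  finally have "8 * T x v w v w = 0" .
  then show ?thesis by simp
qed

lemma T_polarize2: assumes x: "x \<in> U" and v: "G x v v \<noteq> 0"
  shows "T x v w v z = 0"
proof -
  have 1: "T x v w v z + T x v z v w = 0" for w z
    using T_polarize1[OF x v, of "w + z"] T_polarize1[OF x v, of w] T_polarize1[OF x v, of z] by (simp add: T_add x add.commute)
  have "- \<i> * T x v w v z + \<i> * T x v z v w = 0"
    using 1[of w "\<i> *s z"] by (simp add: T_scale x)
  then have "\<i> * (T x v z v w - T x v w v z) = 0" by (simp add: algebra_simps)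
  then have "T x v z v w = T x v w v z" by simp
  with 1[of w z] show ?thesis by simp
qed

text \<open>The linear coefficient in \<open>s\<close> when \<open>v\<close> is replaced by
  \<open>v + s y\<close> in both of its slots; \<open>\<i> *s y\<close> in place of \<open>y\<close>
  separates the linear slot from the antilinear one.\<close>

lemma T_polarize3: assumes x: "x \<in> U" and v: "G x v v \<noteq> 0"
  shows "T x y w v z = 0"
proof -
  have 1: "T x y w v z + T x v w y z = 0" for y
  proof -
    define p where "p = [:T x v w v z, T x y w v z + T x v w y z, T x y w y z:]"
    have "poly p (of_real s) = T x (v + of_real s *s y) w (v + of_real s *s y) z" for s
      unfolding p_def by (simp add: T_add T_scale x algebra_simps)
    then have "p = 0"
      using poly_zero_on_reals[OF G_line_poly(1)[OF x v, of y], of p] T_polarize2[OF x] G_line_poly(2)[OF x v, of y] by simp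
    then show ?thesis by (simp add: p_def)
  qed
  have "\<i> * T x y w v z - \<i> * T x v w y z = 0" using 1[of "\<i> *s y"] by (simp add: T_scale x)
  then have "\<i> * (T x y w v z - T x v w y z) = 0" by (simp add: algebra_simps)
  then have "T x y w v z = T x v w y z" by simp
  with 1[of y] show ?thesis by simp
qed

text \<open>The antilinear slot stays restricted to nonnull \<open>v\<close>; below,
  \<open>v\<close> is the velocity of a disc in a positive definite submanifold.\<close>

lemma curv_space_form: assumes x: "x \<in> U" and v: "G x v v \<noteq> 0"
  shows "curv x a b v = (- of_real (c / 2) * h x a v) *s b + (- of_real (c / 2) * h x b v) *s a"
proof (rule h_eqI[OF x])
  fix z
  show "h x (curv x a b v) z = h x ((- of_real (c / 2) * h x a v) *s b + (- of_real (c / 2) * h x b v) *s a) z"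
    using T_polarize3[OF x v, of a b z] unfolding T_def h_add_left[OF x] h_scale_left[OF x]
    by (simp add: algebra_simps eq_neg_iff_add_eq_0)
qed

end

lemma sum_UNIV_option: "(\<Sum>z\<in>(UNIV :: 'k::finite option set). f z) = f None + (\<Sum>c\<in>UNIV. f (Some c))"
  by (simp add: UNIV_option_conv sum.reindex)

context kaehler_domain
begin

lemma sum_Basis_complex_vec: "(\<Sum>b\<in>(Basis :: (complex ^ 'k) set). f b) = (\<Sum>i\<in>UNIV. f (axis i 1) + f (axis i \<i>))"
proof -
  have B: "(Basis :: (complex ^ 'k) set) = (\<Union>i\<in>UNIV. {axis i 1, axis i \<i>})"
    by (auto simp: Basis_vec_def Basis_complex_def)
  have "(\<Sum>b\<in>(\<Union>i\<in>UNIV. {axis i 1, axis i \<i>}). f b) = (\<Sum>i\<in>(UNIV :: 'k set). \<Sum>b\<in>{axis i 1, axis i \<i>}. f b)"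
    by (rule sum.UNION_disjoint) (auto simp: axis_eq_axis)
  also have "\<dots> = (\<Sum>i\<in>UNIV. f (axis i 1) + f (axis i \<i>))"
    by (intro sum.cong) (auto simp: axis_eq_axis)
  finally show ?thesis unfolding B .
qed

text \<open>The real basis is grouped into pairs of \<open>axis i 1\<close> and its multiple by
  \<open>\<i>\<close>. Within a pair the contributions of the antilinear slot cancel and those of
  the linear slot double.\<close>

lemma ricci_eq: assumes x: "x \<in> U"
  shows "ricci G x v w = - 2 * Re (\<Sum>i\<in>UNIV. curv x w (axis i 1) v $ i)"
proof -
  have ax: "axis i \<i> = \<i> *s axis i (1::complex)" for i :: 'k by (simp add: vec_eq_iff axis_def)
  have in1: "z \<bullet> axis i 1 = Re (z $ i)" "z \<bullet> axis i \<i> = Im (z $ i)" for z :: "complex ^ 'k" and i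
    by (simp_all add: inner_axis inner_complex_def)
  have "riemann G x (axis i 1) v w \<bullet> axis i 1 + riemann G x (axis i \<i>) v w \<bullet> axis i \<i> =
     - 2 * Re (curv x w (axis i 1) v $ i)" for i
    unfolding in1 riemann_eq[OF x] unfolding ax
    by (simp add: curv_linear[OF x] curv_linear_left[OF x] curv_commute[OF x, of w])
  then show ?thesis unfolding ricci_def sum_Basis_complex_vec by (simp add: sum_distrib_left sum_negf)
qed

end

section \<open>Hermitian forms along a disc\<close>

lemma holomorphic_cnj_cnj:
  assumes "f holomorphic_on ball 0 r"
  shows "(\<lambda>s. cnj (f (cnj s))) holomorphic_on ball 0 r"
proof -
  have "z \<in> cnj ` ball 0 r" if "z \<in> ball 0 r" for z
    by (rule image_eqI[of _ _ "cnj z"]) (use that in auto)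
  then have "cnj ` ball 0 r = ball 0 r" by auto
  then have "(cnj \<circ> f \<circ> cnj) holomorphic_on ball 0 r"
    using assms by (intro holomorphic_on_compose_cnj_cnj) auto
  then show ?thesis by (simp add: o_def)
qed

text \<open>Conjugating both the second factor and its argument makes that factor holomorphic in
  \<open>s\<close>.\<close>

lemma finite_rank_hermitian:
  fixes H :: "'k::finite \<Rightarrow> 'k \<Rightarrow> complex"
  assumes "\<And>z. f z holomorphic_on ball 0 r" "\<And>z. g z holomorphic_on ball 0 r"
  shows "finite_rank (ball 0 r) (\<lambda>t s. \<Sum>z\<in>UNIV. \<Sum>w\<in>UNIV. f z t * H z w * cnj (g w (cnj s)))"
  by (intro finite_rank_sum finite finite_rank_product holomorphic_on_mult assms holomorphic_on_const
      holomorphic_cnj_cnj)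

lemma finite_rank_det:
  fixes A :: "'n::finite \<Rightarrow> 'k::finite \<Rightarrow> complex \<Rightarrow> complex"
  assumes "\<And>a z. A a z holomorphic_on ball 0 r"
  shows "finite_rank (ball 0 r)
    (\<lambda>t s. det (\<chi> a b. \<Sum>z\<in>UNIV. \<Sum>w\<in>UNIV. A a z t * H z w * cnj (A b w (cnj s)) :: complex ^ 'n ^ 'n))"
  unfolding det_def vec_lambda_beta
  by (intro finite_rank_sum finite_rank_mult finite_rank_const finite_rank_prod finite_rank_hermitian assms
      finite finite_permutations)

text \<open>Let \<open>X' = N X\<close> with \<open>X 0 = 1\<close> and let \<open>Y\<close> be the
  inverse of \<open>X\<close>. The derivative of \<open>Y W Y^*\<close> in \<open>t\<close> vanishes
  by the equation, and that in the conjugate variable because \<open>W\<close> is Hermitian. Hence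
  \<open>Y W Y^*\<close> is a constant \<open>H\<close>, and \<open>W = X H X^*\<close>.\<close>

lemma hermitian_factorization:
  fixes W N :: "complex \<Rightarrow> 'k::finite \<Rightarrow> 'k \<Rightarrow> complex"
  assumes r: "r > 0" and N: "\<And>a b. (\<lambda>t. N t a b) holomorphic_on ball 0 r"
    and W: "\<And>t a b. t \<in> ball 0 r \<Longrightarrow> \<exists>B. wirtinger (\<lambda>t. W t a b) (\<Sum>c\<in>UNIV. N t a c * W t c b) B t"
    and herm: "\<And>t a b. t \<in> ball 0 r \<Longrightarrow> cnj (W t a b) = W t b a"
  shows "\<exists>d (X :: 'k \<Rightarrow> 'k \<Rightarrow> complex \<Rightarrow> complex) H. 0 < d \<and> d \<le> r \<and> (\<forall>a z. X a z holomorphic_on ball 0 d) \<and>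
    (\<forall>t\<in>ball 0 d. \<forall>a b. W t a b = (\<Sum>z\<in>UNIV. \<Sum>w\<in>UNIV. X a z t * H z w * cnj (X b w t)))"
proof -
  from holomorphic_linear_ode[of r "\<lambda>a b t. N t a b", OF r N]
  obtain d1 X where d1: "0 < d1" "d1 \<le> r" and X0: "\<forall>a b. X a b 0 = (if a = b then 1 else (0::complex))"
    and X: "\<forall>a b. \<forall>t\<in>ball 0 d1. (X a b has_field_derivative (\<Sum>c\<in>UNIV. N t a c * X c b t)) (at t)" by (elim exE conjE) (rule that; assumption)
  \<comment> \<open>The inverse satisfies \<open>Y' = - Y N\<close>; transposition brings this into
    the form solved by \<open>holomorphic_linear_ode\<close>.\<close>
  have "(\<lambda>t. - N t b a) holomorphic_on ball 0 r" for a b using N[of b a] by (intro holomorphic_intros)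
  from holomorphic_linear_ode[of r "\<lambda>a b t. - N t b a", OF r this]
  obtain d2 Z where d2: "0 < d2" "d2 \<le> r" and Z0: "\<forall>a b. Z a b 0 = (if a = b then 1 else (0::complex))"
    and Z: "\<forall>a b. \<forall>t\<in>ball 0 d2. (Z a b has_field_derivative (\<Sum>c\<in>UNIV. - N t c a * Z c b t)) (at t)"
    by (elim exE conjE) (rule that; assumption)
  define d where "d = min d1 d2"
  have d: "0 < d" "d \<le> r" and sub: "\<And>t. t \<in> ball 0 d \<Longrightarrow> t \<in> ball 0 d1 \<and> t \<in> ball 0 d2 \<and> t \<in> ball 0 r"
    using d1 d2 by (auto simp: d_def)
  define Y where "Y a b = Z b a" for a b
  have wX: "wirtinger (X a b) (\<Sum>c\<in>UNIV. N t a c * X c b t) 0 t" if "t \<in> ball 0 d" for a b t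
    using X sub[OF that] by (intro wirtinger_holomorphic) blast
  have wY: "wirtinger (Y a b) (- (\<Sum>c\<in>UNIV. Y a c t * N t c b)) 0 t" if "t \<in> ball 0 d" for a b t
  proof -
    have "(Z b a has_field_derivative (\<Sum>c\<in>UNIV. - N t c b * Z c a t)) (at t)" using Z sub[OF that] by blast
    from wirtinger_holomorphic[OF this] show ?thesis
      unfolding Y_def by (simp add: sum_negf mult.commute)
  qed
  define YM where "YM t = (\<chi> a b. Y a b t)" for t
  define XM where "XM t = (\<chi> a b. X a b t)" for t
  define WM where "WM t = (\<chi> a b. W t a b)" for t
  define NM where "NM t = (\<chi> a b. N t a b)" for t
  define st where "st A = (\<chi> a b. cnj (A $ b $ a))" for A :: "complex ^ 'k ^ 'k"
  have st_mult: "st (A ** B) = st B ** st A" for A B :: "complex ^ 'k ^ 'k"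
    by (simp add: st_def vec_eq_iff matrix_matrix_mult_def mult.commute)
  have YX: "YM t ** XM t = mat 1" if t: "t \<in> ball 0 d" for t
  proof -
    have A1: "(\<Sum>c\<in>UNIV. Y a c t * X c b t) = (\<Sum>c\<in>UNIV. Y a c 0 * X c b 0)" for a b
    proof (rule wirtinger_zero_const[where f = "\<lambda>t. \<Sum>c\<in>UNIV. Y a c t * X c b t", OF _ t])
      fix t :: complex assume t: "t \<in> ball 0 d"
      have "wirtinger (\<lambda>t. \<Sum>c\<in>UNIV. Y a c t * X c b t)
        (\<Sum>c\<in>UNIV. - (\<Sum>e\<in>UNIV. Y a e t * N t e c) * X c b t + Y a c t * (\<Sum>e\<in>UNIV. N t c e * X e b t))
        (\<Sum>c\<in>UNIV. 0 * X c b t + Y a c t * 0) t"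
        by (intro wirtinger_sum wirtinger_mult wX wY t)
      moreover have "(\<Sum>c\<in>UNIV. - (\<Sum>e\<in>UNIV. Y a e t * N t e c) * X c b t + Y a c t * (\<Sum>e\<in>UNIV. N t c e * X e b t)) = 0"
      proof -
        have "(\<Sum>c\<in>UNIV. (\<Sum>e\<in>UNIV. Y a e t * N t e c) * X c b t) = ((YM t ** NM t) ** XM t) $ a $ b"
          by (simp add: matrix_matrix_mult_def YM_def NM_def XM_def)
        also have "\<dots> = (YM t ** (NM t ** XM t)) $ a $ b" by (simp add: matrix_mul_assoc)
        also have "\<dots> = (\<Sum>c\<in>UNIV. Y a c t * (\<Sum>e\<in>UNIV. N t c e * X e b t))"
          by (simp add: matrix_matrix_mult_def YM_def NM_def XM_def)
        finally show ?thesis by (simp add: sum.distrib sum_negf sum_subtractf)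
      qed
      ultimately show "wirtinger (\<lambda>t. \<Sum>c\<in>UNIV. Y a c t * X c b t) 0 0 t" by simp
    qed
    have A2: "(\<Sum>c\<in>UNIV. Y a c 0 * X c b 0) = (if a = b then 1 else 0)" for a b
    proof -
      have "(\<Sum>c\<in>UNIV. Y a c 0 * X c b 0) = (\<Sum>c\<in>UNIV. if c = a then X c b 0 else 0)"
        by (intro sum.cong) (auto simp: Y_def Z0)
      then show ?thesis using X0 by simp
    qed
    show ?thesis by (simp add: vec_eq_iff matrix_matrix_mult_def YM_def XM_def mat_def A1 A2)
  qed
  define F where "F t = YM t ** WM t ** st (YM t)" for t
  have F_nth: "F t $ a $ b = (\<Sum>c\<in>UNIV. (\<Sum>e\<in>UNIV. Y a e t * W t e c) * cnj (Y b c t))" for t a b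
    by (simp add: F_def matrix_matrix_mult_def YM_def WM_def st_def)
  have F0: "F t $ a $ b = F 0 $ a $ b" if t: "t \<in> ball 0 d" for t a b
  proof (rule wirtinger_zero_const[where f = "\<lambda>t. F t $ a $ b", OF _ t])
    fix t :: complex assume t: "t \<in> ball 0 d"
    have hW: "W t a b = cnj (W t b a)" for a b using herm[of t b a] sub[OF t] by simp
    define B where "B a b = (SOME B. wirtinger (\<lambda>t. W t a b) (\<Sum>c\<in>UNIV. N t a c * W t c b) B t)" for a b
    have B: "wirtinger (\<lambda>t. W t a b) (\<Sum>c\<in>UNIV. N t a c * W t c b) (B a b) t" for a b
      unfolding B_def by (rule someI_ex[OF W]) (use sub[OF t] in blast)
    have op: "open (ball (0::complex) r)" by simp
    \<comment> \<open>The conjugate of the equation for \<open>W t b a\<close> determines the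
      antiholomorphic derivative of \<open>W t a b\<close>.\<close>
    have "wirtinger (\<lambda>t. W t a b) (cnj (B b a)) (cnj (\<Sum>c\<in>UNIV. N t b c * W t c a)) t" for a b
      by (rule wirtinger_cong[OF wirtinger_cnj[OF B] op]) (use herm sub[OF t] in auto)
    from wirtinger_unique(2)[OF B this] have Bv: "B a b = cnj (\<Sum>c\<in>UNIV. N t b c * W t c a)" for a b .
    have "wirtinger (\<lambda>t. F t $ a $ b)
      (\<Sum>c\<in>UNIV. (\<Sum>e\<in>UNIV. - (\<Sum>f\<in>UNIV. Y a f t * N t f e) * W t e c + Y a e t * (\<Sum>f\<in>UNIV. N t e f * W t f c)) * cnj (Y b c t)
          + (\<Sum>e\<in>UNIV. Y a e t * W t e c) * cnj 0)
      (\<Sum>c\<in>UNIV. (\<Sum>e\<in>UNIV. 0 * W t e c + Y a e t * B e c) * cnj (Y b c t)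
          + (\<Sum>e\<in>UNIV. Y a e t * W t e c) * cnj (- (\<Sum>f\<in>UNIV. Y b f t * N t f c))) t"
      unfolding F_nth by (intro wirtinger_sum wirtinger_mult wirtinger_cnj wY B t)
    moreover have "(\<Sum>e\<in>UNIV. - (\<Sum>f\<in>UNIV. Y a f t * N t f e) * W t e c + Y a e t * (\<Sum>f\<in>UNIV. N t e f * W t f c)) = 0" for c
    proof -
      have "(\<Sum>e\<in>UNIV. (\<Sum>f\<in>UNIV. Y a f t * N t f e) * W t e c) = ((YM t ** NM t) ** WM t) $ a $ c"
        by (simp add: matrix_matrix_mult_def YM_def NM_def WM_def)
      also have "\<dots> = (YM t ** (NM t ** WM t)) $ a $ c" by (simp add: matrix_mul_assoc)
      also have "\<dots> = (\<Sum>e\<in>UNIV. Y a e t * (\<Sum>f\<in>UNIV. N t e f * W t f c))"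
        by (simp add: matrix_matrix_mult_def YM_def NM_def WM_def)
      finally show ?thesis by (simp add: sum.distrib sum_negf sum_subtractf)
    qed
    moreover have "(\<Sum>c\<in>UNIV. (\<Sum>e\<in>UNIV. 0 * W t e c + Y a e t * B e c) * cnj (Y b c t)
          + (\<Sum>e\<in>UNIV. Y a e t * W t e c) * cnj (- (\<Sum>f\<in>UNIV. Y b f t * N t f c))) = 0"
    proof -
      have Q: "(\<Sum>c\<in>UNIV. (\<Sum>e\<in>UNIV. Y a e t * Q $ e $ c) * cnj (Y b c t)) = (YM t ** Q ** st (YM t)) $ a $ b" for Q :: "complex ^ 'k ^ 'k"
        by (simp add: matrix_matrix_mult_def YM_def st_def)
      have B': "B e c = (WM t ** st (NM t)) $ e $ c" for e c
        unfolding Bv by (simp add: matrix_matrix_mult_def WM_def NM_def st_def hW[of _ e] mult.commute)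
      have "(\<Sum>c\<in>UNIV. (\<Sum>e\<in>UNIV. Y a e t * B e c) * cnj (Y b c t)) = (YM t ** (WM t ** st (NM t)) ** st (YM t)) $ a $ b"
        unfolding B' by (rule Q)
      also have "\<dots> = ((YM t ** WM t) ** st (YM t ** NM t)) $ a $ b"
        by (simp add: st_mult matrix_mul_assoc)
      also have "\<dots> = (\<Sum>c\<in>UNIV. (\<Sum>e\<in>UNIV. Y a e t * W t e c) * cnj (\<Sum>f\<in>UNIV. Y b f t * N t f c))"
        by (simp add: matrix_matrix_mult_def YM_def NM_def WM_def st_def)
      finally show ?thesis by (simp add: sum.distrib sum_negf sum_subtractf)
    qed
    ultimately show "wirtinger (\<lambda>t. F t $ a $ b) 0 0 t" by simp
  qed
  have WX: "WM t = XM t ** F 0 ** st (XM t)" if t: "t \<in> ball 0 d" for t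
  proof -
    have "XM t ** YM t = mat 1" using YX[OF t] by (simp add: matrix_left_right_inverse)
    moreover have "F t = F 0" using F0[OF t] by (simp add: vec_eq_iff)
    moreover have "XM t ** F t ** st (XM t) = (XM t ** YM t) ** WM t ** st (XM t ** YM t)"
      by (simp add: F_def st_mult matrix_mul_assoc)
    moreover have "st (mat 1) = mat 1" by (simp add: st_def mat_def vec_eq_iff)
    ultimately show ?thesis by simp
  qed
  have eq: "W t a b = (\<Sum>z\<in>UNIV. \<Sum>w\<in>UNIV. X a z t * F 0 $ z $ w * cnj (X b w t))" if t: "t \<in> ball 0 d" for t a b
  proof -
    have "W t a b = (XM t ** F 0 ** st (XM t)) $ a $ b" using WX[OF t] by (simp add: WM_def vec_eq_iff)
    also have "\<dots> = (\<Sum>w\<in>UNIV. (\<Sum>z\<in>UNIV. X a z t * F 0 $ z $ w) * cnj (X b w t))"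
      by (simp add: matrix_matrix_mult_def XM_def st_def)
    also have "\<dots> = (\<Sum>w\<in>UNIV. \<Sum>z\<in>UNIV. X a z t * F 0 $ z $ w * cnj (X b w t))" by (simp add: sum_distrib_right)
    also have "\<dots> = (\<Sum>z\<in>UNIV. \<Sum>w\<in>UNIV. X a z t * F 0 $ z $ w * cnj (X b w t))" by (rule sum.swap)
    finally show ?thesis .
  qed
  have "X a z holomorphic_on ball 0 d" for a z
    unfolding holomorphic_on_open[OF open_ball] using X sub by blast
  then show ?thesis
    by (intro exI[of _ d] exI[of _ X] exI[of _ "\<lambda>z w. F 0 $ z $ w"] conjI allI ballI eq d)
qed

text \<open>On \<open>s = cnj t\<close> differentiation in \<open>s\<close> becomes the
  antiholomorphic derivative. This links smooth functions on the disc to functions of finite rank in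
  two variables.\<close>

lemma wirtinger_finite_rank_diagonal:
  assumes F: "finite_rank (ball 0 r) F" and t: "t \<in> ball 0 r"
  shows "wirtinger (\<lambda>t. F t (cnj t)) (deriv (\<lambda>u. F u (cnj t)) t) (deriv (F t) (cnj t)) t"
    "wirtinger (\<lambda>t. deriv (\<lambda>u. F u (cnj t)) t) a b t \<Longrightarrow> b = deriv (\<lambda>u. deriv (F u) (cnj t)) t"
proof -
  obtain k :: nat and p q where pq: "\<forall>i<k. p i holomorphic_on ball 0 r \<and> q i holomorphic_on ball 0 r"
    "\<forall>t\<in>ball 0 r. \<forall>s\<in>ball 0 r. F t s = (\<Sum>i<k. p i t * q i s) \<and>
      deriv (\<lambda>t. F t s) t = (\<Sum>i<k. deriv (p i) t * q i s) \<and>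
      deriv (F t) s = (\<Sum>i<k. p i t * deriv (q i) s) \<and>
      deriv (\<lambda>t. deriv (F t) s) t = (\<Sum>i<k. deriv (p i) t * deriv (q i) s)"
    using finite_rank_derivs[OF F open_ball] by auto
  have ct: "cnj u \<in> ball 0 r" if "u \<in> ball 0 r" for u using that by simp
  have w: "wirtinger (\<lambda>t. \<Sum>i<k. f i t * q i (cnj t)) (\<Sum>i<k. deriv (f i) t * q i (cnj t)) (\<Sum>i<k. f i t * deriv (q i) (cnj t)) t"
    if f: "\<And>i. i < k \<Longrightarrow> f i holomorphic_on ball 0 r" for f
  proof -
    have "wirtinger (\<lambda>t. \<Sum>i<k. f i t * q i (cnj t))
       (\<Sum>i<k. deriv (f i) t * q i (cnj t) + f i t * 0) (\<Sum>i<k. 0 * q i (cnj t) + f i t * deriv (q i) (cnj t)) t"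
      by (intro wirtinger_sum wirtinger_mult wirtinger_holomorphic wirtinger_antiholomorphic
          holomorphic_derivI[OF _ open_ball] t ct) (use f pq(1) t in auto)
    then show ?thesis by simp
  qed
  have "wirtinger (\<lambda>t. F t (cnj t)) (\<Sum>i<k. deriv (p i) t * q i (cnj t)) (\<Sum>i<k. p i t * deriv (q i) (cnj t)) t"
    by (rule wirtinger_cong[OF w open_ball t]) (use pq ct in auto)
  then show "wirtinger (\<lambda>t. F t (cnj t)) (deriv (\<lambda>u. F u (cnj t)) t) (deriv (F t) (cnj t)) t"
    using pq(2) t ct[OF t] by simp
  assume a: "wirtinger (\<lambda>t. deriv (\<lambda>u. F u (cnj t)) t) a b t"
  have "wirtinger (\<lambda>t. deriv (\<lambda>u. F u (cnj t)) t) (\<Sum>i<k. deriv (deriv (p i)) t * q i (cnj t)) (\<Sum>i<k. deriv (p i) t * deriv (q i) (cnj t)) t"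
    by (rule wirtinger_cong[OF w[of "\<lambda>i. deriv (p i)"] open_ball t]) (use pq ct in \<open>auto intro: holomorphic_deriv\<close>)
  from wirtinger_unique(2)[OF a this] show "b = deriv (\<lambda>u. deriv (F u) (cnj t)) t"
    using pq(2) t ct[OF t] by simp
qed

text \<open>On the diagonal \<open>\<nu>\<close> is the logarithmic derivative of \<open>F\<close>,
  so its antiholomorphic derivative \<open>\<kappa>\<close> is the mixed logarithmic derivative,
  here cleared of denominators.\<close>

lemma mixed_log_derivative:
  assumes F: "finite_rank (ball 0 r) F" 
    and f: "\<And>t. t \<in> ball 0 r \<Longrightarrow> \<exists>B. wirtinger (\<lambda>t. F t (cnj t)) (\<nu> t * F t (cnj t)) B t"
    and \<nu>: "wirtinger \<nu> a \<kappa> t" and t: "t \<in> ball 0 r"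
  shows "F t (cnj t) * deriv (\<lambda>u. deriv (F u) (cnj t)) t - deriv (\<lambda>u. F u (cnj t)) t * deriv (F t) (cnj t)
    = \<kappa> * (F t (cnj t))\<^sup>2"
proof -
  have 1: "deriv (\<lambda>u. F u (cnj s)) s = \<nu> s * F s (cnj s)" if s: "s \<in> ball 0 r" for s
    using f[OF s] wirtinger_unique(1)[OF wirtinger_finite_rank_diagonal(1)[OF F s]] by blast
  note wF = wirtinger_finite_rank_diagonal(1)[OF F t]
  have "wirtinger (\<lambda>t. deriv (\<lambda>u. F u (cnj t)) t) (a * F t (cnj t) + \<nu> t * deriv (\<lambda>u. F u (cnj t)) t)
     (\<kappa> * F t (cnj t) + \<nu> t * deriv (F t) (cnj t)) t"
    by (rule wirtinger_cong[OF wirtinger_mult[OF \<nu> wF] open_ball t]) (simp add: 1)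
  from wirtinger_finite_rank_diagonal(2)[OF F t this]
  have "deriv (\<lambda>u. deriv (F u) (cnj t)) t = \<kappa> * F t (cnj t) + \<nu> t * deriv (F t) (cnj t)" by simp
  then show ?thesis using 1[OF t] by (simp add: algebra_simps power2_eq_square)
qed

text \<open>The relation is known on the diagonal, is polarised to independent \<open>t\<close> and
  \<open>s\<close>, and is then restricted to a disc on which \<open>E\<close> has no zeros.\<close>

lemma flat_conclusion:
  assumes r: "r > 0" and E: "finite_rank (ball 0 r) E" and \<rho>: "finite_rank (ball 0 r) \<rho>"
    and w: "\<And>t. t \<in> ball 0 r \<Longrightarrow> \<exists>B. wirtinger (\<lambda>t. E t (cnj t)) (\<nu> t * E t (cnj t)) B t"
    and \<nu>: "\<And>t. t \<in> ball 0 r \<Longrightarrow> \<exists>a. wirtinger \<nu> a (\<alpha> * \<rho> t (cnj t)) t"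
    and nz: "E 0 0 \<noteq> 0" "\<rho> 0 0 \<noteq> 0"
  shows "\<alpha> = 0"
proof -
  let ?Et = "\<lambda>t s. deriv (\<lambda>u. E u s) t" and ?Es = "\<lambda>t s. deriv (E t) s" and ?Ets = "\<lambda>t s. deriv (\<lambda>u. deriv (E u) s) t"
  have fr: "finite_rank (ball 0 r) (\<lambda>t s. (E t s * ?Ets t s - ?Et t s * ?Es t s) - \<alpha> * \<rho> t s * (E t s)\<^sup>2)"
    unfolding power2_eq_square
    by (intro finite_rank_diff finite_rank_mult finite_rank_const E \<rho> finite_rank_deriv[OF E open_ball])
  have rel: "(E t s * ?Ets t s - ?Et t s * ?Es t s) - \<alpha> * \<rho> t s * (E t s)\<^sup>2 = 0"
    if ts: "t \<in> ball 0 (r / 2)" "s \<in> ball 0 (r / 2)" for t s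
  proof (rule polarization[OF fr _ ts])
    fix t :: complex assume t: "t \<in> ball 0 r"
    obtain a where "wirtinger \<nu> a (\<alpha> * \<rho> t (cnj t)) t" using \<nu>[OF t] by blast
    from mixed_log_derivative[OF E w this t]
    show "(E t (cnj t) * ?Ets t (cnj t) - ?Et t (cnj t) * ?Es t (cnj t)) - \<alpha> * \<rho> t (cnj t) * (E t (cnj t))\<^sup>2 = 0"
      by simp
  qed
  have half: "ball (0::complex) (r / 2) \<subseteq> ball 0 r" using r by auto
  obtain d where d: "d > 0" "d \<le> r / 2" "\<And>t s. t \<in> ball 0 d \<Longrightarrow> s \<in> ball 0 d \<Longrightarrow> E t s \<noteq> 0"
    using finite_rank_nonzero_nbhd[OF finite_rank_subset[OF E half] _ nz(1)] r by auto
  let ?D = "ball (0::complex) d"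
  have sub: "?D \<subseteq> ball 0 r" "?D \<subseteq> ball 0 (r / 2)" using d r by auto
  obtain n :: nat and e k where ek: "\<forall>i<n. e i holomorphic_on ?D \<and> k i holomorphic_on ?D"
    "\<forall>t\<in>?D. \<forall>s\<in>?D. E t s = (\<Sum>i<n. e i t * k i s) \<and> ?Et t s = (\<Sum>i<n. deriv (e i) t * k i s) \<and>
      ?Es t s = (\<Sum>i<n. e i t * deriv (k i) s) \<and> ?Ets t s = (\<Sum>i<n. deriv (e i) t * deriv (k i) s)"
    using finite_rank_derivs[OF finite_rank_subset[OF E sub(1)] open_ball] by auto
  obtain q :: nat and a b where ab: "\<forall>i<q. a i holomorphic_on ?D \<and> b i holomorphic_on ?D"
    "\<forall>t\<in>?D. \<forall>s\<in>?D. \<rho> t s = (\<Sum>i<q. a i t * b i s)"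
    using finite_rank_sum_form[OF finite_rank_subset[OF \<rho> sub(1)]] by auto
  show ?thesis
  proof (rule flat_rank_argument[OF d(1), of n e k q a b "\<lambda>t s. \<Sum>i<n. e i t * k i s" "\<lambda>t s. \<Sum>i<n. deriv (e i) t * k i s"
        "\<lambda>t s. \<Sum>i<n. e i t * deriv (k i) s" "\<lambda>t s. \<Sum>i<n. deriv (e i) t * deriv (k i) s" "\<lambda>t s. \<Sum>i<q. a i t * b i s"])
    fix t s assume t: "t \<in> ?D" and s: "s \<in> ?D"
    note eqs = ek(2)[rule_format, OF t s] ab(2)[rule_format, OF t s]
    show "(\<Sum>i<n. e i t * k i s) \<noteq> 0" using d(3)[OF t s] eqs by simp
    have "E t s * ?Ets t s - ?Et t s * ?Es t s = \<alpha> * \<rho> t s * (E t s)\<^sup>2" using rel[OF subsetD[OF sub(2) t] subsetD[OF sub(2) s]] by simp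
    then show "(\<Sum>i<n. e i t * k i s) * (\<Sum>i<n. deriv (e i) t * deriv (k i) s) - (\<Sum>i<n. deriv (e i) t * k i s) * (\<Sum>i<n. e i t * deriv (k i) s)
       = \<alpha> * (\<Sum>i<q. a i t * b i s) * (\<Sum>i<n. e i t * k i s)\<^sup>2" using eqs by simp
  next
    show "(\<Sum>i<q. a i 0 * b i 0) \<noteq> 0" using ab(2) d(1) nz(2) by simp
  qed (use ek(1) ab(1) in auto)
qed

text \<open>The function \<open>\<kappa>\<close> lives on the diagonal only. Eliminating it between
  the equations for \<open>E\<close> and \<open>P\<close> leaves a polynomial relation of finite
  rank, to which polarisation applies.\<close>

lemma curved_conclusion:
  assumes r: "r > 0" and E: "finite_rank (ball 0 r) E" and P: "finite_rank (ball 0 r) P"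
    and wE: "\<And>t. t \<in> ball 0 r \<Longrightarrow> \<exists>B. wirtinger (\<lambda>t. E t (cnj t)) (\<nu> t * E t (cnj t)) B t"
    and \<nu>: "\<And>t. t \<in> ball 0 r \<Longrightarrow> \<exists>a. wirtinger \<nu> a (\<beta> * \<kappa> t) t"
    and wP: "\<And>t. t \<in> ball 0 r \<Longrightarrow> \<exists>B. wirtinger (\<lambda>t. P t (cnj t)) (\<mu> t * P t (cnj t)) B t"
    and \<mu>: "\<And>t. t \<in> ball 0 r \<Longrightarrow> \<exists>a. wirtinger \<mu> a (\<kappa> t) t"
    and nz: "E 0 0 \<noteq> 0" "P 0 0 \<noteq> 0" "\<kappa> 0 \<noteq> 0"
  shows "\<beta> \<in> \<rat>"
proof -
  let ?Et = "\<lambda>t s. deriv (\<lambda>u. E u s) t" and ?Es = "\<lambda>t s. deriv (E t) s" and ?Ets = "\<lambda>t s. deriv (\<lambda>u. deriv (E u) s) t"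
  let ?Pt = "\<lambda>t s. deriv (\<lambda>u. P u s) t" and ?Ps = "\<lambda>t s. deriv (P t) s" and ?Pts = "\<lambda>t s. deriv (\<lambda>u. deriv (P u) s) t"
  have fr: "finite_rank (ball 0 r) (\<lambda>t s. (E t s * ?Ets t s - ?Et t s * ?Es t s) * (P t s)\<^sup>2 -
      \<beta> * (P t s * ?Pts t s - ?Pt t s * ?Ps t s) * (E t s)\<^sup>2)"
    unfolding power2_eq_square
    by (intro finite_rank_diff finite_rank_mult finite_rank_const E P finite_rank_deriv[OF E open_ball] finite_rank_deriv[OF P open_ball])
  have Pk: "P t (cnj t) * ?Pts t (cnj t) - ?Pt t (cnj t) * ?Ps t (cnj t) = \<kappa> t * (P t (cnj t))\<^sup>2" if t: "t \<in> ball 0 r" for t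
  proof -
    obtain b where "wirtinger \<mu> b (\<kappa> t) t" using \<mu>[OF t] by blast
    from mixed_log_derivative[OF P wP this t] show ?thesis .
  qed
  have rel: "(E t s * ?Ets t s - ?Et t s * ?Es t s) * (P t s)\<^sup>2 - \<beta> * (P t s * ?Pts t s - ?Pt t s * ?Ps t s) * (E t s)\<^sup>2 = 0"
    if ts: "t \<in> ball 0 (r / 2)" "s \<in> ball 0 (r / 2)" for t s
  proof (rule polarization[OF fr _ ts])
    fix t :: complex assume t: "t \<in> ball 0 r"
    obtain a where a: "wirtinger \<nu> a (\<beta> * \<kappa> t) t" using \<nu>[OF t] by blast
    show "(E t (cnj t) * ?Ets t (cnj t) - ?Et t (cnj t) * ?Es t (cnj t)) * (P t (cnj t))\<^sup>2 -
      \<beta> * (P t (cnj t) * ?Pts t (cnj t) - ?Pt t (cnj t) * ?Ps t (cnj t)) * (E t (cnj t))\<^sup>2 = 0"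
    proof -
      have Ek: "E t (cnj t) * ?Ets t (cnj t) - ?Et t (cnj t) * ?Es t (cnj t) = \<beta> * \<kappa> t * (E t (cnj t))\<^sup>2"
        by (rule mixed_log_derivative[OF E wE a t])
      show ?thesis unfolding Pk[OF t] Ek by (simp add: mult_ac)
    qed
  qed
  have half: "ball (0::complex) (r / 2) \<subseteq> ball 0 r" using r by auto
  obtain d1 where d1: "d1 > 0" "d1 \<le> r / 2" "\<And>t s. t \<in> ball 0 d1 \<Longrightarrow> s \<in> ball 0 d1 \<Longrightarrow> E t s \<noteq> 0"
    using finite_rank_nonzero_nbhd[OF finite_rank_subset[OF E half] _ nz(1)] r by auto
  obtain d2 where d2: "d2 > 0" "d2 \<le> r / 2" "\<And>t s. t \<in> ball 0 d2 \<Longrightarrow> s \<in> ball 0 d2 \<Longrightarrow> P t s \<noteq> 0"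
    using finite_rank_nonzero_nbhd[OF finite_rank_subset[OF P half] _ nz(2)] r by auto
  define d where "d = min d1 d2"
  let ?D = "ball (0::complex) d"
  have d: "d > 0" "?D \<subseteq> ball 0 d1" "?D \<subseteq> ball 0 d2" using d1 d2 by (auto simp: d_def)
  have sub: "?D \<subseteq> ball 0 r" "?D \<subseteq> ball 0 (r / 2)" using d1 d2 r by (auto simp: d_def)
  obtain n :: nat and e k where ek: "\<forall>i<n. e i holomorphic_on ?D \<and> k i holomorphic_on ?D"
    "\<forall>t\<in>?D. \<forall>s\<in>?D. E t s = (\<Sum>i<n. e i t * k i s) \<and> ?Et t s = (\<Sum>i<n. deriv (e i) t * k i s) \<and>
      ?Es t s = (\<Sum>i<n. e i t * deriv (k i) s) \<and> ?Ets t s = (\<Sum>i<n. deriv (e i) t * deriv (k i) s)"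
    using finite_rank_derivs[OF finite_rank_subset[OF E sub(1)] open_ball] by auto
  obtain q :: nat and p l where pl: "\<forall>i<q. p i holomorphic_on ?D \<and> l i holomorphic_on ?D"
    "\<forall>t\<in>?D. \<forall>s\<in>?D. P t s = (\<Sum>i<q. p i t * l i s) \<and> ?Pt t s = (\<Sum>i<q. deriv (p i) t * l i s) \<and>
      ?Ps t s = (\<Sum>i<q. p i t * deriv (l i) s) \<and> ?Pts t s = (\<Sum>i<q. deriv (p i) t * deriv (l i) s)"
    using finite_rank_derivs[OF finite_rank_subset[OF P sub(1)] open_ball] by auto
  show ?thesis
  proof (rule curved_rank_argument[OF d(1), of n e k q p l "\<lambda>t s. \<Sum>i<n. e i t * k i s" "\<lambda>t s. \<Sum>i<n. deriv (e i) t * k i s"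
        "\<lambda>t s. \<Sum>i<n. e i t * deriv (k i) s" "\<lambda>t s. \<Sum>i<n. deriv (e i) t * deriv (k i) s"
        "\<lambda>t s. \<Sum>i<q. p i t * l i s" "\<lambda>t s. \<Sum>i<q. deriv (p i) t * l i s"
        "\<lambda>t s. \<Sum>i<q. p i t * deriv (l i) s" "\<lambda>t s. \<Sum>i<q. deriv (p i) t * deriv (l i) s"])
    fix t s assume t: "t \<in> ?D" and s: "s \<in> ?D"
    note eqs = ek(2)[rule_format, OF t s] pl(2)[rule_format, OF t s]
    show "(\<Sum>i<n. e i t * k i s) \<noteq> 0" using d1(3)[OF subsetD[OF d(2) t] subsetD[OF d(2) s]] eqs by simp
    show "(\<Sum>i<q. p i t * l i s) \<noteq> 0" using d2(3)[OF subsetD[OF d(3) t] subsetD[OF d(3) s]] eqs by simp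
    have "(E t s * ?Ets t s - ?Et t s * ?Es t s) * (P t s)\<^sup>2 = \<beta> * (P t s * ?Pts t s - ?Pt t s * ?Ps t s) * (E t s)\<^sup>2"
      using rel[OF subsetD[OF sub(2) t] subsetD[OF sub(2) s]] by simp
    then show "((\<Sum>i<n. e i t * k i s) * (\<Sum>i<n. deriv (e i) t * deriv (k i) s) - (\<Sum>i<n. deriv (e i) t * k i s) * (\<Sum>i<n. e i t * deriv (k i) s)) * (\<Sum>i<q. p i t * l i s)\<^sup>2
       = \<beta> * ((\<Sum>i<q. p i t * l i s) * (\<Sum>i<q. deriv (p i) t * deriv (l i) s) - (\<Sum>i<q. deriv (p i) t * l i s) * (\<Sum>i<q. p i t * deriv (l i) s)) * (\<Sum>i<n. e i t * k i s)\<^sup>2"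
      using eqs by simp
  next
    have "0 \<in> ?D" using d(1) by simp
    from pl(2)[rule_format, OF this this] Pk[of 0]
    show "(\<Sum>i<q. p i 0 * l i 0) * (\<Sum>i<q. deriv (p i) 0 * deriv (l i) 0) - (\<Sum>i<q. deriv (p i) 0 * l i 0) * (\<Sum>i<q. p i 0 * deriv (l i) 0) \<noteq> 0"
      using r nz(2,3) by simp
  qed (use ek(1) pl(1) in auto)
qed

section \<open>Ambient Hermitian form of a space form\<close>

text \<open>In the models, the space form is the projectivisation of a Hermitian vector space, and
  \<open>tractor\<close> is the Gram matrix of that ambient Hermitian form in the frame given by a local section
  (index \<open>None\<close>) and its derivatives (index \<open>Some a\<close>). The frame moves along a curve with velocity
  \<open>v\<close> by \<open>tractor_connection\<close>, which for a space form is flat, hence holomorphic along holomorphic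
  curves.\<close>

definition tractor_vector :: "('k \<Rightarrow> complex) \<Rightarrow> 'k option \<Rightarrow> complex" where
  "tractor_vector \<theta> x = (case x of None \<Rightarrow> 1 | Some a \<Rightarrow> - \<theta> a)"

definition tractor_block :: "('k \<Rightarrow> 'k \<Rightarrow> complex) \<Rightarrow> 'k option \<Rightarrow> 'k option \<Rightarrow> complex" where
  "tractor_block g x y = (case x of None \<Rightarrow> 0 | Some a \<Rightarrow> (case y of None \<Rightarrow> 0 | Some b \<Rightarrow> g a b))"

text \<open>When \<open>\<theta>\<close> is minus the logarithmic derivative of \<open>p\<close>,
  and \<open>\<kappa> * g\<close> is the antiholomorphic derivative of \<open>-\<theta>\<close>, the
  entries are \<open>p\<close>, its first derivatives and its mixed second derivatives.\<close>

definition tractor :: "complex \<Rightarrow> ('k \<Rightarrow> complex) \<Rightarrow> complex \<Rightarrow> ('k \<Rightarrow> 'k \<Rightarrow> complex) \<Rightarrow> 'k option \<Rightarrow> 'k option \<Rightarrow> complex" where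
  "tractor p \<theta> \<kappa> g x y = p * (tractor_vector \<theta> x * cnj (tractor_vector \<theta> y) + \<kappa> * tractor_block g x y)"

text \<open>The projective change of the connection matrix \<open>\<Gamma>\<close> by the one-form
  \<open>-\<theta>\<close>.\<close>

definition tractor_transport :: "('k::finite \<Rightarrow> complex) \<Rightarrow> ('k \<Rightarrow> 'k \<Rightarrow> complex) \<Rightarrow> ('k \<Rightarrow> complex) \<Rightarrow> 'k \<Rightarrow> 'k \<Rightarrow> complex" where
  "tractor_transport v \<Gamma> \<theta> a c = \<Gamma> a c - \<theta> a * v c - (if c = a then (\<Sum>e\<in>UNIV. v e * \<theta> e) else 0)"

definition tractor_connection :: "('k::finite \<Rightarrow> complex) \<Rightarrow> ('k \<Rightarrow> 'k \<Rightarrow> complex) \<Rightarrow> ('k \<Rightarrow> complex) \<Rightarrow> ('k \<Rightarrow> complex) \<Rightarrow> 'k option \<Rightarrow> 'k option \<Rightarrow> complex" where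
  "tractor_connection v \<Gamma> \<theta> \<delta> x z = (case x of None \<Rightarrow> (case z of None \<Rightarrow> 0 | Some c \<Rightarrow> v c)
     | Some a \<Rightarrow> (case z of None \<Rightarrow> (\<Sum>c\<in>UNIV. tractor_transport v \<Gamma> \<theta> a c * \<theta> c) + (\<Sum>e\<in>UNIV. v e * \<theta> e) * \<theta> a - \<delta> a
         | Some c \<Rightarrow> tractor_transport v \<Gamma> \<theta> a c))"

lemma tractor_simps:
  "tractor_vector \<theta> None = 1" "tractor_vector \<theta> (Some a) = - \<theta> a" "tractor_block g None y = 0" "tractor_block g x None = 0" "tractor_block g (Some a) (Some b) = g a b"
  "tractor_connection v \<Gamma> \<theta> \<delta> None None = 0" "tractor_connection v \<Gamma> \<theta> \<delta> None (Some c) = v c" "tractor_connection v \<Gamma> \<theta> \<delta> (Some a) (Some c) = tractor_transport v \<Gamma> \<theta> a c"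
  "tractor_connection v \<Gamma> \<theta> \<delta> (Some a) None = (\<Sum>c\<in>UNIV. tractor_transport v \<Gamma> \<theta> a c * \<theta> c) + (\<Sum>e\<in>UNIV. v e * \<theta> e) * \<theta> a - \<delta> a"
  by (auto simp: tractor_vector_def tractor_block_def tractor_connection_def split: option.splits)

text \<open>The source of the \<open>n + 1\<close> in \<open>\<beta>\<close>: a multiple of the
  identity of size \<open>CARD('k)\<close> contributes its size, and a term of rank one contributes
  1.\<close>

lemma trace_tractor_connection: "(\<Sum>x\<in>UNIV. tractor_connection v \<Gamma> \<theta> \<delta> x x) =
    (\<Sum>a\<in>(UNIV :: 'k::finite set). \<Gamma> a a) - of_nat (Suc CARD('k)) * (\<Sum>e\<in>UNIV. v e * \<theta> e)"
proof -
  have "tractor_transport v \<Gamma> \<theta> a a = \<Gamma> a a - \<theta> a * v a - (\<Sum>e\<in>UNIV. v e * \<theta> e)" for a by (simp add: tractor_transport_def)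
  then show ?thesis unfolding sum_UNIV_option tractor_simps by (simp only: sum_subtractf) (simp add: algebra_simps)
qed

text \<open>The row \<open>None\<close> says that the section moves in the direction of the
  velocity, and the other rows arise by differentiating once more. The derivative
  \<open>\<delta>\<close> of \<open>\<theta>\<close> may be arbitrary; it is absorbed by the column
  \<open>None\<close>.\<close>

lemma tractor_derivative:
  fixes g :: "complex \<Rightarrow> 'k::finite \<Rightarrow> 'k \<Rightarrow> complex"
  assumes wg: "\<And>a b. \<exists>B. wirtinger (\<lambda>t. g t a b) (\<Sum>c\<in>UNIV. \<Gamma> a c * g t c b) B t"
    and wP: "wirtinger P (- (\<Sum>c\<in>UNIV. v c * \<theta> t c) * P t) pb t"
    and w\<theta>: "\<And>a. wirtinger (\<lambda>t. \<theta> t a) (\<delta> a) (- \<kappa> * (\<Sum>b\<in>UNIV. cnj (v b) * g t a b)) t"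
    and herm: "\<And>a b. cnj (g t a b) = g t b a" and \<kappa>: "cnj \<kappa> = \<kappa>"
  shows "\<exists>B. wirtinger (\<lambda>t. tractor (P t) (\<theta> t) \<kappa> (g t) x y)
    (\<Sum>z\<in>UNIV. tractor_connection v \<Gamma> (\<theta> t) \<delta> x z * tractor (P t) (\<theta> t) \<kappa> (g t) z y) B t"
proof -
  define d1 where "d1 x = (case x of None \<Rightarrow> 0 | Some a \<Rightarrow> - \<delta> a)" for x :: "'k option"
  define b1 where "b1 x = (case x of None \<Rightarrow> 0 | Some a \<Rightarrow> \<kappa> * (\<Sum>b\<in>UNIV. cnj (v b) * g t a b))" for x
  define d2 where "d2 x y = (case x of None \<Rightarrow> 0 | Some a \<Rightarrow> (\<Sum>c\<in>UNIV. \<Gamma> a c * tractor_block (g t) (Some c) y))" for x y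
  have w1: "wirtinger (\<lambda>t. tractor_vector (\<theta> t) x) (d1 x) (b1 x) t" for x
  proof (cases x)
    case (Some a)
    from wirtinger_minus[OF w\<theta>[of a]] show ?thesis unfolding Some by (simp add: tractor_simps d1_def b1_def)
  qed (simp add: tractor_simps d1_def b1_def wirtinger_const)
  have "\<exists>B. wirtinger (\<lambda>t. tractor_block (g t) x y) (d2 x y) B t"
  proof (cases x)
    case None
    then show ?thesis using wirtinger_const[of 0 t] by (auto simp: tractor_simps d2_def)
  next
    case (Some a)
    then show ?thesis using wirtinger_const[of 0 t] wg by (cases y) (auto simp: tractor_simps d2_def)
  qed
  then obtain b2 where w2: "wirtinger (\<lambda>t. tractor_block (g t) x y) (d2 x y) b2 t" by blast
  have cb: "cnj (b1 y) = \<kappa> * (\<Sum>c\<in>UNIV. v c * tractor_block (g t) (Some c) y)"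
    by (cases y) (simp_all add: b1_def tractor_simps \<kappa> herm)
  let ?X = "tractor_vector (\<theta> t) x" and ?Y = "cnj (tractor_vector (\<theta> t) y)" and ?v = "\<Sum>c\<in>UNIV. v c * \<theta> t c"
  let ?g = "\<lambda>c. tractor_block (g t) (Some c) y"
  from wirtinger_mult[OF wP wirtinger_add[OF wirtinger_mult[OF w1[of x] wirtinger_cnj[OF w1[of y]]] wirtinger_cmult[OF w2, of \<kappa>]]]
  have "\<exists>B. wirtinger (\<lambda>t. tractor (P t) (\<theta> t) \<kappa> (g t) x y)
    (- ?v * P t * (?X * ?Y + \<kappa> * tractor_block (g t) x y) + P t * ((d1 x * ?Y + ?X * cnj (b1 y)) + \<kappa> * d2 x y)) B t"
    unfolding tractor_def by blast
  moreover have "- ?v * P t * (?X * ?Y + \<kappa> * tractor_block (g t) x y) + P t * ((d1 x * ?Y + ?X * cnj (b1 y)) + \<kappa> * d2 x y) =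
    (\<Sum>z\<in>UNIV. tractor_connection v \<Gamma> (\<theta> t) \<delta> x z * tractor (P t) (\<theta> t) \<kappa> (g t) z y)"
  proof -
    have lin: "(\<Sum>c\<in>UNIV. f c * tractor (P t) (\<theta> t) \<kappa> (g t) (Some c) y) =
        P t * (- (\<Sum>c\<in>UNIV. f c * \<theta> t c) * ?Y + \<kappa> * (\<Sum>c\<in>UNIV. f c * ?g c))" for f :: "'k \<Rightarrow> complex"
      unfolding tractor_def tractor_simps
      by (simp add: algebra_simps sum.distrib sum_subtractf sum_distrib_left sum_negf)
    show ?thesis
    proof (cases x)
      case None
      show ?thesis unfolding None sum_UNIV_option tractor_simps lin cb
        by (simp add: d1_def d2_def tractor_simps algebra_simps)
    next
      case (Some a)
      have tractor_transport: "(\<Sum>c\<in>UNIV. tractor_transport v \<Gamma> (\<theta> t) a c * ?g c) =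
          (\<Sum>c\<in>UNIV. \<Gamma> a c * ?g c) - \<theta> t a * (\<Sum>c\<in>UNIV. v c * ?g c) - ?v * ?g a"
      proof -
        have "tractor_transport v \<Gamma> (\<theta> t) a c * ?g c = \<Gamma> a c * ?g c - \<theta> t a * (v c * ?g c) - (if c = a then ?v * ?g a else 0)" for c
          by (simp add: tractor_transport_def algebra_simps)
        then show ?thesis by (simp add: sum_subtractf flip: sum_distrib_left)
      qed
      have t0: "tractor (P t) (\<theta> t) \<kappa> (g t) None y = P t * ?Y" by (simp add: tractor_def tractor_simps)
      show ?thesis unfolding Some sum_UNIV_option tractor_simps lin cb tractor_transport t0
        by (simp add: d1_def d2_def algebra_simps)
    qed
  qed
  ultimately show ?thesis by simp
qed

lemma wirtinger_exI: "wirtinger f a b t \<Longrightarrow> b = b' \<Longrightarrow> \<exists>a. wirtinger f a b' t"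
  by blast

lemma wirtinger_chain_holomorphic:
  assumes "wirtinger f a b t" "(q has_field_derivative q') (at (f t))"
  shows "wirtinger (\<lambda>t. q (f t)) (q' * a) (q' * b) t"
  using has_derivative_compose[OF assms(1)[unfolded wirtinger_def], of q "\<lambda>d. q' * d"] assms(2)
  unfolding wirtinger_def has_field_derivative_def by (simp add: algebra_simps mult_commute_abs)

section \<open>Connection matrices along holomorphic curves\<close>

context kaehler_domain
begin

lemma gam_expand: assumes "x \<in> U" shows "gam x v a $ l = (\<Sum>c\<in>UNIV. v $ c * gam x (axis c 1) a $ l)"
proof -
  have 0: "gam x 0 a = 0" using gam_linear(2)[OF assms, of 0 0 a] by simp
  have "gam x (\<Sum>i\<in>I. v $ i *s axis i 1) a $ l = (\<Sum>c\<in>I. v $ c * gam x (axis c 1) a $ l)" for I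
    by (induction I rule: infinite_finite_induct) (simp_all add: 0 gam_linear[OF assms])
  from this[of UNIV] show ?thesis by (simp only: basis_expansion)
qed

lemma curv_expand: assumes "x \<in> U" shows "curv x v a u $ l = (\<Sum>c\<in>UNIV. v $ c * curv x (axis c 1) a u $ l)"
proof -
  have 0: "curv x 0 a u = 0" using curv_linear_left(2)[OF assms, of 0 0 a u] by simp
  have "curv x (\<Sum>i\<in>I. v $ i *s axis i 1) a u $ l = (\<Sum>c\<in>I. v $ c * curv x (axis c 1) a u $ l)" for I
    by (induction I rule: infinite_finite_induct) (simp_all add: 0 curv_linear_left[OF assms])
  from this[of UNIV] show ?thesis by (simp only: basis_expansion)
qed

lemma wirtinger_h_curve:
  assumes "\<gamma> t \<in> U" "(\<gamma> has_derivative (\<lambda>d. d *s v)) (at t)"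
  shows "\<exists>B. wirtinger (\<lambda>t. h (\<gamma> t) (axis a 1) (axis b 1))
    (\<Sum>c\<in>UNIV. gam (\<gamma> t) v (axis a 1) $ c * h (\<gamma> t) (axis c 1) (axis b 1)) B t"
proof -
  from wirtinger_compose[OF h_diff[OF assms(1)] assms(2), of "axis a 1" "axis b 1"]
  show ?thesis unfolding dz_h[OF assms(1)] h_expand_left[OF assms(1), of "gam _ _ _"] by blast
qed

text \<open>The velocity is holomorphic, so the antiholomorphic derivative falls on the connection
  alone and gives \<open>curv\<close>: curvature measures how far the connection matrix is from
  being holomorphic.\<close>

lemma wirtinger_gam_curve:
  fixes v :: "complex \<Rightarrow> complex ^ 'k"
  assumes "\<gamma> t \<in> U" "(\<gamma> has_derivative (\<lambda>d. d *s v t)) (at t)" and v: "\<And>i. \<exists>v'. ((\<lambda>t. v t $ i) has_field_derivative v') (at t)"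
    and D: "open D" "t \<in> D" "\<And>s. s \<in> D \<Longrightarrow> \<gamma> s \<in> U"
  shows "\<exists>A. wirtinger (\<lambda>t. gam (\<gamma> t) (v t) a $ k) A (curv (\<gamma> t) (v t) a (v t) $ k) t"
proof -
  obtain v' where v': "\<And>i. ((\<lambda>t. v t $ i) has_field_derivative v' i) (at t)" using v by metis
  have "wirtinger (\<lambda>t. \<Sum>i\<in>UNIV. v t $ i * gam (\<gamma> t) (axis i 1) a $ k)
    (\<Sum>i\<in>UNIV. v' i * gam (\<gamma> t) (axis i 1) a $ k + v t $ i * dz (\<lambda>x. gam x (axis i 1) a $ k) (\<gamma> t) (v t))
    (\<Sum>i\<in>UNIV. 0 * gam (\<gamma> t) (axis i 1) a $ k + v t $ i * dzb (\<lambda>x. gam x (axis i 1) a $ k) (\<gamma> t) (v t)) t"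
    by (intro wirtinger_sum wirtinger_mult wirtinger_holomorphic v' wirtinger_compose gam_diff assms(1,2))
  moreover have "(\<Sum>i\<in>UNIV. 0 * gam (\<gamma> t) (axis i 1) a $ k + v t $ i * dzb (\<lambda>x. gam x (axis i 1) a $ k) (\<gamma> t) (v t)) =
    curv (\<gamma> t) (v t) a (v t) $ k"
    unfolding curv_expand[OF assms(1), of "v t"] by (simp add: curv_def)
  ultimately have w: "wirtinger (\<lambda>t. \<Sum>i\<in>UNIV. v t $ i * gam (\<gamma> t) (axis i 1) a $ k)
    (\<Sum>i\<in>UNIV. v' i * gam (\<gamma> t) (axis i 1) a $ k + v t $ i * dz (\<lambda>x. gam x (axis i 1) a $ k) (\<gamma> t) (v t))
    (curv (\<gamma> t) (v t) a (v t) $ k) t" by simp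
  show ?thesis
    by (rule exI, rule wirtinger_cong[OF w D(1,2)], rule gam_expand[symmetric], rule D(3))
qed

text \<open>The holomorphic logarithmic derivative of the determinant of the metric, by Jacobi's
  formula and \<open>\<tau>_contract\<close>.\<close>

definition \<tau> :: "complex ^ 'k \<Rightarrow> 'k \<Rightarrow> complex" where
  "\<tau> x a = (\<Sum>l\<in>UNIV. gam x (axis l 1) (axis a 1) $ l)"

lemma \<tau>_smooth: "smooth_on U (\<lambda>x. \<tau> x a)"
  unfolding \<tau>_def by (intro smooth_on_sum open_U gam_smooth finite)

lemma \<tau>_contract: assumes "x \<in> U" shows "(\<Sum>a\<in>UNIV. v $ a * \<tau> x a) = (\<Sum>l\<in>UNIV. gam x v (axis l 1) $ l)"
proof -
  have "(\<Sum>a\<in>UNIV. v $ a * \<tau> x a) = (\<Sum>l\<in>UNIV. \<Sum>a\<in>UNIV. v $ a * gam x (axis a 1) (axis l 1) $ l)"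
    unfolding \<tau>_def sum_distrib_left by (subst sum.swap) (simp add: gam_commute[OF assms, of "axis _ 1" "axis _ 1"])
  then show ?thesis by (simp add: gam_expand[OF assms, of v])
qed

lemma dzb_\<tau>: assumes "x \<in> U" shows "dzb (\<lambda>x. \<tau> x a) x u = (\<Sum>l\<in>UNIV. curv x (axis l 1) (axis a 1) u $ l)"
proof -
  have "dzb (\<lambda>x. \<tau> x a) x u = (\<Sum>l\<in>UNIV. 1 * dzb (\<lambda>x. gam x (axis l 1) (axis a 1) $ l) x u)"
    by (rule dz_sum(2)[OF open_U assms gam_diff[OF assms] smooth_onD(1)[OF \<tau>_smooth assms]]) (simp add: \<tau>_def)
  then show ?thesis by (simp add: curv_def)
qed

end

context kaehler_space_form
begin

text \<open>The trace of \<open>curv_space_form\<close>: one of its two summands contributes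
  \<open>CARD('k)\<close> times, the other once.\<close>

lemma dzb_\<tau>_space_form: assumes x: "x \<in> U" and u: "G x u u \<noteq> 0"
  shows "dzb (\<lambda>x. \<tau> x a) x u = - of_real (c / 2) * of_nat (Suc CARD('k)) * h x (axis a 1) u"
proof -
  have "curv x (axis l 1) (axis a 1) u $ l = - of_real (c / 2) * (if l = a then h x (axis a 1) u else 0) - of_real (c / 2) * h x (axis a 1) u" for l
    unfolding curv_space_form[OF x u] by (simp add: axis_def)
  then have "dzb (\<lambda>x. \<tau> x a) x u = (\<Sum>l\<in>UNIV. (if l = a then - of_real (c / 2) * h x (axis a 1) u else 0) - of_real (c / 2) * h x (axis a 1) u)"
    unfolding dzb_\<tau>[OF x] by (intro sum.cong) auto
  also have "\<dots> = - of_real (c / 2) * h x (axis a 1) u - of_nat CARD('k) * (of_real (c / 2) * h x (axis a 1) u)"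
    by (simp only: sum_subtractf) simp
  finally show ?thesis unfolding of_nat_Suc by algebra
qed

text \<open>The metric volume gives the potential: \<open>P\<close> is a power of the determinant of the metric.\<close>

lemma curve_data:
  fixes \<gamma> :: "complex \<Rightarrow> complex ^ 'k" and v :: "complex \<Rightarrow> complex ^ 'k"
  defines "g \<equiv> \<lambda>t a b. h (\<gamma> t) (axis a 1) (axis b 1)"
    and "\<theta> \<equiv> \<lambda>t a. \<tau> (\<gamma> t) a / of_nat (Suc CARD('k))"
    and "\<Gamma> \<equiv> \<lambda>t a e. gam (\<gamma> t) (v t) (axis a 1) $ e"
  assumes \<gamma>: "\<And>t. t \<in> ball 0 r \<Longrightarrow> \<gamma> t \<in> U" "\<And>t. t \<in> ball 0 r \<Longrightarrow> (\<gamma> has_derivative (\<lambda>d. d *s v t)) (at t)"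
    and v: "\<And>i. (\<lambda>t. v t $ i) holomorphic_on ball 0 r"
    and nonnull: "\<And>t. t \<in> ball 0 r \<Longrightarrow> G (\<gamma> t) (v t) (v t) \<noteq> 0"
  shows "\<exists>P \<delta>. (\<forall>t\<in>ball 0 r. P t \<noteq> 0 \<and> cnj (P t) = P t \<and>
      (\<exists>B. wirtinger P (- (\<Sum>e\<in>UNIV. v t $ e * \<theta> t e) * P t) B t) \<and>
      (\<forall>a. wirtinger (\<lambda>t. \<theta> t a) (\<delta> t a) (- of_real (c / 2) * (\<Sum>b\<in>UNIV. cnj (v t $ b) * g t a b)) t)) \<and>
      (\<forall>x z. (\<lambda>t. tractor_connection (\<lambda>e. v t $ e) (\<Gamma> t) (\<theta> t) (\<delta> t) x z) holomorphic_on ball 0 r)"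
proof -
  \<comment> \<open>Dimension plus one. Dividing the trace \<open>\<tau>\<close> by it normalises
    the antiholomorphic derivative of \<open>\<theta>\<close> to \<open>-\<kappa>\<close> times the
    metric, with \<open>\<kappa> = c / 2\<close>.\<close>
  define m where "m = (of_nat (Suc CARD('k)) :: complex)"
  have m: "m \<noteq> 0" "cnj m = m" unfolding m_def by (simp_all del: of_nat_Suc)
  define \<kappa> where "\<kappa> = complex_of_real (c / 2)"
  have hv: "h (\<gamma> t) w (v t) = (\<Sum>e\<in>UNIV. w $ e * (\<Sum>b\<in>UNIV. cnj (v t $ b) * g t e b))" if "t \<in> ball 0 r" for t w
    unfolding g_def h_expand_right[OF \<gamma>(1)[OF that], of _ "v t", symmetric] by (rule h_expand_left[OF \<gamma>(1)[OF that]])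
  have hax: "(\<Sum>b\<in>UNIV. cnj (v t $ b) * g t e b) = h (\<gamma> t) (axis e 1) (v t)" if "t \<in> ball 0 r" for t e
    unfolding g_def by (rule h_expand_right[OF \<gamma>(1)[OF that], symmetric])
  define \<delta> where "\<delta> t a = dz (\<lambda>x. \<tau> x a) (\<gamma> t) (v t) / m" for t a
  have w\<theta>: "wirtinger (\<lambda>t. \<theta> t a) (\<delta> t a) (- \<kappa> * h (\<gamma> t) (axis a 1) (v t)) t" if t: "t \<in> ball 0 r" for t a
  proof -
    from wirtinger_cmult[OF wirtinger_compose[OF smooth_onD(1)[OF \<tau>_smooth \<gamma>(1)[OF t]] \<gamma>(2)[OF t]], of "1 / m" a]
    show ?thesis
      unfolding dzb_\<tau>_space_form[OF \<gamma>(1)[OF t] nonnull[OF t]] \<theta>_def \<delta>_def m_def[symmetric] \<kappa>_def[symmetric]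
      using m by simp
  qed
  have w\<delta>: "\<exists>A. wirtinger (\<lambda>t. \<delta> t a) A (- \<kappa> * h (\<gamma> t) (gam (\<gamma> t) (v t) (axis a 1)) (v t)) t" if t: "t \<in> ball 0 r" for t a
  proof -
    have dv: "((\<lambda>t. v t $ i) has_field_derivative deriv (\<lambda>t. v t $ i) t) (at t)" for i
      using v[of i] t by (intro holomorphic_derivI[OF _ open_ball])
    note sm = smooth_on_dz(1)[OF open_U \<tau>_smooth]
    have f1: "wirtinger (\<lambda>t. 1 / m * (\<Sum>i\<in>UNIV. v t $ i * dz (\<lambda>x. \<tau> x a) (\<gamma> t) (axis i 1)))
      (1 / m * (\<Sum>i\<in>UNIV. deriv (\<lambda>t. v t $ i) t * dz (\<lambda>x. \<tau> x a) (\<gamma> t) (axis i 1) + v t $ i * dz (\<lambda>x. dz (\<lambda>x. \<tau> x a) x (axis i 1)) (\<gamma> t) (v t)))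
      (1 / m * (\<Sum>i\<in>UNIV. 0 * dz (\<lambda>x. \<tau> x a) (\<gamma> t) (axis i 1) + v t $ i * dzb (\<lambda>x. dz (\<lambda>x. \<tau> x a) x (axis i 1)) (\<gamma> t) (v t))) t"
      by (intro wirtinger_cmult wirtinger_sum wirtinger_mult wirtinger_holomorphic dv
          wirtinger_compose[OF smooth_onD(1)[OF sm \<gamma>(1)[OF t]] \<gamma>(2)[OF t]])
    have e1: "dzb (\<lambda>x. dz (\<lambda>x. \<tau> x a) x (axis i 1)) (\<gamma> t) (v t) = - \<kappa> * m * h (\<gamma> t) (gam (\<gamma> t) (axis i 1) (axis a 1)) (v t)" for i
    proof -
      \<comment> \<open>The formula for \<open>dzb\<close> of \<open>\<tau>\<close> requires a
        nonnull direction. For the fixed vector \<open>v t\<close> this persists near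
        \<open>\<gamma> t\<close>, so the formula may be differentiated there.\<close>
      define V where "V = U \<inter> (\<lambda>x. G x (v t) (v t)) -` (- {0})"
      have V: "open V" "\<gamma> t \<in> V" unfolding V_def
        using smooth_onD(3)[OF G_smooth] open_U \<gamma>(1)[OF t] nonnull[OF t] by (auto intro: continuous_open_preimage)
      have "dzb (\<lambda>x. dz (\<lambda>x. \<tau> x a) x (axis i 1)) (\<gamma> t) (v t) = dz (\<lambda>x. dzb (\<lambda>x. \<tau> x a) x (v t)) (\<gamma> t) (axis i 1)"
        by (rule dz_commute(2)[OF open_U \<tau>_smooth \<gamma>(1)[OF t]])
      also have "\<dots> = (\<Sum>j\<in>{()}. (- \<kappa> * m) * dz (\<lambda>x. h x (axis a 1) (v t)) (\<gamma> t) (axis i 1))"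
        by (rule dz_sum(1)[OF V h_diff[OF \<gamma>(1)[OF t]] smooth_onD(1)[OF smooth_on_dz(2)[OF open_U \<tau>_smooth] \<gamma>(1)[OF t]]])
          (auto simp: V_def dzb_\<tau>_space_form m_def \<kappa>_def)
      finally show ?thesis by (simp add: dz_h \<gamma>(1)[OF t])
    qed
    have e2: "(1 / m * (\<Sum>i\<in>UNIV. 0 * dz (\<lambda>x. \<tau> x a) (\<gamma> t) (axis i 1) + v t $ i * (- \<kappa> * m * h (\<gamma> t) (gam (\<gamma> t) (axis i 1) (axis a 1)) (v t))))
      = - \<kappa> * h (\<gamma> t) (gam (\<gamma> t) (v t) (axis a 1)) (v t)"
    proof -
      have "h (\<gamma> t) (gam (\<gamma> t) (v t) (axis a 1)) (v t) = cnj (dzb (\<lambda>y. h y (v t) (axis a 1)) (\<gamma> t) (v t))"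
        by (simp add: dzb_h h_cnj \<gamma>(1)[OF t])
      also have "\<dots> = (\<Sum>i\<in>UNIV. v t $ i * h (\<gamma> t) (gam (\<gamma> t) (axis i 1) (axis a 1)) (v t))"
        unfolding dz_sum_axis(2)[OF h_diff[OF \<gamma>(1)[OF t]], of _ _ "v t"] by (simp add: dzb_h h_cnj \<gamma>(1)[OF t])
      finally have "- \<kappa> * h (\<gamma> t) (gam (\<gamma> t) (v t) (axis a 1)) (v t) =
         (\<Sum>i\<in>UNIV. 1 / m * (v t $ i * (- \<kappa> * m * h (\<gamma> t) (gam (\<gamma> t) (axis i 1) (axis a 1)) (v t))))"
        using m(1) by (simp add: sum_distrib_left mult_ac flip: sum_negf)
      then show ?thesis by (simp only: sum_distrib_left mult_zero_left add_0)
    qed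
    note w = f1[unfolded e1 e2]
    show ?thesis
      by (rule exI, rule wirtinger_cong[OF w open_ball t])
        (simp add: \<delta>_def dz_sum_axis(1)[OF smooth_onD(1)[OF \<tau>_smooth \<gamma>(1)], of _ _ "v _"])
  qed
  define \<Delta> where "\<Delta> t = det (\<chi> a b. g t a b)" for t
  have \<Delta>0: "\<Delta> t \<noteq> 0" "cnj (\<Delta> t) = \<Delta> t" if t: "t \<in> ball 0 r" for t
  proof -
    have tr: "transpose (\<chi> a b. g t a b) = gram (\<gamma> t)" by (simp add: transpose_def gram_def g_def)
    then show "\<Delta> t \<noteq> 0" using det_gram[OF \<gamma>(1)[OF t]] det_transpose[of "\<chi> a b. g t a b"] by (simp add: \<Delta>_def)
    have "cnj (\<Delta> t) = det (transpose (\<chi> a b. g t a b))"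
      unfolding \<Delta>_def det_def transpose_def by (simp add: g_def h_cnj \<gamma>(1)[OF t])
    then show "cnj (\<Delta> t) = \<Delta> t" by (simp add: \<Delta>_def)
  qed
  \<comment> \<open>The determinant is real but possibly negative. Its square is positive, so
    \<open>Ln\<close> is differentiable there, and \<open>P\<close> below is the power
    \<open>-1 / m\<close> of the absolute value of the determinant.\<close>
  define s where "s t = \<Delta> t * \<Delta> t" for t
  have s: "s t = of_real ((Re (\<Delta> t))\<^sup>2)" "Re (\<Delta> t) \<noteq> 0" if t: "t \<in> ball 0 r" for t
    using \<Delta>0[OF t] by (auto simp: s_def complex_eq_iff power2_eq_square)
  define P where "P t = exp (- 1 / (2 * m) * Ln (s t))" for t
  have P: "P t \<noteq> 0" "cnj (P t) = P t" if t: "t \<in> ball 0 r" for t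
  proof -
    show "P t \<noteq> 0" by (simp add: P_def)
    have "Ln (s t) = of_real (ln ((Re (\<Delta> t))\<^sup>2))" unfolding s(1)[OF t] using s(2)[OF t] by (intro Ln_of_real) simp
    then show "cnj (P t) = P t" by (simp add: P_def exp_cnj m)
  qed
  have wP: "\<exists>B. wirtinger P (- (\<Sum>e\<in>UNIV. v t $ e * \<theta> t e) * P t) B t" if t: "t \<in> ball 0 r" for t
  proof -
    have tr: "(\<Sum>a\<in>UNIV. \<Gamma> t a a) = m * (\<Sum>e\<in>UNIV. v t $ e * \<theta> t e)"
      using \<tau>_contract[OF \<gamma>(1)[OF t], of "v t"] m unfolding \<Gamma>_def \<theta>_def m_def[symmetric] by (simp flip: sum_divide_distrib)
    have "\<exists>B. wirtinger (\<lambda>t. g t a b) (\<Sum>e\<in>UNIV. \<Gamma> t a e * g t e b) B t" for a b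
      unfolding g_def \<Gamma>_def by (rule wirtinger_h_curve[OF \<gamma>(1)[OF t] \<gamma>(2)[OF t]])
    then obtain B where "\<And>a b. wirtinger (\<lambda>t. g t a b) (\<Sum>e\<in>UNIV. \<Gamma> t a e * g t e b) (B a b) t" by metis
    then have "\<exists>b. wirtinger \<Delta> ((\<Sum>a\<in>UNIV. \<Gamma> t a a) * \<Delta> t) b t"
      unfolding \<Delta>_def by (intro wirtinger_det[where B = B]) simp
    then obtain b where w\<Delta>: "wirtinger \<Delta> ((\<Sum>a\<in>UNIV. \<Gamma> t a a) * \<Delta> t) b t" by (elim exE)
    have "s t \<notin> \<real>\<^sub>\<le>\<^sub>0" unfolding s(1)[OF t] using s(2)[OF t] by (simp add: complex_nonpos_Reals_iff)
    then have "((\<lambda>z. exp (- 1 / (2 * m) * Ln z)) has_field_derivative P t * (- 1 / (2 * m) * inverse (s t))) (at (s t))"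
      unfolding P_def using m(1) by (auto intro!: derivative_eq_intros simp: field_simps)
    from wirtinger_chain_holomorphic[OF wirtinger_mult[OF w\<Delta> w\<Delta>, folded s_def] this]
    have "\<exists>B. wirtinger P (P t * (- 1 / (2 * m) * inverse (s t)) * ((\<Sum>a\<in>UNIV. \<Gamma> t a a) * \<Delta> t * \<Delta> t + \<Delta> t * ((\<Sum>a\<in>UNIV. \<Gamma> t a a) * \<Delta> t))) B t"
      unfolding P_def[abs_def] by (rule exI)
    moreover have "P t * (- 1 / (2 * m) * inverse (s t)) * ((\<Sum>a\<in>UNIV. \<Gamma> t a a) * \<Delta> t * \<Delta> t + \<Delta> t * ((\<Sum>a\<in>UNIV. \<Gamma> t a a) * \<Delta> t))
      = - (\<Sum>e\<in>UNIV. v t $ e * \<theta> t e) * P t"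
      unfolding tr using \<Delta>0(1)[OF t] m by (simp add: s_def field_simps)
    ultimately show ?thesis by simp
  qed
  \<comment> \<open>Every entry has antiholomorphic derivative zero: the curvature of
    \<open>\<Gamma>\<close> is compensated by the derivatives of \<open>\<theta>\<close> and
    \<open>\<delta>\<close>. Constant holomorphic curvature is what makes these match.\<close>
  have hol: "(\<lambda>t. tractor_connection (\<lambda>e. v t $ e) (\<Gamma> t) (\<theta> t) (\<delta> t) x z) holomorphic_on ball 0 r" for x z
    unfolding holomorphic_on_open[OF open_ball]
  proof (intro ballI)
    fix t :: complex assume t: "t \<in> ball 0 r"
    let ?h = "h (\<gamma> t)" and ?v = "v t"
    have wv: "wirtinger (\<lambda>t. v t $ i) (deriv (\<lambda>t. v t $ i) t) 0 t" for i
      using v[of i] t by (intro wirtinger_holomorphic holomorphic_derivI[OF _ open_ball])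
    have w\<theta>v: "\<exists>A. wirtinger (\<lambda>t. \<Sum>e\<in>UNIV. v t $ e * \<theta> t e) A (- \<kappa> * ?h ?v ?v) t"
    proof -
      have "wirtinger (\<lambda>t. \<Sum>e\<in>UNIV. v t $ e * \<theta> t e) (\<Sum>e\<in>UNIV. deriv (\<lambda>t. v t $ e) t * \<theta> t e + ?v $ e * \<delta> t e)
        (\<Sum>e\<in>UNIV. 0 * \<theta> t e + ?v $ e * (- \<kappa> * ?h (axis e 1) ?v)) t"
        by (intro wirtinger_sum wirtinger_mult wv w\<theta>[OF t])
      moreover have "(\<Sum>e\<in>UNIV. 0 * \<theta> t e + ?v $ e * (- \<kappa> * ?h (axis e 1) ?v)) = - \<kappa> * ?h ?v ?v"
        unfolding h_expand_left[OF \<gamma>(1)[OF t], of ?v ?v] by (simp add: sum_distrib_left sum_negf mult_ac)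
      ultimately show ?thesis by (intro exI) (simp only:)
    qed
    then obtain A0 where A0: "wirtinger (\<lambda>t. \<Sum>e\<in>UNIV. v t $ e * \<theta> t e) A0 (- \<kappa> * ?h ?v ?v) t" by blast
    have wtw: "\<exists>A. wirtinger (\<lambda>t. tractor_transport (\<lambda>e. v t $ e) (\<Gamma> t) (\<theta> t) a e) A 0 t" for a e
    proof -
      have dv: "\<exists>v'. ((\<lambda>t. v t $ i) has_field_derivative v') (at t)" for i
        using holomorphic_derivI[OF v[of i] open_ball t] by blast
      have "\<exists>A1. wirtinger (\<lambda>t. \<Gamma> t a e) A1 (curv (\<gamma> t) ?v (axis a 1) ?v $ e) t"
        unfolding \<Gamma>_def
        by (rule wirtinger_gam_curve[where \<gamma> = \<gamma> and v = v and t = t and a = "axis a 1" and k = e, OF \<gamma>(1)[OF t] \<gamma>(2)[OF t] dv open_ball t \<gamma>(1)])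
      then obtain A1 where "wirtinger (\<lambda>t. \<Gamma> t a e) A1 (curv (\<gamma> t) ?v (axis a 1) ?v $ e) t" by (elim exE)
      note w1 = this[unfolded curv_space_form[OF \<gamma>(1)[OF t] nonnull[OF t]], folded \<kappa>_def]
      have w3: "wirtinger (\<lambda>t. if e = a then (\<Sum>e\<in>UNIV. v t $ e * \<theta> t e) else 0) (if e = a then A0 else 0) (if e = a then - \<kappa> * ?h ?v ?v else 0) t"
        using A0 wirtinger_const[of 0 t] by simp
      from wirtinger_diff[OF wirtinger_diff[OF w1 wirtinger_mult[OF w\<theta>[OF t, of a] wv[of e]]] w3]
      have "\<exists>A. wirtinger (\<lambda>t. \<Gamma> t a e - \<theta> t a * v t $ e - (if e = a then (\<Sum>e\<in>UNIV. v t $ e * \<theta> t e) else 0)) A 0 t"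
          by (rule wirtinger_exI) (simp add: axis_def algebra_simps)
      then show ?thesis unfolding tractor_transport_def .
    qed
    then obtain A2 where A2: "\<And>a e. wirtinger (\<lambda>t. tractor_transport (\<lambda>e. v t $ e) (\<Gamma> t) (\<theta> t) a e) (A2 a e) 0 t" by metis
    have "\<exists>A. wirtinger (\<lambda>t. tractor_connection (\<lambda>e. v t $ e) (\<Gamma> t) (\<theta> t) (\<delta> t) x z) A 0 t"
    proof (cases x)
      case None
      then show ?thesis using wirtinger_exI[OF wv refl] wirtinger_exI[OF wirtinger_const[of 0 t] refl] by (cases z) (simp_all add: tractor_simps)
    next
      case (Some a)
      show ?thesis
      proof (cases z)
        case (Some e)
        show ?thesis unfolding \<open>x = Some a\<close> Some tractor_simps by (rule exI, rule A2)
      next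
        case None
        obtain A3 where A3: "wirtinger (\<lambda>t. \<delta> t a) A3 (- \<kappa> * ?h (gam (\<gamma> t) ?v (axis a 1)) ?v) t" using w\<delta>[OF t] by blast
        have ws: "wirtinger (\<lambda>t. \<Sum>e\<in>UNIV. tractor_transport (\<lambda>e. v t $ e) (\<Gamma> t) (\<theta> t) a e * \<theta> t e)
          (\<Sum>e\<in>UNIV. A2 a e * \<theta> t e + tractor_transport (\<lambda>e. v t $ e) (\<Gamma> t) (\<theta> t) a e * \<delta> t e)
          (\<Sum>e\<in>UNIV. 0 * \<theta> t e + tractor_transport (\<lambda>e. v t $ e) (\<Gamma> t) (\<theta> t) a e * (- \<kappa> * ?h (axis e 1) ?v)) t"
          by (intro wirtinger_sum wirtinger_mult A2 w\<theta>[OF t])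
        have "(\<Sum>e\<in>UNIV. tractor_transport (\<lambda>e. v t $ e) (\<Gamma> t) (\<theta> t) a e * ?h (axis e 1) ?v) =
          ?h (gam (\<gamma> t) ?v (axis a 1)) ?v - \<theta> t a * ?h ?v ?v - (\<Sum>e\<in>UNIV. ?v $ e * \<theta> t e) * ?h (axis a 1) ?v"
        proof -
          have "tractor_transport (\<lambda>e. v t $ e) (\<Gamma> t) (\<theta> t) a e * ?h (axis e 1) ?v = gam (\<gamma> t) ?v (axis a 1) $ e * ?h (axis e 1) ?v
            - \<theta> t a * (?v $ e * ?h (axis e 1) ?v) - (if e = a then (\<Sum>e\<in>UNIV. ?v $ e * \<theta> t e) * ?h (axis a 1) ?v else 0)" for e
            by (simp add: tractor_transport_def \<Gamma>_def algebra_simps)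
          then show ?thesis
            unfolding h_expand_left[OF \<gamma>(1)[OF t], of "gam (\<gamma> t) ?v (axis a 1)" ?v] h_expand_left[OF \<gamma>(1)[OF t], of ?v ?v]
            by (simp add: sum_subtractf flip: sum_distrib_left)
        qed
        note tw_h = this
        have "(\<Sum>e\<in>UNIV. 0 * \<theta> t e + tractor_transport (\<lambda>e. v t $ e) (\<Gamma> t) (\<theta> t) a e * (- \<kappa> * ?h (axis e 1) ?v)) =
          - \<kappa> * (\<Sum>e\<in>UNIV. tractor_transport (\<lambda>e. v t $ e) (\<Gamma> t) (\<theta> t) a e * ?h (axis e 1) ?v)"
          unfolding sum_distrib_left by (intro sum.cong refl) (simp only: mult_zero_left add_0 mult.left_commute)
        note ws' = ws[unfolded this tw_h]
        from wirtinger_diff[OF wirtinger_add[OF ws' wirtinger_mult[OF A0 w\<theta>[OF t, of a]]] A3]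
        have "\<exists>A. wirtinger (\<lambda>t. (\<Sum>c\<in>UNIV. tractor_transport (\<lambda>e. v t $ e) (\<Gamma> t) (\<theta> t) a c * \<theta> t c) + (\<Sum>e\<in>UNIV. v t $ e * \<theta> t e) * \<theta> t a - \<delta> t a) A 0 t"
          by (rule wirtinger_exI) (simp add: algebra_simps)
        then show ?thesis unfolding \<open>x = Some a\<close> None tractor_simps .
      qed
    qed
    then show "\<exists>f'. ((\<lambda>t. tractor_connection (\<lambda>e. v t $ e) (\<Gamma> t) (\<theta> t) (\<delta> t) x z) has_field_derivative f') (at t)"
      using wirtinger_holomorphicD by blast
  qed
  show ?thesis
    by (intro exI[of _ P] exI[of _ \<delta>] conjI ballI allI P wP hol)
      (use w\<theta> in \<open>simp_all only: hax \<kappa>_def\<close>)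
qed

end

section \<open>Holomorphic maps along complex lines\<close>

lemma complex_linear_scale:
  fixes D :: "complex ^ 'n \<Rightarrow> complex ^ 'm"
  assumes "linear D" "\<And>v. D (J v) = J (D v)"
  shows "D (d *s v) = d *s D v"
  unfolding scale_eq_real_combination[of d v] scale_eq_real_combination[of d "D v"]
  by (simp add: linear_add[OF assms(1)] linear_scale[OF assms(1)] assms(2))

lemma has_derivative_holomorphic_curve:
  fixes f :: "complex ^ 'n::finite \<Rightarrow> complex ^ 'm::finite"
  assumes "(f has_derivative D) (at (\<gamma> t))" "\<And>v. D (J v) = J (D v)" "(\<gamma> has_derivative (\<lambda>d. d *s v)) (at t)"
  shows "((\<lambda>t. f (\<gamma> t)) has_derivative (\<lambda>d. d *s D v)) (at t)"
  using has_derivative_compose[OF assms(3,1)]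
  by (simp add: complex_linear_scale[OF has_derivative_linear[OF assms(1)] assms(2)])

lemma has_field_derivative_vec_nth:
  fixes f :: "complex \<Rightarrow> complex ^ 'm::finite"
  assumes "(f has_derivative (\<lambda>d. d *s v)) (at t)"
  shows "((\<lambda>t. f t $ k) has_field_derivative v $ k) (at t)"
  using bounded_linear.has_derivative[OF bounded_linear_vec_nth assms, of k]
  by (simp add: has_field_derivative_def mult_commute_abs)

text \<open>Cauchy's inequality on circles of radius \<open>R / 4\<close> bounds the second
  derivative on the half disc by \<open>2 * B\<close> over the square of \<open>R / 4\<close>, which
  is the stated constant; Taylor's formula does the rest.\<close>

lemma difference_quotient_bound:
  fixes f :: "complex \<Rightarrow> complex"
  assumes R: "R > 0" and f: "f holomorphic_on ball 0 R" and B: "\<And>z. z \<in> ball 0 R \<Longrightarrow> norm (f z) \<le> B"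
    and e: "e \<noteq> 0" "norm e < R / 2"
  shows "norm ((f e - f 0) / e - deriv f 0) \<le> 8 * B / R\<^sup>2 * norm e * 4"
proof -
  have "norm ((deriv ^^ 2) f z) \<le> fact 2 * B / (R / 4) ^ 2" if z: "z \<in> ball 0 (R / 2)" for z
  proof (rule Cauchy_inequality)
    have sub: "cball z (R / 4) \<subseteq> ball 0 R"
    proof
      fix w assume "w \<in> cball z (R / 4)"
      then have "norm w \<le> norm z + R / 4" using norm_triangle_ineq2[of w z] by (simp add: dist_norm norm_minus_commute)
      then show "w \<in> ball 0 R" using z R by simp
    qed
    show "continuous_on (cball z (R / 4)) f" using holomorphic_on_imp_continuous_on[OF holomorphic_on_subset[OF f sub]] .
    show "f holomorphic_on ball z (R / 4)" using holomorphic_on_subset[OF f] sub by force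
    show "0 < R / 4" using R by simp
    show "norm (f w) \<le> B" if "norm (z - w) = R / 4" for w using B[of w] sub that by (auto simp: dist_norm subset_iff)
  qed
  then have "cmod ((deriv ^^ 0) f e - (\<Sum>i\<le>1. (deriv ^^ i) f 0 * (e - 0) ^ i / fact i))
      \<le> (fact 2 * B / (R / 4) ^ 2) * cmod (e - 0) ^ Suc 1 / fact 1"
  proof (intro complex_Taylor[of "ball 0 (R / 2)"])
    fix i :: nat and z :: complex assume "z \<in> ball 0 (R / 2)"
    then have "z \<in> ball 0 R" using R by auto
    from has_field_derivative_higher_deriv[OF f open_ball this, of i]
    show "((deriv ^^ i) f has_field_derivative (deriv ^^ Suc i) f z) (at z within ball 0 (R / 2))"
      by (rule has_field_derivative_at_within)
  qed (use R e in \<open>auto simp: numeral_2_eq_2\<close>)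
  then have "norm (f e - f 0 - deriv f 0 * e) \<le> (8 * B / R\<^sup>2 * 4) * (norm e)\<^sup>2"
    by (simp add: power2_eq_square field_simps)
  note le = this
  have eq: "(f e - f 0) / e - deriv f 0 = (f e - f 0 - deriv f 0 * e) / e" using e by (simp add: field_simps)
  have "norm ((f e - f 0) / e - deriv f 0) \<le> (8 * B / R\<^sup>2 * 4) * (norm e)\<^sup>2 / norm e"
    unfolding eq norm_divide by (rule divide_right_mono[OF le]) simp
  then show ?thesis using e by (simp add: power2_eq_square mult_ac)
qed

text \<open>Only one complex derivative is assumed; that it is again holomorphic along lines follows by
  realising it as a locally uniform limit of difference quotients.\<close>

lemma holomorphic_directional:
  fixes f :: "complex ^ 'n::finite \<Rightarrow> complex ^ 'm::finite" and D :: "complex ^ 'n \<Rightarrow> complex ^ 'n \<Rightarrow> complex ^ 'm"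
  assumes U: "open U" "p \<in> U" and f: "\<And>x. x \<in> U \<Longrightarrow> (f has_derivative D x) (at x)"
    and J: "\<And>x v. x \<in> U \<Longrightarrow> D x (J v) = J (D x v)"
  shows "\<exists>r>0. (\<forall>t\<in>ball 0 r. p + t *s v \<in> U) \<and> (\<lambda>t. D (p + t *s v) a $ k) holomorphic_on ball 0 r"
proof -
  obtain e where e: "e > 0" "ball p e \<subseteq> U" using U open_contains_ball by blast
  obtain K1 where K1: "K1 > 0" "\<And>t. norm (t *s v) \<le> norm t * K1"
    using bounded_linear.pos_bounded[OF bounded_linear_scale_vec[of v]] by blast
  obtain K2 where K2: "K2 > 0" "\<And>t. norm (t *s a) \<le> norm t * K2"
    using bounded_linear.pos_bounded[OF bounded_linear_scale_vec[of a]] by blast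
  \<comment> \<open>Small enough for \<open>p + t *s v + z *s a\<close> to stay in the ball of
    radius \<open>e\<close> when \<open>t\<close> and \<open>z\<close> have norm at most
    \<open>R\<close>.\<close>
  define R where "R = e / (2 * (K1 + K2))"
  have "R * (K1 + K2) = e / 2" using K1(1) K2(1) by (simp add: R_def divide_simps)
  then have R: "R * (K1 + K2) < e" using e(1) by linarith
  have R: "R > 0" "R * (K1 + K2) < e" using e(1) K1(1) K2(1) by (simp add: R_def) (rule R)
  have inU: "p + t *s v + z *s a \<in> U" if "norm t \<le> R" "norm z \<le> R" for t z
  proof -
    have "norm (t *s v + z *s a) \<le> norm t * K1 + norm z * K2"
      using norm_triangle_ineq[of "t *s v" "z *s a"] K1(2)[of t] K2(2)[of z] by linarith
    also have "\<dots> \<le> R * K1 + R * K2" using that K1 K2 by (intro add_mono mult_right_mono) auto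
    also have "\<dots> < e" using R by (simp add: distrib_left)
    finally have "p + t *s v + z *s a \<in> ball p e" by (simp add: dist_norm norm_minus_commute add_ac)
    then show ?thesis using e by blast
  qed
  define F where "F t z = f (p + t *s v + z *s a) $ k" for t z
  have Ft: "((\<lambda>t. F t z) has_field_derivative D (p + t *s v + z *s a) v $ k) (at t)" if "norm t \<le> R" "norm z \<le> R" for t z
  proof -
    have "((\<lambda>t. (p + z *s a) + t *s v) has_derivative (\<lambda>d. d *s v)) (at t)" by (rule has_derivative_line)
    then have "((\<lambda>t. p + t *s v + z *s a) has_derivative (\<lambda>d. d *s v)) (at t)" by (simp add: add_ac)
    from has_field_derivative_vec_nth[OF has_derivative_holomorphic_curve[OF f[OF inU[OF that]] J[OF inU[OF that]] this]]
    show ?thesis unfolding F_def .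
  qed
  have Fz: "((\<lambda>z. F t z) has_field_derivative D (p + t *s v + z *s a) a $ k) (at z)" if "norm t \<le> R" "norm z \<le> R" for t z
    unfolding F_def
    by (rule has_field_derivative_vec_nth[OF has_derivative_holomorphic_curve[OF f[OF inU[OF that]] J[OF inU[OF that]] has_derivative_line]])
  \<comment> \<open>One bound for \<open>F\<close> on the closed bidisc makes the estimate of the
    difference quotients uniform in \<open>t\<close>.\<close>
  have "compact ((\<lambda>q. F (fst q) (snd q)) ` (cball 0 R \<times> cball 0 R))"
  proof (rule compact_continuous_image[OF _ compact_Times[OF compact_cball compact_cball]])
    have c1: "continuous_on U f" using has_derivative_continuous[OF f] by (simp add: continuous_at_imp_continuous_on)
    have "continuous_on (cball 0 R \<times> cball 0 R) (\<lambda>q. fst q *s v)" for v :: "complex ^ 'n"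
      using bounded_linear.continuous_on[OF bounded_linear_scale_vec continuous_on_fst[OF continuous_on_id]] .
    moreover have "continuous_on (cball 0 R \<times> cball 0 R) (\<lambda>q. snd q *s v)" for v :: "complex ^ 'n"
      using bounded_linear.continuous_on[OF bounded_linear_scale_vec continuous_on_snd[OF continuous_on_id]] .
    ultimately have "continuous_on (cball 0 R \<times> cball 0 R) (\<lambda>q. p + fst q *s v + snd q *s a)"
      by (intro continuous_intros)
    moreover have "(\<lambda>q. p + fst q *s v + snd q *s a) ` (cball 0 R \<times> cball 0 R) \<subseteq> U" using inU by auto
    ultimately have "continuous_on (cball 0 R \<times> cball 0 R) (\<lambda>q. f (p + fst q *s v + snd q *s a))"
      by (rule continuous_on_compose2[OF c1])
    then show "continuous_on (cball 0 R \<times> cball 0 R) (\<lambda>q. F (fst q) (snd q))"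
      unfolding F_def by (intro continuous_intros)
  qed
  from compact_imp_bounded[OF this]
  obtain B where B: "\<forall>y\<in>(\<lambda>q. F (fst q) (snd q)) ` (cball 0 R \<times> cball 0 R). norm y \<le> B"
    unfolding bounded_iff by (elim exE)
  have FB: "norm (F t z) \<le> B" if "norm t \<le> R" "norm z \<le> R" for t z
    using bspec[OF B imageI[of "(t, z)"]] that by simp
  \<comment> \<open>Step widths tending to 0; the shift by 3 keeps them below \<open>R / 2\<close>,
    as \<open>difference_quotient_bound\<close> demands.\<close>
  define E where "E n = R / of_nat (n + 3)" for n
  have E: "0 < E n" "E n < R / 2" for n
    unfolding E_def using R(1) by (intro divide_pos_pos divide_strict_left_mono; simp)+
  define q where "q n t = (F t (of_real (E n)) - F t 0) / of_real (E n)" for n t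
  have der: "deriv (F t) 0 = D (p + t *s v) a $ k" if "norm t \<le> R" for t
    using DERIV_imp_deriv[OF Fz[OF that, of 0]] R by simp
  have q: "norm (q n t - D (p + t *s v) a $ k) \<le> 8 * B / R\<^sup>2 * E n * 4" if "norm t \<le> R" for t n
  proof -
    have "F t holomorphic_on ball 0 R" unfolding holomorphic_on_open[OF open_ball]
      by (intro ballI, rule exI, rule Fz[OF that]) simp
    from difference_quotient_bound[OF R(1) this, of B "of_real (E n)"] FB[OF that] E[of n]
    show ?thesis by (simp add: q_def der[OF that])
  qed
  have "(\<lambda>t. D (p + t *s v) a $ k) holomorphic_on ball 0 R"
  proof (rule holomorphic_uniform_sequence[where f = q])
    show "q n holomorphic_on ball 0 R" for n
    proof -
      have "(\<lambda>t. F t z) holomorphic_on ball 0 R" if "norm z \<le> R" for z unfolding holomorphic_on_open[OF open_ball]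
        by (intro ballI, rule exI, rule Ft[OF _ that]) simp
      from this[of "of_real (E n)"] this[of 0] show ?thesis
        unfolding q_def using E[of n] R by (intro holomorphic_intros) auto
    qed
    fix t :: complex assume t: "t \<in> ball 0 R"
    obtain d where d: "d > 0" "cball t d \<subseteq> ball 0 R" using t open_contains_cball[of "ball 0 R"] by blast
    have "uniform_limit (cball t d) q (\<lambda>t. D (p + t *s v) a $ k) sequentially"
    proof (rule uniform_limitI)
      fix \<epsilon> :: real assume \<epsilon>: "\<epsilon> > 0"
      have "(\<lambda>n. 8 * B / R\<^sup>2 * (R / of_nat (n + 3)) * 4) \<longlonglongrightarrow> 8 * B / R\<^sup>2 * 0 * 4"
        by (intro tendsto_intros LIMSEQ_ignore_initial_segment lim_const_over_n)
      then have "\<forall>\<^sub>F n in sequentially. 8 * B / R\<^sup>2 * E n * 4 < \<epsilon>"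
        unfolding E_def using \<epsilon> by (intro order_tendstoD(2)) auto
      then show "\<forall>\<^sub>F n in sequentially. \<forall>t\<in>cball t d. dist (q n t) (D (p + t *s v) a $ k) < \<epsilon>"
      proof eventually_elim
        case (elim n)
        show ?case
        proof
          fix s assume "s \<in> cball t d"
          then have "norm s \<le> R" using d by auto
          from q[OF this, of n] elim show "dist (q n s) (D (p + s *s v) a $ k) < \<epsilon>" by (simp add: dist_norm)
        qed
      qed
    qed
    then show "\<exists>d>0. cball t d \<subseteq> ball 0 R \<and> uniform_limit (cball t d) q (\<lambda>t. D (p + t *s v) a $ k) sequentially"
      using d by blast
  qed (rule open_ball)
  moreover have "p + t *s v \<in> U" if "t \<in> ball 0 R" for t using inU[of t 0] that R by simp
  ultimately show ?thesis using R by blast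
qed

section \<open>Pulling back the ambient Hermitian form\<close>

text \<open>The constant matrix \<open>H\<close> is kept and only the holomorphic factors change, so
  finite rank passes from the ambient form to its restriction.\<close>

lemma congruence_factorization:
  assumes "\<And>i j. W i j = (\<Sum>z\<in>UNIV. \<Sum>w\<in>UNIV. X i z * H z w * cnj (X j w))"
  shows "(\<Sum>i\<in>UNIV. \<Sum>j\<in>UNIV. f i * W i j * cnj (g j)) =
    (\<Sum>z\<in>UNIV. \<Sum>w\<in>UNIV. (\<Sum>i\<in>UNIV. f i * X i z) * H z w * cnj (\<Sum>j\<in>UNIV. g j * X j w :: complex))"
proof -
  have "(\<Sum>i\<in>UNIV. \<Sum>j\<in>UNIV. f i * W i j * cnj (g j)) =
     (\<Sum>i\<in>UNIV. \<Sum>j\<in>UNIV. \<Sum>z\<in>UNIV. \<Sum>w\<in>UNIV. f i * X i z * H z w * cnj (g j * X j w))"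
    by (simp add: assms sum_distrib_left sum_distrib_right mult_ac)
  also have "\<dots> = (\<Sum>i\<in>UNIV. \<Sum>z\<in>UNIV. \<Sum>j\<in>UNIV. \<Sum>w\<in>UNIV. f i * X i z * H z w * cnj (g j * X j w))"
    by (intro sum.cong refl sum.swap)
  also have "\<dots> = (\<Sum>z\<in>UNIV. \<Sum>i\<in>UNIV. \<Sum>w\<in>UNIV. \<Sum>j\<in>UNIV. f i * X i z * H z w * cnj (g j * X j w))"
    by (subst sum.swap) (intro sum.cong refl sum.swap)
  also have "\<dots> = (\<Sum>z\<in>UNIV. \<Sum>w\<in>UNIV. \<Sum>i\<in>UNIV. \<Sum>j\<in>UNIV. f i * X i z * H z w * cnj (g j * X j w))"
    by (intro sum.cong refl sum.swap)
  also have "\<dots> = (\<Sum>z\<in>UNIV. \<Sum>w\<in>UNIV. \<Sum>j\<in>UNIV. \<Sum>i\<in>UNIV. f i * X i z * H z w * cnj (g j * X j w))"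
    by (intro sum.cong refl sum.swap)
  finally show ?thesis by (simp only: sum_distrib_left sum_distrib_right cnj_sum mult.assoc)
qed

text \<open>The block matrix of 1 and the differential: the section is restricted, and tangent frame
  vectors are mapped forward. Hence one potential \<open>p\<close> serves both spaces in
  \<open>tractor_pullback\<close>.\<close>

definition tractor_lift :: "('n \<Rightarrow> 'm \<Rightarrow> complex) \<Rightarrow> 'n option \<Rightarrow> 'm option \<Rightarrow> complex" where
  "tractor_lift \<phi> x p = (case x of None \<Rightarrow> (if p = None then 1 else 0)
     | Some a \<Rightarrow> (case p of None \<Rightarrow> 0 | Some j \<Rightarrow> \<phi> a j))"

lemma tractor_pullback:
  fixes \<phi> :: "'n::finite \<Rightarrow> 'm::finite \<Rightarrow> complex"
  assumes "\<And>a. \<theta>' a = (\<Sum>j\<in>UNIV. \<phi> a j * \<theta> j)" "\<And>a b. g' a b = (\<Sum>i\<in>UNIV. \<Sum>j\<in>UNIV. \<phi> a i * g i j * cnj (\<phi> b j))"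
  shows "tractor p \<theta>' \<kappa> g' x y = (\<Sum>u\<in>UNIV. \<Sum>w\<in>UNIV. tractor_lift \<phi> x u * tractor p \<theta> \<kappa> g u w * cnj (tractor_lift \<phi> y w))"
proof -
  let ?L = "tractor_lift \<phi>"
  have 1: "tractor_vector \<theta>' x = (\<Sum>u\<in>UNIV. ?L x u * tractor_vector \<theta> u)" for x
    by (cases x) (simp_all add: sum_UNIV_option tractor_simps tractor_lift_def assms(1) sum_negf)
  have 2: "tractor_block g' x y = (\<Sum>u\<in>UNIV. \<Sum>w\<in>UNIV. ?L x u * tractor_block g u w * cnj (?L y w))"
    by (cases x; cases y) (simp_all add: sum_UNIV_option tractor_simps tractor_lift_def assms(2))
  have "(\<Sum>u\<in>UNIV. \<Sum>w\<in>UNIV. ?L x u * tractor p \<theta> \<kappa> g u w * cnj (?L y w)) =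
    p * ((\<Sum>u\<in>UNIV. \<Sum>w\<in>UNIV. (?L x u * tractor_vector \<theta> u) * cnj (?L y w * tractor_vector \<theta> w)) + \<kappa> * (\<Sum>u\<in>UNIV. \<Sum>w\<in>UNIV. ?L x u * tractor_block g u w * cnj (?L y w)))"
    unfolding sum_distrib_left sum.distrib[symmetric] tractor_def
    by (intro sum.cong refl) (simp add: algebra_simps)
  then show ?thesis unfolding tractor_def 1 2 cnj_sum sum_product by simp
qed

lemma tractor_cnj:
  fixes g :: "'k::finite \<Rightarrow> 'k \<Rightarrow> complex"
  assumes "cnj p = p" "cnj \<kappa> = \<kappa>" "\<And>a b. cnj (g a b) = g b a"
  shows "cnj (tractor p \<theta> \<kappa> g x y) = tractor p \<theta> \<kappa> g y x"
proof -
  have "cnj (tractor_block g x y) = tractor_block g y x" by (cases x; cases y) (simp_all add: tractor_simps assms)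
  then show ?thesis by (simp add: tractor_def assms mult.commute)
qed

lemma det_nonzeroI:
  fixes A :: "complex ^ 'k ^ 'k::finite"
  assumes "\<And>u. A *v u = 0 \<Longrightarrow> u = 0"
  shows "det A \<noteq> 0"
proof -
  have "\<exists>B. B ** A = mat 1" unfolding matrix_left_invertible_ker using assms by blast
  then show ?thesis by (simp add: invertible_left_inverse flip: invertible_det_nz)
qed

text \<open>For a kernel vector the row \<open>None\<close> makes the rank one part vanish, and the
  other rows then reduce to the nondegenerate block \<open>\<kappa> * g\<close>.\<close>

lemma det_tractor_nonzero:
  fixes g :: "'n::finite \<Rightarrow> 'n \<Rightarrow> complex"
  assumes p: "p \<noteq> 0" and \<kappa>: "\<kappa> \<noteq> 0" and g: "\<And>u. (\<And>a. (\<Sum>b\<in>UNIV. g a b * u b) = 0) \<Longrightarrow> \<forall>b. u b = 0"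
  shows "det (\<chi> x y. tractor p \<theta> \<kappa> g x y :: complex ^ 'n option ^ 'n option) \<noteq> 0"
proof (rule det_nonzeroI)
  fix u :: "complex ^ 'n option" assume u: "(\<chi> x y. tractor p \<theta> \<kappa> g x y) *v u = 0"
  define s where "s = (\<Sum>y\<in>UNIV. cnj (tractor_vector \<theta> y) * u $ y)"
  have row: "tractor_vector \<theta> x * s + \<kappa> * (\<Sum>y\<in>UNIV. tractor_block g x y * u $ y) = 0" for x
  proof -
    have "0 = (\<Sum>y\<in>UNIV. tractor p \<theta> \<kappa> g x y * u $ y)"
      using arg_cong[OF u, of "\<lambda>w. w $ x"] by (simp add: matrix_vector_mult_def)
    also have "\<dots> = p * (tractor_vector \<theta> x * s + \<kappa> * (\<Sum>y\<in>UNIV. tractor_block g x y * u $ y))"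
      unfolding s_def sum_distrib_left sum.distrib[symmetric] tractor_def
      by (intro sum.cong refl) (simp add: algebra_simps)
    finally show ?thesis using p by simp
  qed
  have s: "s = 0" using row[of None] by (simp add: tractor_simps)
  have "(\<Sum>b\<in>UNIV. g a b * u $ Some b) = 0" for a
    using row[of "Some a"] s \<kappa> by (simp add: tractor_simps sum_UNIV_option)
  from g[OF this] have S: "u $ Some b = 0" for b by simp
  then have "u $ None = 0" using s by (simp add: s_def sum_UNIV_option tractor_simps)
  with S have "u $ x = 0" for x by (cases x) auto
  then show "u = 0" by (simp add: vec_eq_iff)
qed

section \<open>Kaehler--Einstein submanifolds\<close>

locale kaehler_einstein_submanifold =
  M: kaehler_domain U G + S: kaehler_space_form V H c
  for U :: "(complex ^ 'n::finite) set" and G and V :: "(complex ^ 'm::finite) set" and H and c +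
  fixes \<psi> :: "complex ^ 'n \<Rightarrow> complex ^ 'm" and D :: "complex ^ 'n \<Rightarrow> complex ^ 'n \<Rightarrow> complex ^ 'm" and \<Lambda> :: real
  assumes into: "x \<in> U \<Longrightarrow> \<psi> x \<in> V"
    and deriv: "x \<in> U \<Longrightarrow> (\<psi> has_derivative D x) (at x)"
    and complex_linear: "x \<in> U \<Longrightarrow> D x (J v) = J (D x v)"
    and isometry: "x \<in> U \<Longrightarrow> G x u v = H (\<psi> x) (D x u) (D x v)"
    and positive: "x \<in> U \<Longrightarrow> v \<noteq> 0 \<Longrightarrow> G x v v > 0"
    and einstein: "x \<in> U \<Longrightarrow> ricci G x u v = \<Lambda> * G x u v"
begin

lemma h_isometry: "x \<in> U \<Longrightarrow> M.h x u v = S.h (\<psi> x) (D x u) (D x v)"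
  unfolding M.h_def S.h_def by (simp add: isometry complex_linear)

text \<open>The real Ricci tensor determines real parts only; inserting \<open>J v\<close> for one
  argument shows that the imaginary part is zero.\<close>

lemma curv_trace: assumes x: "x \<in> U"
  shows "(\<Sum>i\<in>UNIV. M.curv x v (axis i 1) v $ i) = - of_real (\<Lambda> / 2) * M.h x v v"
proof -
  have re: "Re (\<Sum>i\<in>UNIV. M.curv x w (axis i 1) v $ i) = - \<Lambda> / 2 * G x v w" for w
    using einstein[OF x, of v w] unfolding M.ricci_eq[OF x] by simp
  have "(\<Sum>i\<in>UNIV. M.curv x (J v) (axis i 1) v $ i) = \<i> * (\<Sum>i\<in>UNIV. M.curv x v (axis i 1) v $ i)"
    by (simp add: M.curv_linear_left[OF x] sum_distrib_left)
  then have "Im (\<Sum>i\<in>UNIV. M.curv x v (axis i 1) v $ i) = \<Lambda> / 2 * G x v (J v)"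
    using re[of "J v"] by simp
  moreover have "G x v (J v) = 0" using M.h_diagonal[OF x, of v] by (simp add: M.h_def complex_eq_iff)
  ultimately show ?thesis using re[of v] unfolding M.h_diagonal[OF x] by (simp add: complex_eq_iff)
qed

end

section \<open>A complex disc in the submanifold\<close>

locale kaehler_einstein_disc = kaehler_einstein_submanifold U G V H c \<psi> D \<Lambda>
  for U :: "(complex ^ 'n::finite) set" and G and V :: "(complex ^ 'm::finite) set" and H c \<psi> D \<Lambda> +
  fixes p :: "complex ^ 'n" and a\<^sub>0 :: 'n and r :: real
  assumes r: "r > 0" and line: "t \<in> ball 0 r \<Longrightarrow> p + t *s axis a\<^sub>0 1 \<in> U"
    and hol: "(\<lambda>t. D (p + t *s axis a\<^sub>0 1) (axis a 1) $ k) holomorphic_on ball 0 r"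
begin

abbreviation "e\<^sub>0 \<equiv> (axis a\<^sub>0 1 :: complex ^ 'n)"

definition "x t = p + t *s e\<^sub>0"
definition "\<gamma> t = \<psi> (x t)"
definition "v t = D (x t) e\<^sub>0"
definition "\<phi> t a k = D (x t) (axis a 1) $ k"
definition "gM t a b = M.h (x t) (axis a 1) (axis b 1)"
definition "gS t i j = S.h (\<gamma> t) (axis i 1) (axis j 1)"
definition "\<Gamma>M t a b = M.gam (x t) e\<^sub>0 (axis a 1) $ b"
definition "\<Gamma>S t i j = S.gam (\<gamma> t) (v t) (axis i 1) $ j"
text \<open>The squared length of the velocity of the disc. The mixed logarithmic derivatives of the
  determinants and of the potential are all constant multiples of it.\<close>

definition "\<rho> t = M.h (x t) e\<^sub>0 e\<^sub>0"

lemma x_in: "t \<in> ball 0 r \<Longrightarrow> x t \<in> U"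
  unfolding x_def by (rule line)

lemma \<gamma>_in: "t \<in> ball 0 r \<Longrightarrow> \<gamma> t \<in> V"
  unfolding \<gamma>_def by (intro into x_in)

lemma x_deriv: "(x has_derivative (\<lambda>d. d *s e\<^sub>0)) (at t)"
  unfolding x_def[abs_def] by (rule has_derivative_line)

lemma \<gamma>_deriv: assumes "t \<in> ball 0 r" shows "(\<gamma> has_derivative (\<lambda>d. d *s v t)) (at t)"
  unfolding \<gamma>_def[abs_def] v_def
  by (rule has_derivative_holomorphic_curve[OF deriv[OF x_in[OF assms]] complex_linear[OF x_in[OF assms]] x_deriv])

lemma \<phi>_hol: "(\<lambda>t. \<phi> t a k) holomorphic_on ball 0 r"
  unfolding \<phi>_def x_def by (rule hol)

lemma v_nth: "v t $ k = \<phi> t a\<^sub>0 k"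
  by (simp add: v_def \<phi>_def)

lemma v_hol: "(\<lambda>t. v t $ k) holomorphic_on ball 0 r"
  unfolding v_nth by (rule \<phi>_hol)

lemma v_deriv: "t \<in> ball 0 r \<Longrightarrow> \<exists>v'. ((\<lambda>t. v t $ k) has_field_derivative v') (at t)"
  using v_hol[of k] unfolding holomorphic_on_open[OF open_ball] by blast

text \<open>Positivity on the submanifold makes the ambient velocity nonnull, as
  \<open>curv_space_form\<close> demands.\<close>

lemma nonnull: assumes "t \<in> ball 0 r" shows "H (\<gamma> t) (v t) (v t) \<noteq> 0"
  using positive[OF x_in[OF assms], of e\<^sub>0] isometry[OF x_in[OF assms], of e\<^sub>0 e\<^sub>0] by (simp add: \<gamma>_def v_def axis_eq_0_iff)

lemma \<rho>_nonzero: assumes "t \<in> ball 0 r" shows "\<rho> t \<noteq> 0"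
  using positive[OF x_in[OF assms], of e\<^sub>0] unfolding \<rho>_def M.h_diagonal[OF x_in[OF assms]] by (auto simp: axis_eq_0_iff)

lemma gM_cnj: "t \<in> ball 0 r \<Longrightarrow> cnj (gM t a b) = gM t b a"
  by (simp add: gM_def M.h_cnj x_in)

lemma gS_cnj: "t \<in> ball 0 r \<Longrightarrow> cnj (gS t a b) = gS t b a"
  by (simp add: gS_def S.h_cnj \<gamma>_in)

lemma gM_pullback: assumes "t \<in> ball 0 r"
  shows "gM t a b = (\<Sum>i\<in>UNIV. \<Sum>j\<in>UNIV. \<phi> t a i * gS t i j * cnj (\<phi> t b j))"
proof -
  have "gM t a b = S.h (\<gamma> t) (D (x t) (axis a 1)) (D (x t) (axis b 1))"
    unfolding gM_def \<gamma>_def by (rule h_isometry[OF x_in[OF assms]])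
  also have "\<dots> = (\<Sum>i\<in>UNIV. \<phi> t a i * S.h (\<gamma> t) (axis i 1) (D (x t) (axis b 1)))"
    unfolding \<phi>_def by (rule S.h_expand_left[OF \<gamma>_in[OF assms]])
  also have "\<dots> = (\<Sum>i\<in>UNIV. \<phi> t a i * (\<Sum>j\<in>UNIV. cnj (\<phi> t b j) * gS t i j))"
    unfolding \<phi>_def gS_def S.h_expand_right[OF \<gamma>_in[OF assms], of _ "D (x t) (axis b 1)"] by (rule refl)
  finally show ?thesis by (simp add: sum_distrib_left mult_ac)
qed

lemma gM_nondegenerate: assumes t: "t \<in> ball 0 r" and u: "\<And>a. (\<Sum>b\<in>UNIV. gM t a b * u b) = 0"
  shows "\<forall>b. u b = 0"
proof -
  define w where "w = (\<chi> b. cnj (u b))"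
  have 0: "M.h (x t) (axis a 1) w = 0" for a
    unfolding M.h_expand_right[OF x_in[OF t], of _ w] using u[of a] by (simp add: w_def gM_def mult.commute)
  have "w = 0"
  proof (rule M.h_nondegenerate[OF x_in[OF t]])
    fix z
    have "M.h (x t) z w = 0" unfolding M.h_expand_left[OF x_in[OF t], of z w] 0 by simp
    then show "M.h (x t) w z = 0" using M.h_cnj[OF x_in[OF t], of z w] by simp
  qed
  then show ?thesis by (simp add: w_def vec_eq_iff)
qed

lemma det_gM: assumes t: "t \<in> ball 0 r" shows "det (\<chi> a b. gM t a b) \<noteq> 0"
proof (rule det_nonzeroI)
  fix u assume "(\<chi> a b. gM t a b) *v u = 0"
  then have "(\<Sum>b\<in>UNIV. gM t a b * u $ b) = 0" for a
    by (simp add: vec_eq_iff matrix_vector_mult_def)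
  from gM_nondegenerate[OF t this] show "u = 0" by (simp add: vec_eq_iff)
qed

lemma wirtinger_gM: "t \<in> ball 0 r \<Longrightarrow> \<exists>B. wirtinger (\<lambda>t. gM t a b) (\<Sum>e\<in>UNIV. \<Gamma>M t a e * gM t e b) B t"
  unfolding gM_def \<Gamma>M_def by (rule M.wirtinger_h_curve[OF x_in x_deriv])

lemma wirtinger_gS: "t \<in> ball 0 r \<Longrightarrow> \<exists>B. wirtinger (\<lambda>t. gS t i j) (\<Sum>e\<in>UNIV. \<Gamma>S t i e * gS t e j) B t"
  unfolding gS_def \<Gamma>S_def by (rule S.wirtinger_h_curve[OF \<gamma>_in \<gamma>_deriv])

text \<open>This is where the Einstein equation enters: the trace is the logarithmic derivative of
  the determinant of \<open>gM\<close>, and its antiholomorphic derivative is a trace of the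
  curvature.\<close>

lemma wirtinger_trace_\<Gamma>M: assumes t: "t \<in> ball 0 r"
  shows "\<exists>A. wirtinger (\<lambda>t. \<Sum>a\<in>UNIV. \<Gamma>M t a a) A (- of_real (\<Lambda> / 2) * \<rho> t) t"
proof -
  have d0: "\<exists>w'. ((\<lambda>t. e\<^sub>0 $ i) has_field_derivative w') (at t)" for i using DERIV_const by blast
  have "\<exists>A. wirtinger (\<lambda>t. \<Gamma>M t a a) A (M.curv (x t) e\<^sub>0 (axis a 1) e\<^sub>0 $ a) t" for a
    unfolding \<Gamma>M_def
    by (rule M.wirtinger_gam_curve[where \<gamma> = x and v = "\<lambda>_. e\<^sub>0", OF x_in[OF t] x_deriv d0 open_ball t x_in])
  then obtain A where "\<And>a. wirtinger (\<lambda>t. \<Gamma>M t a a) (A a) (M.curv (x t) e\<^sub>0 (axis a 1) e\<^sub>0 $ a) t" by metis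
  note A = this
  have "wirtinger (\<lambda>t. \<Sum>a\<in>UNIV. \<Gamma>M t a a) (\<Sum>a\<in>UNIV. A a) (\<Sum>a\<in>UNIV. M.curv (x t) e\<^sub>0 (axis a 1) e\<^sub>0 $ a) t"
    by (rule wirtinger_sum) (rule A)
  then show ?thesis
    unfolding curv_trace[OF x_in[OF t]] \<rho>_def by (rule exI)
qed

text \<open>For \<open>c = 0\<close> the connection matrix of the ambient metric is already
  holomorphic along the disc, so the metric itself factorises and takes the role of the ambient
  form.\<close>

lemma flat: assumes c: "c = 0" shows "\<Lambda> = 0"
proof -
  have \<Gamma>_hol: "(\<lambda>t. \<Gamma>S t i j) holomorphic_on ball 0 r" for i j
    unfolding holomorphic_on_open[OF open_ball]
  proof (intro ballI)
    fix t :: complex assume t: "t \<in> ball 0 r"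
    have "\<exists>A. wirtinger (\<lambda>t. \<Gamma>S t i j) A (S.curv (\<gamma> t) (v t) (axis i 1) (v t) $ j) t"
      unfolding \<Gamma>S_def
      by (rule S.wirtinger_gam_curve[where \<gamma> = \<gamma> and v = v, OF \<gamma>_in[OF t] \<gamma>_deriv[OF t] v_deriv[OF t] open_ball t \<gamma>_in])
    moreover have "S.curv (\<gamma> t) (v t) (axis i 1) (v t) $ j = 0"
      unfolding S.curv_space_form[OF \<gamma>_in[OF t] nonnull[OF t]] by (simp add: c)
    ultimately obtain A where "wirtinger (\<lambda>t. \<Gamma>S t i j) A 0 t" by (elim exE) simp
    then show "\<exists>f'. ((\<lambda>t. \<Gamma>S t i j) has_field_derivative f') (at t)" by (intro exI, rule wirtinger_holomorphicD)
  qed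
  have "\<exists>d (X :: 'm \<Rightarrow> 'm \<Rightarrow> complex \<Rightarrow> complex) K. 0 < d \<and> d \<le> r \<and> (\<forall>a z. X a z holomorphic_on ball 0 d) \<and>
    (\<forall>t\<in>ball 0 d. \<forall>i j. gS t i j = (\<Sum>z\<in>UNIV. \<Sum>w\<in>UNIV. X i z t * K z w * cnj (X j w t)))"
    by (rule hermitian_factorization[where N = \<Gamma>S and W = gS, OF r \<Gamma>_hol wirtinger_gS gS_cnj])
  then obtain d and X :: "'m \<Rightarrow> 'm \<Rightarrow> complex \<Rightarrow> complex" and K where d: "0 < d" "d \<le> r" and X: "\<forall>a z. X a z holomorphic_on ball 0 d"
    and W: "\<forall>t\<in>ball 0 d. \<forall>i j. gS t i j = (\<Sum>z\<in>UNIV. \<Sum>w\<in>UNIV. X i z t * K z w * cnj (X j w t))"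
    by (elim exE conjE) (rule that; assumption)
  have \<phi>_hol': "(\<lambda>t. \<phi> t a k) holomorphic_on ball 0 d" for a k
    by (rule holomorphic_on_subset[OF \<phi>_hol]) (simp add: subset_ball d)
  have sub: "t \<in> ball 0 r" if "t \<in> ball 0 d" for t :: complex using that d by simp
  define A where "A a z t = (\<Sum>i\<in>UNIV. \<phi> t a i * X i z t)" for a z t
  have A: "A a z holomorphic_on ball 0 d" for a z
    unfolding A_def by (intro holomorphic_on_sum holomorphic_on_mult \<phi>_hol' X[rule_format])
  have gA: "gM t a b = (\<Sum>z\<in>UNIV. \<Sum>w\<in>UNIV. A a z t * K z w * cnj (A b w t))" if t: "t \<in> ball 0 d" for t a b
    unfolding gM_pullback[OF sub[OF t]] A_def by (rule congruence_factorization) (use W t in blast)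
  define E where "E t s = det (\<chi> a b. \<Sum>z\<in>UNIV. \<Sum>w\<in>UNIV. A a z t * K z w * cnj (A b w (cnj s)))" for t s
  define R where "R t s = (\<Sum>z\<in>UNIV. \<Sum>w\<in>UNIV. A a\<^sub>0 z t * K z w * cnj (A a\<^sub>0 w (cnj s)))" for t s
  have E: "E t (cnj t) = det (\<chi> a b. gM t a b)" if "t \<in> ball 0 d" for t by (simp add: E_def gA[OF that])
  have R: "R t (cnj t) = \<rho> t" if "t \<in> ball 0 d" for t by (simp add: R_def gA[OF that, symmetric]) (simp add: gM_def \<rho>_def)
  have "- complex_of_real (\<Lambda> / 2) = 0"
  proof (rule flat_conclusion[where E = E and \<rho> = R and \<nu> = "\<lambda>t. \<Sum>a\<in>UNIV. \<Gamma>M t a a", OF d(1)])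
    show "finite_rank (ball 0 d) E" unfolding E_def by (rule finite_rank_det[OF A])
    show "finite_rank (ball 0 d) R" unfolding R_def by (rule finite_rank_hermitian[OF A A])
    show "E 0 0 \<noteq> 0" "R 0 0 \<noteq> 0"
      using E[of 0] R[of 0] det_gM[of 0] \<rho>_nonzero[of 0] d r by simp_all
    fix t :: complex assume t: "t \<in> ball 0 d"
    obtain B where "\<And>a b. wirtinger (\<lambda>t. gM t a b) (\<Sum>e\<in>UNIV. \<Gamma>M t a e * gM t e b) (B a b) t"
      using wirtinger_gM[OF sub[OF t]] by metis
    then have "\<exists>b. wirtinger (\<lambda>t. det (\<chi> a b. gM t a b)) ((\<Sum>a\<in>UNIV. \<Gamma>M t a a) * det (\<chi> a b. gM t a b)) b t"
      by (intro wirtinger_det[where B = B]) simp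
    then obtain b where b: "wirtinger (\<lambda>t. det (\<chi> a b. gM t a b)) ((\<Sum>a\<in>UNIV. \<Gamma>M t a a) * det (\<chi> a b. gM t a b)) b t" by (elim exE)
    have "wirtinger (\<lambda>t. E t (cnj t)) ((\<Sum>a\<in>UNIV. \<Gamma>M t a a) * E t (cnj t)) b t"
      unfolding E[OF t] by (rule wirtinger_cong[OF b open_ball t]) (simp add: E)
    then show "\<exists>B. wirtinger (\<lambda>t. E t (cnj t)) ((\<Sum>a\<in>UNIV. \<Gamma>M t a a) * E t (cnj t)) B t" by (rule exI)
    show "\<exists>a. wirtinger (\<lambda>t. \<Sum>a\<in>UNIV. \<Gamma>M t a a) a (- of_real (\<Lambda> / 2) * R t (cnj t)) t"
      unfolding R[OF t] by (rule wirtinger_trace_\<Gamma>M[OF sub[OF t]])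
  qed
  then show ?thesis by simp
qed

lemma curved: assumes c: "c \<noteq> 0" shows "of_nat (Suc CARD('n)) - complex_of_real (\<Lambda> / c) \<in> \<rat>"
proof -
  define \<kappa> where "\<kappa> = complex_of_real (c / 2)"
  have \<kappa>: "\<kappa> \<noteq> 0" "cnj \<kappa> = \<kappa>" using c by (simp_all add: \<kappa>_def)
  define \<theta> where "\<theta> t i = S.\<tau> (\<gamma> t) i / of_nat (Suc CARD('m))" for t i
  have funs: "\<theta> t = (\<lambda>i. S.\<tau> (\<gamma> t) i / of_nat (Suc CARD('m)))" "\<Gamma>S t = (\<lambda>i j. S.gam (\<gamma> t) (v t) (axis i 1) $ j)" for t
    by (simp_all add: fun_eq_iff \<theta>_def \<Gamma>S_def)
  have "\<exists>P \<delta>. (\<forall>t\<in>ball 0 r. P t \<noteq> 0 \<and> cnj (P t) = P t \<and>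
      (\<exists>B. wirtinger P (- (\<Sum>e\<in>UNIV. v t $ e * \<theta> t e) * P t) B t) \<and>
      (\<forall>a. wirtinger (\<lambda>t. \<theta> t a) (\<delta> t a) (- \<kappa> * (\<Sum>b\<in>UNIV. cnj (v t $ b) * gS t a b)) t)) \<and>
      (\<forall>x z. (\<lambda>t. tractor_connection (\<lambda>e. v t $ e) (\<Gamma>S t) (\<theta> t) (\<delta> t) x z) holomorphic_on ball 0 r)"
    unfolding funs gS_def \<kappa>_def by (rule S.curve_data[where \<gamma> = \<gamma> and v = v and r = r, OF \<gamma>_in \<gamma>_deriv v_hol nonnull])
  then obtain P \<delta> where PD: "\<forall>t\<in>ball 0 r. P t \<noteq> 0 \<and> cnj (P t) = P t \<and>
      (\<exists>B. wirtinger P (- (\<Sum>e\<in>UNIV. v t $ e * \<theta> t e) * P t) B t) \<and>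
      (\<forall>a. wirtinger (\<lambda>t. \<theta> t a) (\<delta> t a) (- \<kappa> * (\<Sum>b\<in>UNIV. cnj (v t $ b) * gS t a b)) t)"
    and N: "\<forall>x z. (\<lambda>t. tractor_connection (\<lambda>e. v t $ e) (\<Gamma>S t) (\<theta> t) (\<delta> t) x z) holomorphic_on ball 0 r"
    by (elim exE conjE) (rule that; assumption)
  have P: "P t \<noteq> 0" "cnj (P t) = P t" and wP: "\<exists>B. wirtinger P (- (\<Sum>e\<in>UNIV. v t $ e * \<theta> t e) * P t) B t"
    and w\<theta>: "\<And>a. wirtinger (\<lambda>t. \<theta> t a) (\<delta> t a) (- \<kappa> * (\<Sum>b\<in>UNIV. cnj (v t $ b) * gS t a b)) t"
    if "t \<in> ball 0 r" for t using PD that by blast+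
  define W where "W t = tractor (P t) (\<theta> t) \<kappa> (gS t)" for t
  have wW: "\<exists>B. wirtinger (\<lambda>t. W t a b) (\<Sum>z\<in>UNIV. tractor_connection (\<lambda>e. v t $ e) (\<Gamma>S t) (\<theta> t) (\<delta> t) a z * W t z b) B t" if t: "t \<in> ball 0 r" for t a b
  proof -
    obtain pb where pb: "wirtinger P (- (\<Sum>e\<in>UNIV. v t $ e * \<theta> t e) * P t) pb t" using wP[OF t] by (elim exE)
    show ?thesis unfolding W_def
      by (rule tractor_derivative[OF wirtinger_gS[OF t] pb w\<theta>[OF t] gS_cnj[OF t] \<kappa>(2)])
  qed
  have hW: "cnj (W t a b) = W t b a" if t: "t \<in> ball 0 r" for t a b
    unfolding W_def by (rule tractor_cnj[OF P(2)[OF t] \<kappa>(2) gS_cnj[OF t]])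
  have "\<exists>d (X :: 'm option \<Rightarrow> 'm option \<Rightarrow> complex \<Rightarrow> complex) K. 0 < d \<and> d \<le> r \<and> (\<forall>a z. X a z holomorphic_on ball 0 d) \<and>
    (\<forall>t\<in>ball 0 d. \<forall>i j. W t i j = (\<Sum>z\<in>UNIV. \<Sum>w\<in>UNIV. X i z t * K z w * cnj (X j w t)))"
    by (rule hermitian_factorization[where N = "\<lambda>t. tractor_connection (\<lambda>e. v t $ e) (\<Gamma>S t) (\<theta> t) (\<delta> t)" and W = W, OF r N[rule_format] wW hW])
  then obtain d and X :: "'m option \<Rightarrow> 'm option \<Rightarrow> complex \<Rightarrow> complex" and K where d: "0 < d" "d \<le> r" and X: "\<forall>a z. X a z holomorphic_on ball 0 d"
    and WX: "\<forall>t\<in>ball 0 d. \<forall>i j. W t i j = (\<Sum>z\<in>UNIV. \<Sum>w\<in>UNIV. X i z t * K z w * cnj (X j w t))"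
    by (elim exE conjE) (rule that; assumption)
  have \<phi>_hol': "(\<lambda>t. \<phi> t a k) holomorphic_on ball 0 d" for a k
    by (rule holomorphic_on_subset[OF \<phi>_hol]) (simp add: subset_ball d)
  have sub: "t \<in> ball 0 r" if "t \<in> ball 0 d" for t :: complex using that d by simp
  define \<theta>M where "\<theta>M t a = (\<Sum>j\<in>UNIV. \<phi> t a j * \<theta> t j)" for t a
  define WM where "WM t = tractor (P t) (\<theta>M t) \<kappa> (gM t)" for t
  have \<theta>0: "(\<Sum>e\<in>UNIV. v t $ e * \<theta> t e) = \<theta>M t a\<^sub>0" for t by (simp add: \<theta>M_def v_nth)
  define vM where "vM a = (if a = a\<^sub>0 then 1 else 0 :: complex)" for a
  have vM: "(\<Sum>a\<in>UNIV. vM a * f a) = f a\<^sub>0" "(\<Sum>a\<in>UNIV. cnj (vM a) * f a) = f a\<^sub>0" for f :: "'n \<Rightarrow> complex"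
  proof -
    have "vM a * f a = (if a = a\<^sub>0 then f a else 0)" "cnj (vM a) * f a = (if a = a\<^sub>0 then f a else 0)" for a by (simp_all add: vM_def)
    then show "(\<Sum>a\<in>UNIV. vM a * f a) = f a\<^sub>0" "(\<Sum>a\<in>UNIV. cnj (vM a) * f a) = f a\<^sub>0" by simp_all
  qed
  define \<delta>M where "\<delta>M t a = (\<Sum>j\<in>UNIV. deriv (\<lambda>t. \<phi> t a j) t * \<theta> t j + \<phi> t a j * \<delta> t j)" for t a
  have w\<theta>M: "wirtinger (\<lambda>t. \<theta>M t a) (\<delta>M t a) (- \<kappa> * gM t a a\<^sub>0) t" if t: "t \<in> ball 0 r" for t a
  proof -
    have "wirtinger (\<lambda>t. \<theta>M t a) (\<delta>M t a) (\<Sum>j\<in>UNIV. 0 * \<theta> t j + \<phi> t a j * (- \<kappa> * (\<Sum>b\<in>UNIV. cnj (v t $ b) * gS t j b))) t"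
      unfolding \<theta>M_def \<delta>M_def
      by (intro wirtinger_sum wirtinger_mult w\<theta>[OF t] wirtinger_holomorphic holomorphic_derivI[OF \<phi>_hol open_ball t])
    moreover have "(\<Sum>j\<in>UNIV. 0 * \<theta> t j + \<phi> t a j * (- \<kappa> * (\<Sum>b\<in>UNIV. cnj (v t $ b) * gS t j b))) = - \<kappa> * gM t a a\<^sub>0"
      unfolding gM_pullback[OF t] v_nth by (simp add: sum_distrib_left sum_negf mult_ac)
    ultimately show ?thesis by simp
  qed
  \<comment> \<open>The finite rank comes from the ambient factorisation, where the connection is
    holomorphic. For the restricted form only the trace of \<open>NM\<close> enters, as the
    logarithmic derivative of its determinant.\<close>
  define NM where "NM t = tractor_connection vM (\<Gamma>M t) (\<theta>M t) (\<delta>M t)" for t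
  have wWM: "\<exists>B. wirtinger (\<lambda>t. WM t a b) (\<Sum>z\<in>UNIV. NM t a z * WM t z b) B t" if t: "t \<in> ball 0 r" for t a b
  proof -
    obtain pb where "wirtinger P (- (\<Sum>e\<in>UNIV. v t $ e * \<theta> t e) * P t) pb t" using wP[OF t] by (elim exE)
    then have pb: "wirtinger P (- (\<Sum>e\<in>UNIV. vM e * \<theta>M t e) * P t) pb t" by (simp only: vM \<theta>0)
    have w: "wirtinger (\<lambda>t. \<theta>M t a) (\<delta>M t a) (- \<kappa> * (\<Sum>b\<in>UNIV. cnj (vM b) * gM t a b)) t" for a
      unfolding vM by (rule w\<theta>M[OF t])
    show ?thesis unfolding WM_def NM_def
      by (rule tractor_derivative[OF wirtinger_gM[OF t] pb w gM_cnj[OF t] \<kappa>(2)])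
  qed
  define L where "L t = tractor_lift (\<phi> t)" for t
  have WM: "WM t x y = (\<Sum>u\<in>UNIV. \<Sum>w\<in>UNIV. L t x u * W t u w * cnj (L t y w))" if t: "t \<in> ball 0 r" for t x y
    unfolding WM_def W_def L_def by (rule tractor_pullback[OF \<theta>M_def gM_pullback[OF t]])
  define A where "A a z t = (\<Sum>i\<in>UNIV. L t a i * X i z t)" for a z t
  have L_hol: "(\<lambda>t. L t a i) holomorphic_on ball 0 d" for a i
    unfolding L_def by (cases a; cases i) (simp_all add: tractor_lift_def \<phi>_hol' holomorphic_on_const)
  have A: "A a z holomorphic_on ball 0 d" for a z
    unfolding A_def by (intro holomorphic_on_sum holomorphic_on_mult L_hol X[rule_format])
  have WA: "WM t a b = (\<Sum>z\<in>UNIV. \<Sum>w\<in>UNIV. A a z t * K z w * cnj (A b w t))" if t: "t \<in> ball 0 d" for t a b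
    unfolding WM[OF sub[OF t]] A_def by (rule congruence_factorization) (use WX t in blast)
  define E where "E t s = det (\<chi> a b. \<Sum>z\<in>UNIV. \<Sum>w\<in>UNIV. A a z t * K z w * cnj (A b w (cnj s)))" for t s
  \<comment> \<open>The potential \<open>P\<close> is the entry \<open>None\<close>,
    \<open>None\<close> of the ambient form and so extends off the diagonal with finite
    rank.\<close>
  define Q where "Q t s = (\<Sum>z\<in>UNIV. \<Sum>w\<in>UNIV. X None z t * K z w * cnj (X None w (cnj s)))" for t s
  have E: "E t (cnj t) = det (\<chi> a b. WM t a b)" if "t \<in> ball 0 d" for t by (simp add: E_def WA[OF that])
  have Q: "Q t (cnj t) = P t" if t: "t \<in> ball 0 d" for t
  proof -
    have "Q t (cnj t) = W t None None" using WX t by (simp add: Q_def)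
    then show ?thesis by (simp add: W_def tractor_def tractor_simps)
  qed
  define \<nu> where "\<nu> t = (\<Sum>a\<in>UNIV. \<Gamma>M t a a) - of_nat (Suc CARD('n)) * \<theta>M t a\<^sub>0" for t
  show ?thesis
  proof (rule curved_conclusion[where E = E and P = Q and \<nu> = \<nu> and \<mu> = "\<lambda>t. - \<theta>M t a\<^sub>0" and \<kappa> = "\<lambda>t. \<kappa> * \<rho> t", OF d(1)])
    show "finite_rank (ball 0 d) E" unfolding E_def by (rule finite_rank_det[OF A])
    show "finite_rank (ball 0 d) Q" unfolding Q_def using X by (intro finite_rank_hermitian) auto
    have 0: "0 \<in> ball (0::complex) d" "0 \<in> ball (0::complex) r" using d r by auto
    have "det (\<chi> a b. WM 0 a b) \<noteq> 0" unfolding WM_def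
      by (rule det_tractor_nonzero[OF P(1)[OF 0(2)] \<kappa>(1)]) (rule gM_nondegenerate[OF 0(2)])
    then show "E 0 0 \<noteq> 0" using E[OF 0(1)] by simp
    show "Q 0 0 \<noteq> 0" using Q[OF 0(1)] P(1)[OF 0(2)] by simp
    show "\<kappa> * \<rho> 0 \<noteq> 0" using \<kappa>(1) \<rho>_nonzero[OF 0(2)] by simp
    fix t :: complex assume t: "t \<in> ball 0 d"
    note t' = sub[OF t]
    obtain B where "\<And>a b. wirtinger (\<lambda>t. WM t a b) (\<Sum>z\<in>UNIV. NM t a z * WM t z b) (B a b) t"
      using wWM[OF t'] by metis
    then have "\<exists>b. wirtinger (\<lambda>t. det (\<chi> a b. WM t a b)) ((\<Sum>a\<in>UNIV. NM t a a) * det (\<chi> a b. WM t a b)) b t"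
      by (intro wirtinger_det[where B = B]) simp
    then obtain b where "wirtinger (\<lambda>t. det (\<chi> a b. WM t a b)) ((\<Sum>a\<in>UNIV. NM t a a) * det (\<chi> a b. WM t a b)) b t" by (elim exE)
    moreover have "(\<Sum>a\<in>UNIV. NM t a a) = \<nu> t" unfolding NM_def trace_tractor_connection vM \<nu>_def ..
    ultimately have b: "wirtinger (\<lambda>t. det (\<chi> a b. WM t a b)) (\<nu> t * det (\<chi> a b. WM t a b)) b t" by simp
    have "wirtinger (\<lambda>t. E t (cnj t)) (\<nu> t * E t (cnj t)) b t"
      unfolding E[OF t] by (rule wirtinger_cong[OF b open_ball t]) (simp add: E)
    then show "\<exists>B. wirtinger (\<lambda>t. E t (cnj t)) (\<nu> t * E t (cnj t)) B t" by (rule exI)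
    obtain pb where "wirtinger P (- (\<Sum>e\<in>UNIV. v t $ e * \<theta> t e) * P t) pb t" using wP[OF t'] by (elim exE)
    then have pb: "wirtinger P (- \<theta>M t a\<^sub>0 * P t) pb t" by (simp only: \<theta>0)
    have "wirtinger (\<lambda>t. Q t (cnj t)) (- \<theta>M t a\<^sub>0 * Q t (cnj t)) pb t"
      unfolding Q[OF t] by (rule wirtinger_cong[OF pb open_ball t]) (simp add: Q)
    then show "\<exists>B. wirtinger (\<lambda>t. Q t (cnj t)) (- \<theta>M t a\<^sub>0 * Q t (cnj t)) B t" by (rule exI)
    have g0: "gM t a\<^sub>0 a\<^sub>0 = \<rho> t" by (simp add: gM_def \<rho>_def)
    from wirtinger_minus[OF w\<theta>M[OF t', of a\<^sub>0]] show "\<exists>a. wirtinger (\<lambda>t. - \<theta>M t a\<^sub>0) a (\<kappa> * \<rho> t) t"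
      by (rule wirtinger_exI) (simp add: g0)
    obtain A1 where A1: "wirtinger (\<lambda>t. \<Sum>a\<in>UNIV. \<Gamma>M t a a) A1 (- of_real (\<Lambda> / 2) * \<rho> t) t"
      using wirtinger_trace_\<Gamma>M[OF t'] by (elim exE)
    \<comment> \<open>With \<open>\<kappa> = c / 2\<close> the sum
      \<open>(n + 1) \<kappa> - \<Lambda> / 2\<close> is
      \<open>(n + 1 - \<Lambda> / c) \<kappa>\<close>; this fixes \<open>\<beta>\<close>.\<close>
    from wirtinger_diff[OF A1 wirtinger_cmult[OF w\<theta>M[OF t', of a\<^sub>0], of "of_nat (Suc CARD('n))"]]
    show "\<exists>a. wirtinger \<nu> a ((of_nat (Suc CARD('n)) - complex_of_real (\<Lambda> / c)) * (\<kappa> * \<rho> t)) t"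
      unfolding \<nu>_def[abs_def] g0
      by (rule wirtinger_exI) (use c in \<open>simp add: \<kappa>_def field_simps del: of_nat_Suc\<close>)
  qed
qed

end

lemma (in kaehler_einstein_submanifold) einstein_constant_rational:
  assumes "U \<noteq> {}"
  shows "\<exists>q\<in>\<rat>. \<Lambda> = q * c"
proof -
  obtain p where p: "p \<in> U" using assms by blast
  \<comment> \<open>Any coordinate direction serves for the disc.\<close>
  define a0 where "a0 = (undefined :: 'n)"
  have "\<exists>r>0. (\<forall>t\<in>ball 0 r. p + t *s axis a0 1 \<in> U) \<and> (\<lambda>t. D (p + t *s axis a0 1) (axis a 1) $ k) holomorphic_on ball 0 r" for a k
    by (rule holomorphic_directional[OF M.open_U p deriv complex_linear])
  then obtain R where R: "\<And>a k. R a k > 0" "\<And>a k t. t \<in> ball 0 (R a k) \<Longrightarrow> p + t *s axis a0 1 \<in> U"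
    "\<And>a k. (\<lambda>t. D (p + t *s axis a0 1) (axis a 1) $ k) holomorphic_on ball 0 (R a k)" by metis
  \<comment> \<open>One radius for the finitely many components of the differential.\<close>
  define r where "r = Min (range (\<lambda>(a, k). R a k))"
  have r: "r \<le> R a k" for a k unfolding r_def by (rule Min_le) (auto intro: image_eqI[of _ _ "(a, k)"])
  have "r \<in> range (\<lambda>(a, k). R a k)" unfolding r_def by (rule Min_in) auto
  then have r0: "r > 0" using R(1) by auto
  interpret kaehler_einstein_disc U G V H c \<psi> D \<Lambda> p a0 r
  proof
    show "0 < r" by fact
    show "p + t *s axis a0 1 \<in> U" if "t \<in> ball 0 r" for t
      by (rule R(2)[where a = undefined and k = undefined]) (use r[of undefined undefined] that in auto)
    show "(\<lambda>t. D (p + t *s axis a0 1) (axis a 1) $ k) holomorphic_on ball 0 r" for a k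
      using holomorphic_on_subset[OF R(3)] r[of a k] by (simp add: subset_ball)
  qed
  show ?thesis
  proof (cases "c = 0")
    case True
    then show ?thesis using flat by (intro bexI[of _ 0]) auto
  next
    case False
    from Rats_diff[OF Rats_of_nat[of "Suc CARD('n)"] curved[OF False]] have "complex_of_real (\<Lambda> / c) \<in> \<rat>" by simp
    \<comment> \<open>Rationality was obtained for a complex number; the quotient of integers brings
      it back to the reals.\<close>
    then obtain a b :: int where "complex_of_real (\<Lambda> / c) = of_int a / of_int b" by (rule Rats_cases')
    then have "complex_of_real (\<Lambda> / c) = complex_of_real (of_int a / of_int b)" by simp
    then have "\<Lambda> / c = of_int a / of_int b" by (simp only: of_real_eq_iff)
    then have "\<Lambda> / c \<in> \<rat>" by simp
    moreover have "\<Lambda> = \<Lambda> / c * c" using False by simp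
    ultimately show ?thesis by (rule bexI[rotated])
  qed
qed

section \<open>Manifolds\<close>

lemma C_on_subset: "C_on k S f \<Longrightarrow> T \<subseteq> S \<Longrightarrow> C_on k T f"
  by (induction k arbitrary: f) (auto intro: continuous_on_subset)

lemma kaehler_on_subset: assumes "kaehler_on S G" "T \<subseteq> S" shows "kaehler_on T G"
proof -
  have sm: "smooth_on S f \<Longrightarrow> smooth_on T f" for f :: "complex ^ 'a \<Rightarrow> real"
    using C_on_subset[OF _ assms(2)] unfolding smooth_on_def by blast
  have ball: "\<forall>x\<in>S. P x \<Longrightarrow> \<forall>x\<in>T. P x" for P using assms(2) by blast
  show ?thesis using assms(1) unfolding kaehler_on_def pseudo_riemannian_on_def
    by (elim conjE) (intro conjI allI; (erule ball | (rule sm, simp)))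
qed

lemma complex_manifold_chart:
  assumes "complex_manifold X A" "C \<in> A"
  shows "openin X (fst C)" "open (snd C ` fst C)"
    "homeomorphic_map (subtopology X (fst C)) (top_of_set (snd C ` fst C)) (snd C)"
  using assms unfolding complex_manifold_def by (auto simp: case_prod_beta)

theorem corollary1p6:
  fixes M :: "'a topology" and A :: "('a, 'n::finite) chart set" and g :: "('a, 'n) metric"
    and S :: "'b topology" and B :: "('b, 'm::finite) chart set" and g\<^sub>c :: "('b, 'm) metric"
    and \<phi> :: "'a \<Rightarrow> 'b" and c \<Lambda> :: real
  assumes "indefinite_complex_space_form S B g\<^sub>c c"
    and "kaehler_einstein M A g \<Lambda>"
    and "kaehler_immersion M A g S B g\<^sub>c \<phi>"
  shows "\<exists>q\<in>\<rat>. \<Lambda> = q * c"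
proof -
  have S: "complex_manifold S B" "\<forall>E\<in>B. kaehler_on (snd E ` fst E) (g\<^sub>c E)"
    "\<forall>E\<in>B. \<forall>x \<in> snd E ` fst E. \<forall>v. g\<^sub>c E x v v \<noteq> 0 \<longrightarrow> sectional_curvature (g\<^sub>c E) x v (J v) = 2 * c"
    using assms(1) unfolding indefinite_complex_space_form_def indefinite_kaehler_manifold_def by blast+
  have M: "complex_manifold M A" "\<forall>C\<in>A. kaehler_on (snd C ` fst C) (g C)"
    "\<forall>C\<in>A. \<forall>x \<in> snd C ` fst C. \<forall>v. v \<noteq> 0 \<longrightarrow> g C x v v > 0"
    "\<forall>C\<in>A. \<forall>x \<in> snd C ` fst C. \<forall>u v. ricci (g C) x u v = \<Lambda> * g C x u v"
    using assms(2) unfolding kaehler_einstein_def kaehler_manifold_def indefinite_kaehler_manifold_def by blast+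
  have \<phi>: "continuous_map M S \<phi>" "holomorphic_in_charts A B \<phi>" "pullback_eq A g B g\<^sub>c \<phi>"
    using assms(3) unfolding kaehler_immersion_def holomorphic_map_def by blast+
  \<comment> \<open>Since \<open>\<Lambda>\<close> is the same constant in every chart, a
    neighbourhood of one point decides.\<close>
  obtain p C where C: "C \<in> A" and p: "p \<in> fst C" "p \<in> topspace M"
    using M(1) unfolding complex_manifold_def by blast
  have "\<phi> p \<in> topspace S" using continuous_map_image_subset_topspace[OF \<phi>(1)] p(2) by blast
  then obtain E where E: "E \<in> B" "\<phi> p \<in> fst E"
    using S(1) unfolding complex_manifold_def by blast
  note chC = complex_manifold_chart[OF M(1) C] and chE = complex_manifold_chart[OF S(1) E(1)]
  have sub: "fst C \<subseteq> topspace M" using chC(1) by (rule openin_subset)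
  \<comment> \<open>The part of the chart \<open>C\<close> that is mapped into the single chart
    \<open>E\<close>, so that the immersion becomes a map between open sets of coordinate
    spaces.\<close>
  define W where "W = fst C \<inter> \<phi> -` fst E"
  define U where "U = snd C ` W"
  have W: "p \<in> W" "W \<subseteq> fst C" using p E by (auto simp: W_def)
  have US: "U \<subseteq> snd C ` fst C" using W by (auto simp: U_def)
  have "openin (subtopology M (fst C)) W"
    unfolding openin_subtopology
  proof (intro exI conjI)
    show "openin M {x \<in> topspace M. \<phi> x \<in> fst E}"
      by (rule openin_continuous_map_preimage[OF \<phi>(1) chE(1)])
    show "W = {x \<in> topspace M. \<phi> x \<in> fst E} \<inter> fst C" using sub by (auto simp: W_def)
  qed
  then have "openin (top_of_set (snd C ` fst C)) U"
    using homeomorphic_imp_open_map[OF chC(3)] unfolding open_map_def U_def by blast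
  then have oU: "open U" using chC(2) by (simp add: openin_open_eq)
  have "topspace (subtopology M (fst C)) = fst C" using sub by auto
  then have inj: "inj_on (snd C) (fst C)" using homeomorphic_imp_injective_map[OF chC(3)] by simp
  define \<psi> where "\<psi> = local_rep C E \<phi>"
  have \<psi>: "\<psi> (snd C q) = snd E (\<phi> q)" if "q \<in> fst C" for q
    using inv_into_f_f[OF inj that] by (simp add: \<psi>_def local_rep_def)
  have D: "(\<psi> has_derivative frechet_derivative \<psi> (at x)) (at x)"
      "frechet_derivative \<psi> (at x) (J v) = J (frechet_derivative \<psi> (at x) v)" if x: "x \<in> U" for x v
  proof -
    have "holomorphic_vec_on U \<psi>" using \<phi>(2) C E(1) unfolding holomorphic_in_charts_def U_def W_def \<psi>_def by blast
    then obtain D where D: "(\<psi> has_derivative D) (at x)" "\<And>v. D (J v) = J (D v)"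
      using x unfolding holomorphic_vec_on_def by blast
    have "D = frechet_derivative \<psi> (at x)" by (rule frechet_derivative_at[OF D(1)])
    with D show "(\<psi> has_derivative frechet_derivative \<psi> (at x)) (at x)"
      "frechet_derivative \<psi> (at x) (J v) = J (frechet_derivative \<psi> (at x) v)" by simp_all
  qed
  interpret kaehler_einstein_submanifold U "g C" "snd E ` fst E" "g\<^sub>c E" c \<psi> "\<lambda>x. frechet_derivative \<psi> (at x)" \<Lambda>
  proof unfold_locales
    show "open U" by (rule oU)
    show "kaehler_on U (g C)" using M(2) C kaehler_on_subset[OF _ US] by blast
    show "open (snd E ` fst E)" by (rule chE(2))
    show "kaehler_on (snd E ` fst E) (g\<^sub>c E)" using S(2) E(1) by blast
    show "sectional_curvature (g\<^sub>c E) x v (J v) = 2 * c" if "x \<in> snd E ` fst E" "g\<^sub>c E x v v \<noteq> 0" for x v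
      using S(3) E(1) that by blast
    fix x assume x: "x \<in> U"
    then obtain q where q: "q \<in> W" "x = snd C q" unfolding U_def by blast
    then have q': "q \<in> fst C" "\<phi> q \<in> fst E" by (auto simp: W_def)
    show "\<psi> x \<in> snd E ` fst E" unfolding q(2) \<psi>[OF q'(1)] using q'(2) by blast
    show "(\<psi> has_derivative frechet_derivative \<psi> (at x)) (at x)" by (rule D(1)[OF x])
    show "frechet_derivative \<psi> (at x) (J v) = J (frechet_derivative \<psi> (at x) v)" for v by (rule D(2)[OF x])
    show "g C x u v = g\<^sub>c E (\<psi> x) (frechet_derivative \<psi> (at x) u) (frechet_derivative \<psi> (at x) v)" for u v
      using \<phi>(3) C E(1) q' unfolding pullback_eq_def q(2) \<psi>[OF q'(1)] unfolding \<psi>_def by blast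
    show "0 < g C x v v" if "v \<noteq> 0" for v using M(3) C US x that by blast
    show "ricci (g C) x u v = \<Lambda> * g C x u v" for u v using M(4) C US x by blast
  qed
  show ?thesis by (rule einstein_constant_rational) (use W in \<open>auto simp: U_def\<close>)
qed

end
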